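(* Let $S$ be a finitely generated subgroup of a double $D$ of a LERF group $G$ along a finitely generated subgroup $G_0$, such that the intersection of $S$ with any conjugate of $G_0$ in $D$ is finitely generated. If $G_0$ is strongly separable in $G$, then $S$ is closed in $\mathrm{PT}(D)$. Hence if $G_0$ is strongly separable in $G$ and $G_0$ has fgip in $D$, then $D$ is LERF.
   Context: Groups. The profinite topology $\mathrm{PT}(G)$ on a group $G$ is the topology in which the finite index subgroups form a base of open neighborhoods of the identity. $G$ is LERF if every finitely generated subgroup of $G$ is closed in $\mathrm{PT}(G)$. The double of $G$ along $G_0$ is $D=G*_{G_0=H_0}H$, where $H$ is an isomorphic copy of $G$ with a fixed isomorphism $\alpha:G\to H$, $H_0=\alpha(G_0)$, and $G_0$ is identified with $H_0$ via $\alpha$. A subgroup $G_0$ of $D$ has fgip in $D$ if the intersection of $G_0$ with any finitely generated subgroup of $D$ is finitely generated. Graphs. For a set $X$, $X^*=\{x,x^{-1}\mid x\in X\}$. Graphs are oriented, each edge $e$ has an inverse $\bar e$; a labeling by $X^*$ assigns $\mathrm{Lab}(e)\in X^*$ with $\mathrm{Lab}(\bar e)=\mathrm{Lab}(e)^{-1}$; the label of a path is the product of the labels of its edges. If $G$ is generated by $X$ and $S\le G$, the relative Cayley graph $\mathrm{Cayley}(G,S)$ has as vertices the right cosets $Sg$ and for each $Sg$ and $x\in X^*$ an edge from $Sg$ to $Sgx$ labeled $x$. Relative Cayley graphs of $G$ are called covers of $G$. For a labeled graph $\Gamma$ and vertex $v$, $\mathrm{Lab}(\Gamma,v)$ is the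 subgroup of $G$ of all labels of loops in $\Gamma$ beginning at $v$. Embeddings of graphs preserve labels (and base vertices). The subgraphs considered below are connected. If $(\Delta,u)$ is a subgraph of a cover of $G$ with base vertex $u$, it embeds in $\mathrm{Cayley}(G,\mathrm{Lab}(\Delta,u))$ with $u$ mapped to the vertex $\mathrm{Lab}(\Delta,u)\cdot 1$; this based relative Cayley graph is denoted $(\tilde\Delta,u)$, and $\Delta$ is identified with its image in $\tilde\Delta$. For $X_1\subseteq X$, the $X_1^*$-component of a vertex $w$ in a graph is the maximal connected subgraph containing $w$ all of whose edges are labeled in $X_1^*$ (the single vertex $w$ if there are no such edges at $w$). A graph is $X_1^*$-saturated at $v$ if for every $s\in X_1^*$ an edge labeled $s$ begins at $v$. Strong separability. Let $G_0$ be a finitely generated subgroup of $G$; choose generating sets $X_1$ of $G_0$ and $X$ of $G$ such that $X_1$ is a finite subset of $X$. A subgraph $\Gamma'$ of a cover $\tilde\Gamma$ has properties $4'$, $5'$, $7'$ in $\tilde\Gamma$ if: ($4'$) for any vertex $w$ of $\Gamma'$ and any $g\in\mathrm{Lab}(\tilde\Gamma,w)\cap G_0$ there is a loop beginning at $w$ in the $X_1^*$-component of $w$ in $\Gamma'$ with label equal to $g$; ($5'$) any two vertices of $\Gamma'$ are joined by a path in $\tilde\Gamma$ labeled by an element of $G_0$ if and only if they belong to the same $X_1^*$-component of $\Gamma'$; ($7'$) $\Gamma'$ is $X_1^*$-saturated at any vertex $v$ such that $\mathrm{Lab}(\tilde\Gamma,v)\cap G_0$ has finite index in $G_0$. $G_0$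 is strongly separable in $G$ if for any finitely generated subgroups $S_1,S_2$ of $G$ such that $S_1\cap G_0$ and $S_2\cap G_0$ are equal and have infinite index in $G_0$, and for any finite subgraphs $(\Gamma_1,v_1)$, $(\Gamma_2,v_2)$ of covers of $G$ with $\mathrm{Lab}(\Gamma_i,v_i)=S_i$, there exist, for $i=1,2$, finite subgraphs $\Gamma'_i$ of $\tilde\Gamma_i$ which contain $\Gamma_i$ and have properties $4'$, $5'$, $7'$ in $\tilde\Gamma_i$, and embeddings $(\Gamma'_i,v_i)\to(\Delta_i,v_i)$ such that: (a) $\Delta_i$ is a finite subgraph of a cover of $G$ such that the $X_1^*$-component of $v_i$ in $\Delta_i$ is a cover of $G_0$ (with respect to $X_1$); and if an edge $e$ of $\Delta_i$ does not belong to $\Gamma'_i$, then $e$ belongs to the $X_1^*$-component of $v_i$ in $\Delta_i$; (b) $\mathrm{Lab}(\Delta_1,v_1)\cap G_0=\mathrm{Lab}(\Delta_2,v_2)\cap G_0$; (c) if a vertex $u_i$ of $\Gamma'_i$ does not belong to the $X_1^*$-component of $v_i$ in $\tilde\Gamma_i$, then $\mathrm{Lab}(\tilde\Gamma_i,u_i)\cap G_0=\mathrm{Lab}(\tilde\Delta_i,u_i)\cap G_0$; (d) a pair of vertices in the image of $\Gamma'_i$ belongs to the same $X_1^*$-component in $\tilde\Delta_i$ if and only if it belongs to the same $X_1^*$-component in $\tilde\Gamma_i$. *)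

theory Defs
  imports "HOL-Algebra.Generated_Groups" "HOL-Analysis.Abstract_Topology"
begin

section \<open>Profinite topology, LERF groups, fgip\<close>

definition fin_gen :: "('a, 'm) monoid_scheme \<Rightarrow> 'a set \<Rightarrow> bool" where
  "fin_gen G S \<longleftrightarrow> (\<exists>A. finite A \<and> A \<subseteq> carrier G \<and> S = generate G A)"

definition finite_index :: "('a, 'm) monoid_scheme \<Rightarrow> 'a set \<Rightarrow> bool" where
  "finite_index G K \<longleftrightarrow> finite (rcosets\<^bsub>G\<^esub> K)"

definition profinite_topology :: "('a, 'm) monoid_scheme \<Rightarrow> 'a topology" where
  "profinite_topology G = topology (\<lambda>U. U \<subseteq> carrier G \<and>
     (\<forall>g\<in>U. \<exists>K. subgroup K G \<and> finite_index G K \<and> g <#\<^bsub>G\<^esub> K \<subseteq> U))"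

lemma (in group) finite_index_Int:
  assumes K: "subgroup K G" "finite_index G K" and L: "subgroup L G" "finite_index G L"
  shows "finite_index G (K \<inter> L)"
proof -
  have "rcosets\<^bsub>G\<^esub> (K \<inter> L) \<subseteq> (\<lambda>(A, B). A \<inter> B) ` ((rcosets\<^bsub>G\<^esub> K) \<times> (rcosets\<^bsub>G\<^esub> L))"
  proof
    fix C assume "C \<in> rcosets\<^bsub>G\<^esub> (K \<inter> L)"
    then obtain a where a: "a \<in> carrier G" "C = (K \<inter> L) #> a"
      by (auto simp: RCOSETS_def)
    have "(K \<inter> L) #> a = (K #> a) \<inter> (L #> a)"
      using a(1) subgroup.mem_carrier[OF K(1)] subgroup.mem_carrier[OF L(1)]
      by (fastforce simp: r_coset_def)
    then show "C \<in> (\<lambda>(A, B). A \<inter> B) ` ((rcosets\<^bsub>G\<^esub> K) \<times> (rcosets\<^bsub>G\<^esub> L))"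
      using a by (auto simp: RCOSETS_def image_def)
  qed
  then show ?thesis
    using K(2) L(2) unfolding finite_index_def by (meson finite_SigmaI finite_imageI finite_subset)
qed

lemma (in group) openin_profinite_topology:
  "openin (profinite_topology G) U \<longleftrightarrow> U \<subseteq> carrier G \<and>
     (\<forall>g\<in>U. \<exists>K. subgroup K G \<and> finite_index G K \<and> g <# K \<subseteq> U)"
proof -
  let ?P = "\<lambda>U. U \<subseteq> carrier G \<and> (\<forall>g\<in>U. \<exists>K. subgroup K G \<and> finite_index G K \<and> g <# K \<subseteq> U)"
  have "?P (U \<inter> V)" if U: "?P U" and V: "?P V" for U V
  proof (intro conjI ballI)
    show "U \<inter> V \<subseteq> carrier G" using U by blast
    fix g assume "g \<in> U \<inter> V"
    then obtain K L where "subgroup K G" "finite_index G K" "g <# K \<subseteq> U"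
      "subgroup L G" "finite_index G L" "g <# L \<subseteq> V" using U V by blast
    then show "\<exists>K. subgroup K G \<and> finite_index G K \<and> g <# K \<subseteq> U \<inter> V"
      by (intro exI[of _ "K \<inter> L"]) (auto simp: finite_index_Int subgroups_Inter_pair l_coset_def)
  qed
  moreover have "?P (\<Union>\<K>)" if "\<forall>U\<in>\<K>. ?P U" for \<K>
    using that by (meson Sup_least UnionE Union_upper order_trans)
  ultimately have "istopology ?P" unfolding istopology_def by blast
  then show ?thesis
    unfolding profinite_topology_def by (simp add: topology_inverse')
qed

lemma (in group) topspace_profinite_topology: "topspace (profinite_topology G) = carrier G"
proof -
  have "finite_index G (carrier G)"
  proof -
    have "rcosets\<^bsub>G\<^esub> (carrier G) \<subseteq> {carrier G}"
      by (auto simp: RCOSETS_def coset_join2 subgroup_self)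
    then show ?thesis unfolding finite_index_def by (rule finite_subset) simp
  qed
  then have "openin (profinite_topology G) (carrier G)"
    unfolding openin_profinite_topology
    by (auto intro!: exI[of _ "carrier G"] simp: subgroup_self l_coset_def)
  then show ?thesis
    by (metis openin_profinite_topology openin_subset openin_topspace subset_antisym)
qed

definition LERF :: "('a, 'm) monoid_scheme \<Rightarrow> bool" where
  "LERF G \<longleftrightarrow> (\<forall>S. fin_gen G S \<longrightarrow> closedin (profinite_topology G) S)"

definition fgip :: "('a, 'm) monoid_scheme \<Rightarrow> 'a set \<Rightarrow> bool" where
  "fgip G K \<longleftrightarrow> subgroup K G \<and> (\<forall>S. fin_gen G S \<longrightarrow> fin_gen G (K \<inter> S))"


section \<open>Amalgamated free products and doubles\<close>

text \<open>The free product of \<open>A\<close> and \<open>B\<close> with \<open>c \<in> C \<le> A\<close> identified with \<open>\<phi> c\<close>: words with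
  letters in the disjoint union of the two carriers, modulo the congruence generated by the
  multiplication tables of \<open>A\<close> and \<open>B\<close> and by the identification of \<open>c\<close> with \<open>\<phi> c\<close>.\<close>

definition amalg_words :: "('a, 'm) monoid_scheme \<Rightarrow> ('b, 'n) monoid_scheme \<Rightarrow> ('a + 'b) list set" where
  "amalg_words A B = lists (carrier A <+> carrier B)"

inductive amalg_eq ::
  "('a, 'm) monoid_scheme \<Rightarrow> ('b, 'n) monoid_scheme \<Rightarrow> 'a set \<Rightarrow> ('a \<Rightarrow> 'b)
     \<Rightarrow> ('a + 'b) list \<Rightarrow> ('a + 'b) list \<Rightarrow> bool"
  for A B C \<phi> where
  refl: "u \<in> amalg_words A B \<Longrightarrow> amalg_eq A B C \<phi> u u"
| sym: "amalg_eq A B C \<phi> u v \<Longrightarrow> amalg_eq A B C \<phi> v u"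
| trans: "amalg_eq A B C \<phi> u v \<Longrightarrow> amalg_eq A B C \<phi> v w \<Longrightarrow> amalg_eq A B C \<phi> u w"
| append: "amalg_eq A B C \<phi> u u' \<Longrightarrow> amalg_eq A B C \<phi> v v' \<Longrightarrow> amalg_eq A B C \<phi> (u @ v) (u' @ v')"
| one_left: "amalg_eq A B C \<phi> [Inl \<one>\<^bsub>A\<^esub>] []"
| one_right: "amalg_eq A B C \<phi> [Inr \<one>\<^bsub>B\<^esub>] []"
| mult_left: "a \<in> carrier A \<Longrightarrow> a' \<in> carrier A \<Longrightarrow>
    amalg_eq A B C \<phi> [Inl a, Inl a'] [Inl (a \<otimes>\<^bsub>A\<^esub> a')]"
| mult_right: "b \<in> carrier B \<Longrightarrow> b' \<in> carrier B \<Longrightarrow>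
    amalg_eq A B C \<phi> [Inr b, Inr b'] [Inr (b \<otimes>\<^bsub>B\<^esub> b')]"
| glue: "c \<in> C \<Longrightarrow> amalg_eq A B C \<phi> [Inl c] [Inr (\<phi> c)]"

definition amalg_class ::
  "('a, 'm) monoid_scheme \<Rightarrow> ('b, 'n) monoid_scheme \<Rightarrow> 'a set \<Rightarrow> ('a \<Rightarrow> 'b)
     \<Rightarrow> ('a + 'b) list \<Rightarrow> ('a + 'b) list set" where
  "amalg_class A B C \<phi> u = {v. amalg_eq A B C \<phi> u v}"

definition amalgam ::
  "('a, 'm) monoid_scheme \<Rightarrow> ('b, 'n) monoid_scheme \<Rightarrow> 'a set \<Rightarrow> ('a \<Rightarrow> 'b)
     \<Rightarrow> ('a + 'b) list set monoid" where
  "amalgam A B C \<phi> =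
     \<lparr> carrier = amalg_class A B C \<phi> ` amalg_words A B,
       monoid.mult = (\<lambda>P Q. \<Union>u\<in>P. \<Union>v\<in>Q. amalg_class A B C \<phi> (u @ v)),
       one = amalg_class A B C \<phi> [] \<rparr>"

definition double ::
  "('a, 'm) monoid_scheme \<Rightarrow> 'a set \<Rightarrow> ('b, 'n) monoid_scheme \<Rightarrow> ('a \<Rightarrow> 'b)
     \<Rightarrow> ('a + 'b) list set monoid" where
  "double G G\<^sub>0 H \<alpha> = amalgam G H G\<^sub>0 \<alpha>"

text \<open>\<open>G\<close> and its subgroups are regarded as subgroups of the double via this map.\<close>

definition double_incl ::
  "('a, 'm) monoid_scheme \<Rightarrow> 'a set \<Rightarrow> ('b, 'n) monoid_scheme \<Rightarrow> ('a \<Rightarrow> 'b)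
     \<Rightarrow> 'a \<Rightarrow> ('a + 'b) list set" where
  "double_incl G G\<^sub>0 H \<alpha> g = amalg_class G H G\<^sub>0 \<alpha> [Inl g]"

lemma amalg_class_eqI: "amalg_eq A B C \<phi> u v \<Longrightarrow> amalg_class A B C \<phi> u = amalg_class A B C \<phi> v"
  unfolding amalg_class_def by (blast intro: amalg_eq.sym amalg_eq.trans)

lemma amalg_mult_class:
  assumes "u \<in> amalg_words A B" "v \<in> amalg_words A B"
  shows "amalg_class A B C \<phi> u \<otimes>\<^bsub>amalgam A B C \<phi>\<^esub> amalg_class A B C \<phi> v = amalg_class A B C \<phi> (u @ v)"
proof -
  have "amalg_class A B C \<phi> (u' @ v') = amalg_class A B C \<phi> (u @ v)"
    if "u' \<in> amalg_class A B C \<phi> u" "v' \<in> amalg_class A B C \<phi> v" for u' v'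
    using that unfolding amalg_class_def[of A B C \<phi> u] amalg_class_def[of A B C \<phi> v] mem_Collect_eq
    by (rule amalg_class_eqI[OF amalg_eq.append, symmetric])
  moreover have "u \<in> amalg_class A B C \<phi> u" "v \<in> amalg_class A B C \<phi> v"
    using assms by (auto simp: amalg_class_def amalg_eq.refl)
  ultimately have "(\<Union>u'\<in>amalg_class A B C \<phi> u. \<Union>v'\<in>amalg_class A B C \<phi> v. amalg_class A B C \<phi> (u' @ v'))
      = amalg_class A B C \<phi> (u @ v)"
    by blast
  then show ?thesis
    by (simp add: amalgam_def)
qed

lemma amalg_inverse_word:
  assumes "group A" "group B" "u \<in> amalg_words A B"
  shows "\<exists>v\<in>amalg_words A B. amalg_eq A B C \<phi> (v @ u) []"
  using assms(3)
proof (induction u)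
  case Nil
  then show ?case by (auto simp: amalg_words_def intro!: bexI[of _ "[]"] amalg_eq.refl)
next
  case (Cons x u)
  then obtain v where v: "v \<in> amalg_words A B" "amalg_eq A B C \<phi> (v @ u) []"
    by (auto simp: amalg_words_def)
  have x: "x \<in> carrier A <+> carrier B" and u: "u \<in> amalg_words A B"
    using Cons.prems by (auto simp: amalg_words_def)
  obtain y where y: "y \<in> carrier A <+> carrier B" "amalg_eq A B C \<phi> [y, x] []"
  proof (cases x)
    case (Inl a)
    then have a: "a \<in> carrier A" using x by auto
    have i: "inv\<^bsub>A\<^esub> a \<in> carrier A" using a group.inv_closed[OF assms(1)] by blast
    have "amalg_eq A B C \<phi> [Inl (inv\<^bsub>A\<^esub> a), Inl a] [Inl \<one>\<^bsub>A\<^esub>]"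
      using amalg_eq.mult_left[OF i a, of B C \<phi>] by (simp add: group.l_inv[OF assms(1) a])
    from amalg_eq.trans[OF this amalg_eq.one_left]
    show ?thesis using that[of "Inl (inv\<^bsub>A\<^esub> a)"] Inl i by auto
  next
    case (Inr b)
    then have b: "b \<in> carrier B" using x by auto
    have i: "inv\<^bsub>B\<^esub> b \<in> carrier B" using b group.inv_closed[OF assms(2)] by blast
    have "amalg_eq A B C \<phi> [Inr (inv\<^bsub>B\<^esub> b), Inr b] [Inr \<one>\<^bsub>B\<^esub>]"
      using amalg_eq.mult_right[OF i b, of A C \<phi>] by (simp add: group.l_inv[OF assms(2) b])
    from amalg_eq.trans[OF this amalg_eq.one_right]
    show ?thesis using that[of "Inr (inv\<^bsub>B\<^esub> b)"] Inr i by auto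
  qed
  have "amalg_eq A B C \<phi> (v @ [y, x] @ u) (v @ [] @ u)"
    by (rule amalg_eq.append[OF amalg_eq.refl[OF v(1)] amalg_eq.append[OF y(2) amalg_eq.refl[OF u]]])
  then have "amalg_eq A B C \<phi> (v @ [y, x] @ u) (v @ u)"
    by simp
  from amalg_eq.trans[OF this v(2)] have "amalg_eq A B C \<phi> ((v @ [y]) @ x # u) []"
    by simp
  then show ?case using v(1) y(1)
    by (intro bexI[of _ "v @ [y]"]) (auto simp: amalg_words_def)
qed

lemma group_amalgam:
  assumes "group A" "group B"
  shows "group (amalgam A B C \<phi>)"
proof -
  have car: "carrier (amalgam A B C \<phi>) = amalg_class A B C \<phi> ` amalg_words A B"
    and one: "\<one>\<^bsub>amalgam A B C \<phi>\<^esub> = amalg_class A B C \<phi> []"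
    by (simp_all add: amalgam_def)
  have nil: "[] \<in> amalg_words A B" by (simp add: amalg_words_def)
  have app: "u @ v \<in> amalg_words A B" if "u \<in> amalg_words A B" "v \<in> amalg_words A B" for u v
    using that by (simp add: amalg_words_def)
  show ?thesis
  proof (rule groupI)
    fix x assume "x \<in> carrier (amalgam A B C \<phi>)"
    then obtain u where u: "u \<in> amalg_words A B" "x = amalg_class A B C \<phi> u" by (auto simp: car)
    then obtain v where v: "v \<in> amalg_words A B" "amalg_eq A B C \<phi> (v @ u) []"
      using amalg_inverse_word[OF assms] by blast
    show "\<exists>y\<in>carrier (amalgam A B C \<phi>). y \<otimes>\<^bsub>amalgam A B C \<phi>\<^esub> x = \<one>\<^bsub>amalgam A B C \<phi>\<^esub>"
      using u v amalg_class_eqI[OF v(2)]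
      by (intro bexI[of _ "amalg_class A B C \<phi> v"]) (simp_all add: car one amalg_mult_class)
  qed (auto simp: car one amalg_mult_class nil app)
qed

lemma double_incl_hom:
  "double_incl G G\<^sub>0 H \<alpha> \<in> hom G (double G G\<^sub>0 H \<alpha>)"
proof (rule homI)
  fix x y assume xy: "x \<in> carrier G" "y \<in> carrier G"
  then have "[Inl x] \<in> amalg_words G H" "[Inl y] \<in> amalg_words G H"
    by (auto simp: amalg_words_def)
  from amalg_mult_class[OF this, of G\<^sub>0 \<alpha>]
  show "double_incl G G\<^sub>0 H \<alpha> (x \<otimes>\<^bsub>G\<^esub> y) =
      double_incl G G\<^sub>0 H \<alpha> x \<otimes>\<^bsub>double G G\<^sub>0 H \<alpha>\<^esub> double_incl G G\<^sub>0 H \<alpha> y"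
    using amalg_class_eqI[OF amalg_eq.mult_left[OF xy, of H G\<^sub>0 \<alpha>]]
    unfolding double_incl_def double_def by simp
qed (auto simp: double_incl_def double_def amalgam_def amalg_words_def)


section \<open>Labeled graphs\<close>

text \<open>An edge is a triple (initial vertex, label, terminal vertex); this suffices since in a
  relative Cayley graph an edge is determined by its initial vertex and its label.  The inverse of
  the edge \<open>(u, x, w)\<close> is \<open>(w, x\<^sup>-\<^sup>1, u)\<close>.  Labels are elements of the group.\<close>

record ('v, 'a) lgraph =
  verts :: "'v set"
  edges :: "('v \<times> 'a \<times> 'v) set"

definition star :: "('a, 'm) monoid_scheme \<Rightarrow> 'a set \<Rightarrow> 'a set" where
  "star G X = X \<union> m_inv G ` X"

definition cayley :: "('a, 'm) monoid_scheme \<Rightarrow> 'a set \<Rightarrow> 'a set \<Rightarrow> ('a set, 'a) lgraph" where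
  "cayley G X S = \<lparr> verts = rcosets\<^bsub>G\<^esub> S,
     edges = {(c, x, c #>\<^bsub>G\<^esub> x) | c x. c \<in> rcosets\<^bsub>G\<^esub> S \<and> x \<in> star G X} \<rparr>"

definition lsubgraph ::
  "('a, 'm) monoid_scheme \<Rightarrow> ('v, 'a) lgraph \<Rightarrow> ('v, 'a) lgraph \<Rightarrow> bool" where
  "lsubgraph G \<Delta> \<Gamma> \<longleftrightarrow> verts \<Delta> \<subseteq> verts \<Gamma> \<and> edges \<Delta> \<subseteq> edges \<Gamma> \<and>
     (\<forall>(u, x, w)\<in>edges \<Delta>. u \<in> verts \<Delta> \<and> w \<in> verts \<Delta> \<and> (w, inv\<^bsub>G\<^esub> x, u) \<in> edges \<Delta>)"

definition finite_lgraph :: "('v, 'a) lgraph \<Rightarrow> bool" where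
  "finite_lgraph \<Gamma> \<longleftrightarrow> finite (verts \<Gamma>) \<and> finite (edges \<Gamma>)"

fun lpath :: "('v, 'a) lgraph \<Rightarrow> 'v \<Rightarrow> ('v \<times> 'a \<times> 'v) list \<Rightarrow> 'v \<Rightarrow> bool" where
  "lpath \<Gamma> u [] w \<longleftrightarrow> u \<in> verts \<Gamma> \<and> w = u"
| "lpath \<Gamma> u ((a, x, b) # p) w \<longleftrightarrow> a = u \<and> (a, x, b) \<in> edges \<Gamma> \<and> lpath \<Gamma> b p w"

fun plabel :: "('a, 'm) monoid_scheme \<Rightarrow> ('v \<times> 'a \<times> 'v) list \<Rightarrow> 'a" where
  "plabel G [] = \<one>\<^bsub>G\<^esub>"
| "plabel G ((a, x, b) # p) = x \<otimes>\<^bsub>G\<^esub> plabel G p"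

definition lconnected :: "('v, 'a) lgraph \<Rightarrow> bool" where
  "lconnected \<Gamma> \<longleftrightarrow> (\<forall>u\<in>verts \<Gamma>. \<forall>w\<in>verts \<Gamma>. \<exists>p. lpath \<Gamma> u p w)"

definition Lab :: "('a, 'm) monoid_scheme \<Rightarrow> ('v, 'a) lgraph \<Rightarrow> 'v \<Rightarrow> 'a set" where
  "Lab G \<Gamma> v = {plabel G p | p. lpath \<Gamma> v p v}"

definition component :: "'a set \<Rightarrow> ('v, 'a) lgraph \<Rightarrow> 'v \<Rightarrow> ('v, 'a) lgraph" where
  "component Y \<Gamma> w =
     (let V = {u. \<exists>p. lpath \<Gamma> w p u \<and> (\<forall>(a, x, b)\<in>set p. x \<in> Y)}
      in \<lparr> verts = V, edges = {(a, x, b)\<in>edges \<Gamma>. a \<in> V \<and> x \<in> Y} \<rparr>)"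

definition saturated_at :: "'a set \<Rightarrow> ('v, 'a) lgraph \<Rightarrow> 'v \<Rightarrow> bool" where
  "saturated_at Y \<Gamma> v \<longleftrightarrow> (\<forall>s\<in>Y. \<exists>w. (v, s, w) \<in> edges \<Gamma>)"

definition graph_image :: "('v \<Rightarrow> 'w) \<Rightarrow> ('v, 'a) lgraph \<Rightarrow> ('w, 'a) lgraph" where
  "graph_image f \<Gamma> = \<lparr> verts = f ` verts \<Gamma>, edges = (\<lambda>(u, x, w). (f u, x, f w)) ` edges \<Gamma> \<rparr>"

definition lembedding :: "('a, 'm) monoid_scheme \<Rightarrow> ('v \<Rightarrow> 'w) \<Rightarrow> ('v, 'a) lgraph \<Rightarrow> ('w, 'a) lgraph \<Rightarrow> bool" where
  "lembedding G f \<Gamma> \<Delta> \<longleftrightarrow> inj_on f (verts \<Gamma>) \<and> lsubgraph G (graph_image f \<Gamma>) \<Delta>"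

definition lisomorphic :: "('v, 'a) lgraph \<Rightarrow> ('w, 'a) lgraph \<Rightarrow> bool" where
  "lisomorphic \<Gamma> \<Delta> \<longleftrightarrow> (\<exists>f. inj_on f (verts \<Gamma>) \<and> graph_image f \<Gamma> = \<Delta>)"

definition is_cover :: "('a, 'm) monoid_scheme \<Rightarrow> 'a set \<Rightarrow> ('v, 'a) lgraph \<Rightarrow> bool" where
  "is_cover G X \<Gamma> \<longleftrightarrow> (\<exists>S. subgroup S G \<and> lisomorphic \<Gamma> (cayley G X S))"

text \<open>The subgraphs of covers considered below are connected by convention.\<close>

definition fin_subgraph ::
  "('a, 'm) monoid_scheme \<Rightarrow> ('v, 'a) lgraph \<Rightarrow> ('v, 'a) lgraph \<Rightarrow> bool" where
  "fin_subgraph G \<Delta> \<Gamma> \<longleftrightarrow> lsubgraph G \<Delta> \<Gamma> \<and> finite_lgraph \<Delta> \<and> lconnected \<Delta>"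

definition fin_subgraph_of_cover ::
  "('a, 'm) monoid_scheme \<Rightarrow> 'a set \<Rightarrow> ('a set, 'a) lgraph \<Rightarrow> 'a set \<Rightarrow> bool" where
  "fin_subgraph_of_cover G X \<Delta> u \<longleftrightarrow>
     (\<exists>T. subgroup T G \<and> fin_subgraph G \<Delta> (cayley G X T)) \<and> u \<in> verts \<Delta>"

text \<open>\<open>tilde G X \<Delta> u\<close> is the cover \<open>\<Delta>~\<close> of the based graph \<open>(\<Delta>, u)\<close>; its base vertex is the coset
  \<open>Lab G \<Delta> u\<close>.  The embedding of \<open>\<Delta>\<close> in \<open>\<Delta>~\<close> maps a vertex \<open>w\<close> to \<open>Lab(\<Delta>, u) g\<close>, where \<open>g\<close> is
  the label of any path in \<open>\<Delta>\<close> from \<open>u\<close> to \<open>w\<close>; this coset is the set of the labels of all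
  paths in \<open>\<Delta>\<close> from \<open>u\<close> to \<open>w\<close> (see \<open>tilde_map_coset\<close>).\<close>

definition tilde :: "('a, 'm) monoid_scheme \<Rightarrow> 'a set \<Rightarrow> ('v, 'a) lgraph \<Rightarrow> 'v \<Rightarrow> ('a set, 'a) lgraph" where
  "tilde G X \<Delta> u = cayley G X (Lab G \<Delta> u)"

definition tilde_map :: "('a, 'm) monoid_scheme \<Rightarrow> ('v, 'a) lgraph \<Rightarrow> 'v \<Rightarrow> 'v \<Rightarrow> 'a set" where
  "tilde_map G \<Delta> u w = {plabel G p | p. lpath \<Delta> u p w}"


lemma lpath_append: "lpath \<Gamma> u p v \<Longrightarrow> lpath \<Gamma> v q w \<Longrightarrow> lpath \<Gamma> u (p @ q) w"
  by (induction p arbitrary: u) auto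

lemma lpath_verts: "lsubgraph G \<Gamma> \<Gamma>' \<Longrightarrow> lpath \<Gamma> u p w \<Longrightarrow> u \<in> verts \<Gamma> \<and> w \<in> verts \<Gamma>"
  by (induction p arbitrary: u) (auto simp: lsubgraph_def)

lemma lpath_rev:
  assumes "lsubgraph G \<Gamma> \<Gamma>'" "lpath \<Gamma> u p w"
  shows "\<exists>q. lpath \<Gamma> w q u"
  using assms(2)
proof (induction p arbitrary: u)
  case (Cons e p)
  obtain x b where e: "e = (u, x, b)" using Cons.prems by (cases e) auto
  have "(b, inv\<^bsub>G\<^esub> x, u) \<in> edges \<Gamma>" "u \<in> verts \<Gamma>"
    using Cons.prems assms(1) by (auto simp: e lsubgraph_def)
  then have "lpath \<Gamma> b [(b, inv\<^bsub>G\<^esub> x, u)] u" by simp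
  then show ?case using Cons lpath_append by (fastforce simp: e)
qed (auto intro: exI[of _ "[]"])

lemma component_maximal:
  assumes \<Gamma>: "lsubgraph G \<Gamma> \<Gamma>" and w: "w \<in> verts \<Gamma>"
    and Y: "\<And>x. x \<in> Y \<Longrightarrow> inv\<^bsub>G\<^esub> x \<in> Y"
  shows "lsubgraph G (component Y \<Gamma> w) \<Gamma>" "lconnected (component Y \<Gamma> w)"
    "w \<in> verts (component Y \<Gamma> w)" "\<forall>(a, x, b)\<in>edges (component Y \<Gamma> w). x \<in> Y"
    "\<And>\<Delta>. \<lbrakk>lsubgraph G \<Delta> \<Gamma>; lconnected \<Delta>; w \<in> verts \<Delta>; \<forall>(a, x, b)\<in>edges \<Delta>. x \<in> Y\<rbrakk>
       \<Longrightarrow> lsubgraph G \<Delta> (component Y \<Gamma> w)"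
proof -
  let ?C = "component Y \<Gamma> w"
  have V: "u \<in> verts ?C \<longleftrightarrow> (\<exists>p. lpath \<Gamma> w p u \<and> (\<forall>(a, x, b)\<in>set p. x \<in> Y))" for u
    by (simp add: component_def)
  have E: "(a, x, b) \<in> edges ?C \<longleftrightarrow> (a, x, b) \<in> edges \<Gamma> \<and> a \<in> verts ?C \<and> x \<in> Y" for a x b
    by (simp add: component_def)
  have step: "b \<in> verts ?C" if abx: "(a, x, b) \<in> edges ?C" for a x b
  proof -
    have e: "(a, x, b) \<in> edges \<Gamma>" "x \<in> Y" and "a \<in> verts ?C" using abx by (simp_all add: E)
    then obtain p where p: "lpath \<Gamma> w p a" "\<forall>(a, x, b)\<in>set p. x \<in> Y"
      unfolding V by blast
    have "lpath \<Gamma> b [] b" using e(1) \<Gamma> by (auto simp: lsubgraph_def)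
    then have "lpath \<Gamma> w (p @ [(a, x, b)]) b"
      using lpath_append[OF p(1), of "[(a, x, b)]" b] e(1) by simp
    then show ?thesis unfolding V using p(2) e(2) by (intro exI[of _ "p @ [(a, x, b)]"]) auto
  qed
  show w': "w \<in> verts ?C" unfolding V using w by (intro exI[of _ "[]"]) simp
  show "\<forall>(a, x, b)\<in>edges ?C. x \<in> Y" by (auto simp: E)
  have vG: "verts ?C \<subseteq> verts \<Gamma>" using lpath_verts[OF \<Gamma>] by (auto simp: V)
  have inv': "(b, inv\<^bsub>G\<^esub> x, a) \<in> edges ?C" if "(a, x, b) \<in> edges ?C" for a x b
    using that step[OF that] Y \<Gamma> unfolding E lsubgraph_def by blast
  show sub: "lsubgraph G ?C \<Gamma>"
    unfolding lsubgraph_def using vG step inv' by (auto simp: E)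
  then have subC: "lsubgraph G ?C ?C" by (auto simp: lsubgraph_def)
  have toC: "lpath ?C v p u" if "lpath \<Gamma> v p u" "\<forall>(a, x, b)\<in>set p. x \<in> Y" "v \<in> verts ?C" for v p u
    using that
  proof (induction p arbitrary: v)
    case (Cons e p)
    obtain a x b where e: "e = (a, x, b)" by (cases e)
    have "(v, x, b) \<in> edges ?C" using Cons.prems by (auto simp: e E)
    then show ?case using Cons step by (auto simp: e)
  qed simp
  have "\<exists>p. lpath ?C w p u" if "u \<in> verts ?C" for u
    using that toC[OF _ _ w'] unfolding V by blast
  then show "lconnected ?C"
    unfolding lconnected_def using lpath_rev[OF subC] lpath_append by metis
  fix \<Delta> assume \<Delta>: "lsubgraph G \<Delta> \<Gamma>" "lconnected \<Delta>" "w \<in> verts \<Delta>" "\<forall>(a, x, b)\<in>edges \<Delta>. x \<in> Y"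
  have path: "lpath \<Gamma> v p u \<and> (\<forall>(a, x, b)\<in>set p. x \<in> Y)" if "lpath \<Delta> v p u" for v p u
    using that
  proof (induction p arbitrary: v)
    case Nil
    then show ?case using \<Delta>(1) by (auto simp: lsubgraph_def)
  next
    case (Cons e p)
    obtain a x b where e: "e = (a, x, b)" by (cases e)
    have "(v, x, b) \<in> edges \<Delta>" "a = v" "lpath \<Delta> b p u" using Cons.prems by (auto simp: e)
    moreover from this have "x \<in> Y" "(v, x, b) \<in> edges \<Gamma>"
      using \<Delta>(1,4) by (auto simp: lsubgraph_def)
    ultimately show ?case using Cons.IH[of b] by (simp add: e)
  qed
  have "verts \<Delta> \<subseteq> verts ?C"
  proof
    fix u assume "u \<in> verts \<Delta>"
    then obtain p where "lpath \<Delta> w p u" using \<Delta>(2,3) unfolding lconnected_def by blast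
    then show "u \<in> verts ?C" unfolding V using path by blast
  qed
  then show "lsubgraph G \<Delta> ?C"
    using \<Delta>(1,4) unfolding lsubgraph_def by (fastforce simp: E)
qed

lemma (in group) plabel_closed:
  "\<lbrakk>\<forall>(a, x, b)\<in>edges \<Delta>. x \<in> carrier G; lpath \<Delta> u p w\<rbrakk> \<Longrightarrow> plabel G p \<in> carrier G"
proof (induction p arbitrary: u)
  case (Cons e p)
  obtain x b where "e = (u, x, b)" using Cons.prems by (cases e) auto
  then show ?case using Cons by auto
qed simp

lemma (in group) plabel_append:
  assumes L: "\<forall>(a, x, b)\<in>edges \<Delta>. x \<in> carrier G" and "lpath \<Delta> u p v" "lpath \<Delta> v q w"
  shows "plabel G (p @ q) = plabel G p \<otimes> plabel G q"
  using assms(2)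
proof (induction p arbitrary: u)
  case Nil
  then show ?case using plabel_closed[OF L assms(3)] by simp
next
  case (Cons e p)
  obtain x b where e: "e = (u, x, b)" using Cons.prems by (cases e) auto
  have "x \<in> carrier G" "lpath \<Delta> b p v" using Cons.prems L by (auto simp: e)
  then show ?case
    using Cons.IH plabel_closed[OF L] assms(3) by (simp add: e m_assoc)
qed

lemma (in group) lpath_rev_label:
  assumes L: "\<forall>(a, x, b)\<in>edges \<Delta>. x \<in> carrier G" and \<Delta>: "lsubgraph G \<Delta> \<Gamma>"
    and p: "lpath \<Delta> u p w"
  shows "\<exists>q. lpath \<Delta> w q u \<and> plabel G q = inv (plabel G p)"
  using p
proof (induction p arbitrary: u)
  case Nil
  then show ?case by (intro exI[of _ "[]"]) auto
next
  case (Cons e p)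
  obtain x b where e: "e = (u, x, b)" using Cons.prems by (cases e) auto
  have x: "x \<in> carrier G" and p: "lpath \<Delta> b p w" using Cons.prems L by (auto simp: e)
  obtain q where q: "lpath \<Delta> w q b" "plabel G q = inv (plabel G p)" using Cons.IH[OF p] by blast
  have r: "lpath \<Delta> b [(b, inv x, u)] u" using Cons.prems \<Delta> by (auto simp: e lsubgraph_def)
  have "plabel G (q @ [(b, inv x, u)]) = inv (x \<otimes> plabel G p)"
    unfolding plabel_append[OF L q(1) r] using x plabel_closed[OF L p] by (simp add: q(2) inv_mult_group)
  then show ?case using lpath_append[OF q(1) r] by (intro exI[of _ "q @ [(b, inv x, u)]"]) (simp add: e)
qed

lemma (in group) lpath_cayley:
  assumes T: "subgroup T G" and X: "X \<subseteq> carrier G" and \<Delta>: "lsubgraph G \<Delta> (cayley G X T)"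
    and p: "lpath \<Delta> u p w"
  shows "plabel G p \<in> carrier G \<and> w = u #> plabel G p"
  using p
proof (induction p arbitrary: u)
  case Nil
  then have "u \<in> rcosets T" using \<Delta> by (auto simp: lsubgraph_def cayley_def)
  then show ?case using Nil subgroup.rcosets_carrier[OF T is_group] by (simp add: coset_mult_one)
next
  case (Cons e p)
  obtain x b where e: "e = (u, x, b)" using Cons.prems by (cases e) auto
  have "(u, x, b) \<in> edges (cayley G X T)" using Cons.prems \<Delta> by (auto simp: e lsubgraph_def)
  then have "u \<in> rcosets T" and x: "x \<in> carrier G" and b: "b = u #> x"
    using X by (auto simp: cayley_def star_def)
  moreover from this have "u \<subseteq> carrier G" using subgroup.rcosets_carrier[OF T is_group] by blast
  moreover have "plabel G p \<in> carrier G" "w = b #> plabel G p" using Cons by (auto simp: e)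
  ultimately show ?case by (simp add: e coset_mult_assoc)
qed

lemma (in group) cayley_labels:
  assumes "X \<subseteq> carrier G" "lsubgraph G \<Delta> (cayley G X T)"
  shows "\<forall>(a, x, b)\<in>edges \<Delta>. x \<in> carrier G \<and> x \<in> star G X"
proof -
  have "\<forall>(a, x, b)\<in>edges (cayley G X T). x \<in> carrier G \<and> x \<in> star G X"
    using assms(1) by (auto simp: cayley_def star_def)
  then show ?thesis using assms(2) unfolding lsubgraph_def by blast
qed

lemma (in group) Lab_subgroup:
  assumes L: "\<forall>(a, x, b)\<in>edges \<Delta>. x \<in> carrier G" and \<Delta>: "lsubgraph G \<Delta> \<Gamma>" and u: "u \<in> verts \<Delta>"
  shows "subgroup (Lab G \<Delta> u) G"
proof (rule subgroupI)
  show "Lab G \<Delta> u \<subseteq> carrier G" using plabel_closed[OF L] by (auto simp: Lab_def)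
  show "Lab G \<Delta> u \<noteq> {}" using u by (auto simp: Lab_def intro!: exI[of _ "[]"])
  show "inv a \<in> Lab G \<Delta> u" if "a \<in> Lab G \<Delta> u" for a
    using that lpath_rev_label[OF L \<Delta>] unfolding Lab_def mem_Collect_eq by metis
  show "a \<otimes> b \<in> Lab G \<Delta> u" if "a \<in> Lab G \<Delta> u" "b \<in> Lab G \<Delta> u" for a b
    using that plabel_append[OF L] lpath_append unfolding Lab_def mem_Collect_eq by metis
qed

lemma (in group) tilde_map_coset:
  assumes L: "\<forall>(a, x, b)\<in>edges \<Delta>. x \<in> carrier G" and \<Delta>: "lsubgraph G \<Delta> \<Gamma>"
    and p: "lpath \<Delta> u p w"
  shows "tilde_map G \<Delta> u w = Lab G \<Delta> u #> plabel G p"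
proof (intro equalityI subsetI)
  fix g assume "g \<in> tilde_map G \<Delta> u w"
  then obtain q where q: "lpath \<Delta> u q w" "g = plabel G q" by (auto simp: tilde_map_def)
  obtain r where r: "lpath \<Delta> w r u" "plabel G r = inv (plabel G p)"
    using lpath_rev_label[OF L \<Delta> p] by blast
  have "plabel G q \<otimes> inv (plabel G p) \<in> Lab G \<Delta> u"
    using lpath_append[OF q(1) r(1)] plabel_append[OF L q(1) r(1)] r(2) unfolding Lab_def mem_Collect_eq by metis
  moreover have "g = plabel G q \<otimes> inv (plabel G p) \<otimes> plabel G p"
    using plabel_closed[OF L] p q by (simp add: m_assoc)
  ultimately show "g \<in> Lab G \<Delta> u #> plabel G p" unfolding r_coset_def by blast
next
  fix g assume "g \<in> Lab G \<Delta> u #> plabel G p"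
  then obtain q where q: "lpath \<Delta> u q u" "g = plabel G q \<otimes> plabel G p"
    by (auto simp: r_coset_def Lab_def)
  then show "g \<in> tilde_map G \<Delta> u w"
    using lpath_append[OF q(1) p] plabel_append[OF L q(1) p] unfolding tilde_map_def mem_Collect_eq by metis
qed

lemma (in group) tilde_map_embedding:
  assumes X: "X \<subseteq> carrier G" and "fin_subgraph_of_cover G X \<Delta> u"
  shows "lembedding G (tilde_map G \<Delta> u) \<Delta> (tilde G X \<Delta> u)" "tilde_map G \<Delta> u u = Lab G \<Delta> u"
proof -
  show "tilde_map G \<Delta> u u = Lab G \<Delta> u" by (simp add: tilde_map_def Lab_def)
  obtain T where T: "subgroup T G" and \<Delta>: "lsubgraph G \<Delta> (cayley G X T)" and c: "lconnected \<Delta>"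
    and u: "u \<in> verts \<Delta>"
    using assms(2) by (auto simp: fin_subgraph_of_cover_def fin_subgraph_def)
  have L: "\<forall>(a, x, b)\<in>edges \<Delta>. x \<in> carrier G" and st: "\<forall>(a, x, b)\<in>edges \<Delta>. x \<in> star G X"
    using cayley_labels[OF X \<Delta>] by blast+
  note coset = tilde_map_coset[OF L \<Delta>]
  have S: "Lab G \<Delta> u \<subseteq> carrier G" using Lab_subgroup[OF L \<Delta> u] by (rule subgroup.subset)
  have path: "\<exists>p. lpath \<Delta> u p w" if "w \<in> verts \<Delta>" for w
    using c u that unfolding lconnected_def by blast
  have inj: "inj_on (tilde_map G \<Delta> u) (verts \<Delta>)"
  proof (rule inj_onI)
    fix w w' assume w: "w \<in> verts \<Delta>" "w' \<in> verts \<Delta>" "tilde_map G \<Delta> u w = tilde_map G \<Delta> u w'"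
    then obtain p where p: "lpath \<Delta> u p w" using path by blast
    then have "plabel G p \<in> tilde_map G \<Delta> u w'" unfolding w(3)[symmetric] by (auto simp: tilde_map_def)
    then obtain q where "lpath \<Delta> u q w'" "plabel G p = plabel G q" by (auto simp: tilde_map_def)
    then show "w = w'" using p lpath_cayley[OF T X \<Delta>] by metis
  qed
  have V: "tilde_map G \<Delta> u w \<in> rcosets (Lab G \<Delta> u)" if w: "w \<in> verts \<Delta>" for w
  proof -
    obtain p where p: "lpath \<Delta> u p w" using path[OF w] by blast
    show ?thesis using plabel_closed[OF L p] unfolding coset[OF p] RCOSETS_def by blast
  qed
  have E: "tilde_map G \<Delta> u b = tilde_map G \<Delta> u a #> x" if e: "(a, x, b) \<in> edges \<Delta>" for a x b
  proof -
    have ab: "a \<in> verts \<Delta>" "b \<in> verts \<Delta>" "x \<in> carrier G" using e \<Delta> L by (auto simp: lsubgraph_def)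
    obtain p where p: "lpath \<Delta> u p a" using path[OF ab(1)] by blast
    have q: "lpath \<Delta> a [(a, x, b)] b" using e ab by simp
    show ?thesis
      unfolding coset[OF p] coset[OF lpath_append[OF p q]] plabel_append[OF L p q]
      using plabel_closed[OF L p] ab(3) S by (simp add: coset_mult_assoc)
  qed
  let ?I = "graph_image (tilde_map G \<Delta> u) \<Delta>"
  have "verts ?I \<subseteq> verts (tilde G X \<Delta> u)"
    using V by (auto simp: graph_image_def tilde_def cayley_def)
  moreover have "edges ?I \<subseteq> edges (tilde G X \<Delta> u)"
  proof
    fix e assume "e \<in> edges ?I"
    then obtain a x b where e: "(a, x, b) \<in> edges \<Delta>"
      "e = (tilde_map G \<Delta> u a, x, tilde_map G \<Delta> u b)"
      by (auto simp: graph_image_def)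
    have "a \<in> verts \<Delta>" using e(1) \<Delta> unfolding lsubgraph_def by blast
    moreover have "x \<in> star G X" using e(1) st by blast
    ultimately show "e \<in> edges (tilde G X \<Delta> u)"
      using V[of a] unfolding e(2) E[OF e(1)] tilde_def cayley_def by simp
  qed
  moreover have "\<forall>(a, x, b)\<in>edges ?I. a \<in> verts ?I \<and> b \<in> verts ?I \<and> (b, inv x, a) \<in> edges ?I"
    using \<Delta> by (force simp: graph_image_def lsubgraph_def)
  ultimately show "lembedding G (tilde_map G \<Delta> u) \<Delta> (tilde G X \<Delta> u)"
    using inj unfolding lembedding_def lsubgraph_def by blast
qed


section \<open>Strong separability\<close>

text \<open>Throughout, \<open>X\<close> generates \<open>G\<close>, the finite subset \<open>X\<^sub>1 \<subseteq> X\<close> generates \<open>G\<^sub>0\<close>, and \<open>K\<close> is a cover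
  of \<open>G\<close> containing \<open>\<Gamma>'\<close>.\<close>

definition property4 ::
  "('a, 'm) monoid_scheme \<Rightarrow> 'a set \<Rightarrow> 'a set \<Rightarrow> ('v, 'a) lgraph \<Rightarrow> ('v, 'a) lgraph \<Rightarrow> bool" where
  "property4 G G\<^sub>0 X\<^sub>1 \<Gamma>' K \<longleftrightarrow> (\<forall>w\<in>verts \<Gamma>'. \<forall>g\<in>Lab G K w \<inter> G\<^sub>0.
     \<exists>p. lpath (component (star G X\<^sub>1) \<Gamma>' w) w p w \<and> plabel G p = g)"

definition property5 ::
  "('a, 'm) monoid_scheme \<Rightarrow> 'a set \<Rightarrow> 'a set \<Rightarrow> ('v, 'a) lgraph \<Rightarrow> ('v, 'a) lgraph \<Rightarrow> bool" where
  "property5 G G\<^sub>0 X\<^sub>1 \<Gamma>' K \<longleftrightarrow> (\<forall>u\<in>verts \<Gamma>'. \<forall>w\<in>verts \<Gamma>'.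
     (\<exists>p. lpath K u p w \<and> plabel G p \<in> G\<^sub>0) \<longleftrightarrow> w \<in> verts (component (star G X\<^sub>1) \<Gamma>' u))"

definition property7 ::
  "('a, 'm) monoid_scheme \<Rightarrow> 'a set \<Rightarrow> 'a set \<Rightarrow> ('v, 'a) lgraph \<Rightarrow> ('v, 'a) lgraph \<Rightarrow> bool" where
  "property7 G G\<^sub>0 X\<^sub>1 \<Gamma>' K \<longleftrightarrow> (\<forall>v\<in>verts \<Gamma>'.
     finite_index (G\<lparr>carrier := G\<^sub>0\<rparr>) (Lab G K v \<inter> G\<^sub>0) \<longrightarrow> saturated_at (star G X\<^sub>1) \<Gamma>' v)"

text \<open>All conditions on \<open>\<Gamma>\<^sub>i'\<close>, \<open>\<Delta>\<^sub>i\<close> and the embedding \<open>f : (\<Gamma>\<^sub>i', v\<^sub>i) \<rightarrow> (\<Delta>\<^sub>i, b)\<close> that concern a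
  single index \<open>i\<close>.  The cover \<open>\<Gamma>\<^sub>i~\<close> is \<open>K\<close>, with base vertex \<open>o\<^sub>K\<close>, and \<open>\<Gamma>\<^sub>i'\<close> contains \<open>\<Gamma>\<^sub>i\<close> as
  identified with its image in \<open>K\<close>.\<close>

definition strong_separability_data ::
  "('a, 'm) monoid_scheme \<Rightarrow> 'a set \<Rightarrow> 'a set \<Rightarrow> 'a set
     \<Rightarrow> ('a set, 'a) lgraph \<Rightarrow> 'a set \<Rightarrow> ('a set, 'a) lgraph \<Rightarrow> ('a set, 'a) lgraph \<Rightarrow> 'a set
     \<Rightarrow> ('a set \<Rightarrow> 'a set) \<Rightarrow> bool" where
  "strong_separability_data G X G\<^sub>0 X\<^sub>1 \<Gamma> v \<Gamma>' \<Delta> b f \<longleftrightarrow>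
     (let K = tilde G X \<Gamma> v; o\<^sub>K = tilde_map G \<Gamma> v v;
          K\<^sub>\<Delta> = tilde G X \<Delta> b; j = (\<lambda>u. tilde_map G \<Delta> b (f u));
          Y = star G X\<^sub>1
      in
        fin_subgraph G \<Gamma>' K \<and>
        lsubgraph G (graph_image (tilde_map G \<Gamma> v) \<Gamma>) \<Gamma>' \<and>
        property4 G G\<^sub>0 X\<^sub>1 \<Gamma>' K \<and> property5 G G\<^sub>0 X\<^sub>1 \<Gamma>' K \<and> property7 G G\<^sub>0 X\<^sub>1 \<Gamma>' K \<and>
        fin_subgraph_of_cover G X \<Delta> b \<and>
        lembedding G f \<Gamma>' \<Delta> \<and> f o\<^sub>K = b \<and>
        is_cover (G\<lparr>carrier := G\<^sub>0\<rparr>) X\<^sub>1 (component Y \<Delta> b) \<and>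
        edges \<Delta> \<subseteq> edges (graph_image f \<Gamma>') \<union> edges (component Y \<Delta> b) \<and>
        (\<forall>u\<in>verts \<Gamma>'. u \<notin> verts (component Y K o\<^sub>K) \<longrightarrow>
           Lab G K u \<inter> G\<^sub>0 = Lab G K\<^sub>\<Delta> (j u) \<inter> G\<^sub>0) \<and>
        (\<forall>u\<in>verts \<Gamma>'. \<forall>w\<in>verts \<Gamma>'.
           j w \<in> verts (component Y K\<^sub>\<Delta> (j u)) \<longleftrightarrow> w \<in> verts (component Y K u)))"

definition strongly_separable ::
  "('a, 'm) monoid_scheme \<Rightarrow> 'a set \<Rightarrow> 'a set \<Rightarrow> 'a set \<Rightarrow> bool" where
  "strongly_separable G X G\<^sub>0 X\<^sub>1 \<longleftrightarrow>
     (\<forall>S\<^sub>1 S\<^sub>2 \<Gamma>\<^sub>1 v\<^sub>1 \<Gamma>\<^sub>2 v\<^sub>2.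
        fin_gen G S\<^sub>1 \<and> fin_gen G S\<^sub>2 \<and> S\<^sub>1 \<inter> G\<^sub>0 = S\<^sub>2 \<inter> G\<^sub>0 \<and>
        \<not> finite_index (G\<lparr>carrier := G\<^sub>0\<rparr>) (S\<^sub>1 \<inter> G\<^sub>0) \<and>
        fin_subgraph_of_cover G X \<Gamma>\<^sub>1 v\<^sub>1 \<and> Lab G \<Gamma>\<^sub>1 v\<^sub>1 = S\<^sub>1 \<and>
        fin_subgraph_of_cover G X \<Gamma>\<^sub>2 v\<^sub>2 \<and> Lab G \<Gamma>\<^sub>2 v\<^sub>2 = S\<^sub>2 \<longrightarrow>
        (\<exists>\<Gamma>\<^sub>1' \<Gamma>\<^sub>2' \<Delta>\<^sub>1 \<Delta>\<^sub>2 b\<^sub>1 b\<^sub>2 f\<^sub>1 f\<^sub>2.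
           strong_separability_data G X G\<^sub>0 X\<^sub>1 \<Gamma>\<^sub>1 v\<^sub>1 \<Gamma>\<^sub>1' \<Delta>\<^sub>1 b\<^sub>1 f\<^sub>1 \<and>
           strong_separability_data G X G\<^sub>0 X\<^sub>1 \<Gamma>\<^sub>2 v\<^sub>2 \<Gamma>\<^sub>2' \<Delta>\<^sub>2 b\<^sub>2 f\<^sub>2 \<and>
           Lab G \<Delta>\<^sub>1 b\<^sub>1 \<inter> G\<^sub>0 = Lab G \<Delta>\<^sub>2 b\<^sub>2 \<inter> G\<^sub>0))"

end

theory Submission
  imports Defs
begin

text \<open>
  A subgroup \<open>S\<close> of the double \<open>D\<close> is closed as soon as every \<open>d \<notin> S\<close> is separated from \<open>S\<close> by the
  stabilizer of a point in some finite \<open>D\<close>-set.  Finite \<open>D\<close>-sets are produced from finite \<open>G\<close>-sets with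
  an involution \<open>\<tau>\<close> that commutes with \<open>G\<^sub>0\<close>: elements of \<open>G\<close> act as they are, and \<open>\<alpha> g\<close> acts as
  \<open>\<tau> g \<tau>\<close>; on \<open>G\<^sub>0\<close> the two prescriptions agree.  This is where it matters that \<open>D\<close> is a double, and it
  makes all completions easy: where \<open>\<tau>\<close> is not prescribed, it may be the identity.

  The model to be approximated is \<open>\<Omega>\<close>, two copies of the coset space \<open>S \ D\<close>, on which \<open>G\<close> acts
  through \<open>G\<close> and through \<open>H\<close> respectively and which \<open>\<tau>\<close> exchanges.  Words for \<open>d\<close> and for generators of
  \<open>S\<close> visit only a finite set \<open>F\<close> of points of \<open>\<Omega>\<close>.  The \<open>G\<close>-orbits that meet \<open>F\<close> are replaced by coset
  spaces \<open>T i \ G\<close>, where \<open>T i\<close> is generated by finitely many elements that record how the points of \<open>F\<close>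
  are related to one another (\<open>finite_presentation_of_points\<close>).  Among them are generators of the
  \<open>G\<^sub>0\<close>-stabilizers of these points, which are conjugate to intersections of \<open>S\<close> with conjugates of
  \<open>G\<^sub>0\<close>; so the hypothesis on these intersections is what makes \<open>T i\<close> finitely generated.  The
  involution survives as a finite list of pairs of points, and all that is asked of it is
  \<open>compatible\<close>: it commutes with \<open>G\<^sub>0\<close> on the listed points.

  From here on the subgroups \<open>T i\<close> only grow, which preserves every relation between the points; what
  has to be guarded is that no unwanted relations appear.  Strong separability, read as a statement
  about subgroups (\<open>simultaneous_separating_overgroups\<close>), treats one pair of partners whose common
  \<open>G\<^sub>0\<close>-stabilizer has infinite index in \<open>G\<^sub>0\<close>.  It enlarges the two groups involved so that the new
  \<open>G\<^sub>0\<close>-stabilizers of the two partners are again equal and have finite index, while other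
  \<open>G\<^sub>0\<close>-orbits neither merge nor change their stabilizers.  Hence compatibility persists
  (\<open>compatible_side\<close>), and after finitely many such steps all these stabilizers have finite index
  (\<open>complete_all_edges\<close>).  Then only finitely many elements have to be kept out of each \<open>T i\<close>, and
  LERF allows it to be enlarged to a subgroup of finite index (\<open>finite_index_completion\<close>).  Gluing the
  resulting finite coset spaces (\<open>glued_coset_space\<close>) gives the finite \<open>D\<close>-set.

  The second claim follows from the first because \<open>S \<inter> d G\<^sub>0 d\<^sup>-\<^sup>1\<close> is conjugate to
  \<open>G\<^sub>0 \<inter> d\<^sup>-\<^sup>1 S d\<close>.
\<close>

section \<open>Finite index subgroups and separation\<close>

context group
begin

lemma inv_mult_cancel: "x \<in> carrier G \<Longrightarrow> y \<in> carrier G \<Longrightarrow> inv x \<otimes> (x \<otimes> y) = y"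
  by (simp flip: m_assoc)

lemma mult_inv_cancel: "x \<in> carrier G \<Longrightarrow> y \<in> carrier G \<Longrightarrow> x \<otimes> (inv x \<otimes> y) = y"
  by (simp flip: m_assoc)

lemma finite_index_if_finite_map:
  assumes L: "subgroup L G" and Y: "finite Y" "\<And>x. x \<in> carrier G \<Longrightarrow> \<phi> x \<in> Y"
    and \<phi>: "\<And>x y. \<lbrakk>x \<in> carrier G; y \<in> carrier G; \<phi> x = \<phi> y\<rbrakk> \<Longrightarrow> x \<otimes> inv y \<in> L"
  shows "finite_index G L"
proof -
  have sub: "rcosets L \<subseteq> (\<lambda>z. L #> (SOME x. x \<in> carrier G \<and> \<phi> x = z)) ` Y"
  proof
    fix C assume "C \<in> rcosets L"
    then obtain x where x: "x \<in> carrier G" "C = L #> x" by (auto simp: RCOSETS_def)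
    let ?y = "SOME y. y \<in> carrier G \<and> \<phi> y = \<phi> x"
    have y: "?y \<in> carrier G \<and> \<phi> ?y = \<phi> x" by (rule someI[of _ x]) (simp add: x)
    then have "x \<otimes> inv ?y \<in> L" using \<phi> x by metis
    then have "L #> (x \<otimes> inv ?y) = L" using L by (simp add: coset_join2 subgroup.mem_carrier)
    then have "L #> x = L #> ?y"
      using coset_mult_inv1[OF _ x(1) _ subgroup.subset[OF L], of ?y] y by blast
    then show "C \<in> (\<lambda>z. L #> (SOME x. x \<in> carrier G \<and> \<phi> x = z)) ` Y"
      using x Y by auto
  qed
  show ?thesis unfolding finite_index_def by (rule finite_subset[OF sub]) (simp add: Y(1))
qed

lemma finite_index_mono:
  assumes L: "subgroup L G" and K: "subgroup K G" "finite_index G K" "K \<subseteq> L"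
  shows "finite_index G L"
proof (rule finite_index_if_finite_map[OF L, of "rcosets K" "\<lambda>x. K #> x"])
  show "finite (rcosets K)" using K by (simp add: finite_index_def)
  show "K #> x \<in> rcosets K" if "x \<in> carrier G" for x using that by (auto simp: RCOSETS_def)
  show "x \<otimes> inv y \<in> L" if xy: "x \<in> carrier G" "y \<in> carrier G" "K #> x = K #> y" for x y
  proof -
    have "x \<in> K #> y" using xy K(1) rcos_self[of x K] by simp
    then obtain k where k: "k \<in> K" "x = k \<otimes> y" by (auto simp: r_coset_def)
    moreover from k have "k \<in> carrier G" using K(1) by (simp add: subgroup.mem_carrier)
    ultimately show ?thesis using xy K(3) by (auto simp: m_assoc)
  qed
qed

lemma closed_subgroup_if_separated:
  assumes S: "subgroup S G"
    and sep: "\<And>g. \<lbrakk>g \<in> carrier G; g \<notin> S\<rbrakk> \<Longrightarrow> \<exists>L. subgroup L G \<and> finite_index G L \<and> S \<subseteq> L \<and> g \<notin> L"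
  shows "closedin (profinite_topology G) S"
  unfolding closedin_def topspace_profinite_topology openin_profinite_topology
proof (intro conjI ballI)
  show "S \<subseteq> carrier G" using S by (rule subgroup.subset)
  fix g assume g: "g \<in> carrier G - S"
  then obtain L where L: "subgroup L G" "finite_index G L" "S \<subseteq> L" "g \<notin> L" using sep by blast
  have "g \<otimes> k \<notin> S" if k: "k \<in> L" for k
  proof
    assume "g \<otimes> k \<in> S"
    then have "(g \<otimes> k) \<otimes> inv k \<in> L" using L k by (meson subgroup.m_closed subgroup.m_inv_closed subsetD)
    then show False using L k g by (simp add: m_assoc subgroup.mem_carrier[OF L(1)])
  qed
  then have "g <# L \<subseteq> carrier G - S"
    using g subgroup.mem_carrier[OF L(1)] by (auto simp: l_coset_def)
  then show "\<exists>K. subgroup K G \<and> finite_index G K \<and> g <# K \<subseteq> carrier G - S" using L by blast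
qed simp

text \<open>If \<open>g K\<close> misses \<open>S\<close>, let \<open>G\<close> act on the finite set of right cosets of \<open>K\<close>.  The setwise
  stabilizer \<open>L\<close> of the \<open>S\<close>-orbit of the coset \<open>K\<close> contains \<open>S\<close> and has finite index, and \<open>g \<in> L\<close>
  would put \<open>K g\<^sup>-\<^sup>1\<close> into that orbit.\<close>

lemma closed_subgroup_separated:
  assumes S: "subgroup S G" and cl: "closedin (profinite_topology G) S"
    and g: "g \<in> carrier G" "g \<notin> S"
  shows "\<exists>L. subgroup L G \<and> finite_index G L \<and> S \<subseteq> L \<and> g \<notin> L"
proof -
  have "openin (profinite_topology G) (carrier G - S)"
    using cl unfolding closedin_def topspace_profinite_topology by blast
  then obtain K where K: "subgroup K G" "finite_index G K" "g <# K \<subseteq> carrier G - S"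
    unfolding openin_profinite_topology using g by blast
  define Orb where "Orb = (\<lambda>s. K #> s) ` S"
  define L where "L = {x \<in> carrier G. (\<lambda>C. C #> x) ` Orb = Orb}"
  have Sc: "\<And>s. s \<in> S \<Longrightarrow> s \<in> carrier G" and Kc: "K \<subseteq> carrier G"
    using S K(1) by (auto simp: subgroup.mem_carrier subgroup.subset)
  have act: "(\<lambda>C. C #> y) ` (\<lambda>C. C #> x) ` Orb = (\<lambda>C. C #> (x \<otimes> y)) ` Orb"
    if "x \<in> carrier G" "y \<in> carrier G" for x y
    unfolding Orb_def image_image
    by (rule image_cong) (use that Sc Kc in \<open>simp_all add: coset_mult_assoc m_assoc\<close>)
  have act1: "(\<lambda>C. C #> \<one>) ` Orb = Orb"
    unfolding Orb_def image_image
    by (rule image_cong) (use Sc Kc in \<open>simp_all add: coset_mult_assoc\<close>)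
  have Linv: "x \<otimes> inv y \<in> L" if "x \<in> carrier G" "y \<in> carrier G" "(\<lambda>C. C #> x) ` Orb = (\<lambda>C. C #> y) ` Orb" for x y
  proof -
    have "(\<lambda>C. C #> (x \<otimes> inv y)) ` Orb = (\<lambda>C. C #> (y \<otimes> inv y)) ` Orb"
      using that by (simp only: act[symmetric] inv_closed)
    then show ?thesis using that act1 by (simp add: L_def)
  qed
  have sub: "subgroup L G"
  proof (rule subgroupI)
    show "L \<noteq> {}" using act1 by (auto simp: L_def)
    show "inv a \<in> L" if "a \<in> L" for a
      using Linv[of \<one> a] that act1 by (simp add: L_def)
    show "a \<otimes> b \<in> L" if "a \<in> L" "b \<in> L" for a b
      using that act[of a b] by (simp add: L_def)
  qed (simp add: L_def)
  have "finite_index G L"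
  proof (rule finite_index_if_finite_map[OF sub, of "Pow (rcosets K)" "\<lambda>x. (\<lambda>C. C #> x) ` Orb"])
    show "finite (Pow (rcosets K))" using K by (simp add: finite_index_def)
    show "(\<lambda>C. C #> x) ` Orb \<in> Pow (rcosets K)" if "x \<in> carrier G" for x
      using that Sc Kc by (auto simp: Orb_def coset_mult_assoc intro!: rcosetsI)
  qed (rule Linv)
  moreover have "S \<subseteq> L"
  proof
    fix s assume s: "s \<in> S"
    have "(\<lambda>C. C #> s) ` Orb = (\<lambda>t. K #> (t \<otimes> s)) ` S"
      unfolding Orb_def image_image by (rule image_cong) (use s Sc Kc in \<open>simp_all add: coset_mult_assoc\<close>)
    also have "\<dots> = (#>) K ` (\<lambda>t. t \<otimes> s) ` S" by (simp add: image_image)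
    also have "(\<lambda>t. t \<otimes> s) ` S = S"
    proof
      show "(\<lambda>t. t \<otimes> s) ` S \<subseteq> S" using S s by (auto simp: subgroup.m_closed)
      show "S \<subseteq> (\<lambda>t. t \<otimes> s) ` S"
      proof
        fix t assume t: "t \<in> S"
        show "t \<in> (\<lambda>t. t \<otimes> s) ` S"
          by (rule image_eqI[of _ _ "t \<otimes> inv s"])
            (use s t S Sc in \<open>simp_all add: m_assoc subgroup.m_closed subgroup.m_inv_closed\<close>)
      qed
    qed
    finally show "s \<in> L" using s Sc by (simp add: L_def Orb_def)
  qed
  moreover have "g \<notin> L"
  proof
    assume "g \<in> L"
    then have "inv g \<in> L" using sub by (simp add: subgroup.m_inv_closed)
    moreover have "K \<in> Orb"
      unfolding Orb_def by (rule image_eqI[of _ _ \<one>]) (use S Kc in \<open>simp_all add: subgroup.one_closed\<close>)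
    ultimately have "K #> inv g \<in> Orb" by (auto simp: L_def)
    then obtain s where s: "s \<in> S" "K #> inv g = K #> s" by (auto simp: Orb_def)
    have "inv g \<in> K #> inv g" using g K(1) rcos_self by blast
    then obtain k where k: "k \<in> K" "inv g = k \<otimes> s" unfolding s(2) by (auto simp: r_coset_def)
    have kc: "k \<in> carrier G" using k Kc by blast
    have "g = inv s \<otimes> inv k"
      using k(2) kc g Sc[OF s(1)] by (metis inv_inv inv_mult_group)
    then have "inv s = g \<otimes> k"
      using kc Sc[OF s(1)] by (simp add: m_assoc)
    moreover have "g \<otimes> k \<in> g <# K" using k by (auto simp: l_coset_def)
    ultimately have "inv s \<notin> S" using K(3) by auto
    then show False using s S by (simp add: subgroup.m_inv_closed)
  qed
  ultimately show ?thesis using sub by blast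
qed

lemma LERF_separates:
  assumes "LERF G" and T: "fin_gen G T" and B: "finite B" "B \<subseteq> carrier G" "B \<inter> T = {}"
  shows "\<exists>L. subgroup L G \<and> finite_index G L \<and> T \<subseteq> L \<and> B \<inter> L = {}"
  using B
proof (induction B)
  case empty
  have "finite_index G (carrier G)"
    by (rule finite_index_if_finite_map[OF subgroup_self, of "{()}" "\<lambda>_. ()"]) auto
  moreover have "T \<subseteq> carrier G" using T generate_incl by (auto simp: fin_gen_def)
  ultimately show ?case using subgroup_self by blast
next
  case (insert g B)
  then obtain L where L: "subgroup L G" "finite_index G L" "T \<subseteq> L" "B \<inter> L = {}" by auto
  have "subgroup T G" using T generate_is_subgroup by (auto simp: fin_gen_def)
  moreover have "closedin (profinite_topology G) T" using assms(1) T by (simp add: LERF_def)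
  ultimately obtain K where K: "subgroup K G" "finite_index G K" "T \<subseteq> K" "g \<notin> K"
    using closed_subgroup_separated[of T g] insert by auto
  then show ?case
    using L by (intro exI[of _ "K \<inter> L"]) (auto simp: finite_index_Int subgroups_Inter_pair)
qed

end

section \<open>Steps between cosets\<close>

text \<open>In the coset space \<open>T \ G\<close>, right multiplication by \<open>g\<close> takes the coset of \<open>a\<close> to the coset of
  \<open>b\<close> (see \<open>coset_step_iff\<close>).  In this form it is evident that steps persist when \<open>T\<close> grows, with the
  same elements \<open>a\<close> and \<open>b\<close> as names for the cosets.\<close>

definition coset_step :: "('a, 'm) monoid_scheme \<Rightarrow> 'a set \<Rightarrow> 'a \<Rightarrow> 'a \<Rightarrow> 'a \<Rightarrow> bool" where
  "coset_step G T a g b \<longleftrightarrow> a \<otimes>\<^bsub>G\<^esub> g \<otimes>\<^bsub>G\<^esub> inv\<^bsub>G\<^esub> b \<in> T"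

text \<open>For a subgroup \<open>T\<close> this is \<open>u\<^sup>-\<^sup>1 T u\<close>, the stabilizer of the coset of \<open>u\<close> in \<open>T \ G\<close>.\<close>

definition conjugate_subgroup :: "('a, 'm) monoid_scheme \<Rightarrow> 'a \<Rightarrow> 'a set \<Rightarrow> 'a set" where
  "conjugate_subgroup G u T = {x \<in> carrier G. u \<otimes>\<^bsub>G\<^esub> x \<otimes>\<^bsub>G\<^esub> inv\<^bsub>G\<^esub> u \<in> T}"

lemma fin_gen_subgroup: "group G \<Longrightarrow> fin_gen G T \<Longrightarrow> subgroup T G"
  unfolding fin_gen_def using group.generate_is_subgroup by blast

lemma fin_gen_hom_image:
  assumes "group G" "group K" "h \<in> hom G K" "fin_gen G T"
  shows "fin_gen K (h ` T)"
proof -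
  interpret group_hom G K h using assms by (simp add: group_hom_def group_hom_axioms_def)
  obtain A where A: "finite A" "A \<subseteq> carrier G" "T = generate G A" using assms(4) by (auto simp: fin_gen_def)
  have "h ` T = generate K (h ` A)" using generate_img[OF A(2)] A(3) by simp
  moreover have "h ` A \<subseteq> carrier K" using A(2) by auto
  ultimately show ?thesis using A(1) unfolding fin_gen_def by blast
qed

context group
begin

lemma coset_step_refl: "subgroup T G \<Longrightarrow> a \<in> carrier G \<Longrightarrow> coset_step G T a \<one> a"
  by (simp add: coset_step_def subgroup.one_closed)

lemma coset_step_trans:
  assumes "subgroup T G" "coset_step G T a g b" "coset_step G T b h c"
    "a \<in> carrier G" "b \<in> carrier G" "c \<in> carrier G" "g \<in> carrier G" "h \<in> carrier G"
  shows "coset_step G T a (g \<otimes> h) c"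
proof -
  have "(a \<otimes> g \<otimes> inv b) \<otimes> (b \<otimes> h \<otimes> inv c) \<in> T"
    using assms(1-3) unfolding coset_step_def by (rule subgroup.m_closed)
  then show ?thesis using assms(4-8) by (simp add: coset_step_def m_assoc inv_mult_cancel)
qed

lemma coset_step_inv:
  assumes "subgroup T G" "coset_step G T a g b" "a \<in> carrier G" "b \<in> carrier G" "g \<in> carrier G"
  shows "coset_step G T b (inv g) a"
proof -
  have "inv (a \<otimes> g \<otimes> inv b) \<in> T" using assms(1,2) unfolding coset_step_def by (rule subgroup.m_inv_closed)
  then show ?thesis using assms(3-5) by (simp add: coset_step_def m_assoc inv_mult_group)
qed

lemma coset_step_mono: "coset_step G T a g b \<Longrightarrow> T \<subseteq> L \<Longrightarrow> coset_step G L a g b"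
  unfolding coset_step_def by blast

lemma coset_step_iff:
  assumes T: "subgroup T G" and a: "a \<in> carrier G" and b: "b \<in> carrier G" and g: "g \<in> carrier G"
  shows "coset_step G T a g b \<longleftrightarrow> T #> (a \<otimes> g) = T #> b"
proof
  have Tc: "T \<subseteq> carrier G" and ag: "a \<otimes> g \<in> carrier G" and agb: "a \<otimes> g \<otimes> inv b \<in> carrier G"
    using subgroup.subset[OF T] a b g by simp_all
  show "T #> (a \<otimes> g) = T #> b" if "coset_step G T a g b"
    using coset_mult_inv1[OF coset_join2[OF agb T] ag b Tc] that by (simp add: coset_step_def)
  show "coset_step G T a g b" if "T #> (a \<otimes> g) = T #> b"
    using coset_join1[OF coset_mult_inv2[OF that ag b Tc] agb T] by (simp add: coset_step_def)
qed

lemma fin_gen_conjugate_subgroup: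
  assumes "fin_gen G T" "u \<in> carrier G"
  shows "fin_gen G (conjugate_subgroup G u T)"
proof -
  have T: "T \<subseteq> carrier G" using fin_gen_subgroup[OF is_group assms(1)] by (rule subgroup.subset)
  have "(\<lambda>t. inv u \<otimes> t \<otimes> u) \<in> hom G G"
    by (rule homI) (use assms(2) in \<open>simp_all add: m_assoc mult_inv_cancel\<close>)
  from fin_gen_hom_image[OF is_group is_group this assms(1)]
  have "fin_gen G ((\<lambda>t. inv u \<otimes> t \<otimes> u) ` T)" .
  moreover have "(\<lambda>t. inv u \<otimes> t \<otimes> u) ` T = conjugate_subgroup G u T"
  proof
    show "(\<lambda>t. inv u \<otimes> t \<otimes> u) ` T \<subseteq> conjugate_subgroup G u T"
    proof
      fix x assume "x \<in> (\<lambda>t. inv u \<otimes> t \<otimes> u) ` T"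
      then obtain t where "t \<in> T" "t \<in> carrier G" "x = inv u \<otimes> t \<otimes> u" using T by auto
      then show "x \<in> conjugate_subgroup G u T"
        using assms(2) by (simp add: conjugate_subgroup_def m_assoc mult_inv_cancel)
    qed
    show "conjugate_subgroup G u T \<subseteq> (\<lambda>t. inv u \<otimes> t \<otimes> u) ` T"
    proof
      fix x assume "x \<in> conjugate_subgroup G u T"
      then have x: "x \<in> carrier G" "u \<otimes> x \<otimes> inv u \<in> T" by (auto simp: conjugate_subgroup_def)
      show "x \<in> (\<lambda>t. inv u \<otimes> t \<otimes> u) ` T"
        by (rule image_eqI[OF _ x(2)]) (use x(1) assms(2) in \<open>simp add: m_assoc inv_mult_cancel\<close>)
    qed
  qed
  ultimately show ?thesis by simp
qed

text \<open>Left multiplication by \<open>u\<^sup>-\<^sup>1\<close> identifies \<open>T \ G\<close> with the coset space of \<open>u\<^sup>-\<^sup>1 T u\<close> and turns the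
  coset of \<open>u\<close> into the base coset.\<close>

lemma coset_step_conjugate:
  assumes "u \<in> carrier G" "a \<in> carrier G" "b \<in> carrier G" "g \<in> carrier G"
  shows "coset_step G (conjugate_subgroup G u T) (inv u \<otimes> a) g (inv u \<otimes> b) \<longleftrightarrow> coset_step G T a g b"
proof -
  have "u \<otimes> (inv u \<otimes> a \<otimes> g \<otimes> inv (inv u \<otimes> b)) \<otimes> inv u = a \<otimes> g \<otimes> inv b"
    using assms by (simp add: m_assoc inv_mult_group mult_inv_cancel)
  then show ?thesis using assms by (simp add: coset_step_def conjugate_subgroup_def)
qed

end

section \<open>Finite subgraphs of covers\<close>

context group
begin

text \<open>Fix a path \<open>t u\<close> from \<open>b\<close> to every vertex \<open>u\<close>, the empty one for \<open>b\<close> itself.  Inserting these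
  paths and their inverses between consecutive edges writes the label of a loop at \<open>b\<close> as a product of
  elements of the set \<open>A\<close>, which has one element for each edge.\<close>

lemma fin_gen_Lab:
  assumes L: "\<forall>(a, x, b)\<in>edges \<Delta>. x \<in> carrier G" and \<Delta>: "lsubgraph G \<Delta> \<Gamma>"
    and fin: "finite_lgraph \<Delta>" and con: "lconnected \<Delta>" and b: "b \<in> verts \<Delta>"
  shows "fin_gen G (Lab G \<Delta> b)"
proof -
  define t where "t = (\<lambda>u. if u = b then [] else SOME p. lpath \<Delta> b p u)"
  have t: "lpath \<Delta> b (t u) u" if "u \<in> verts \<Delta>" for u
  proof (cases "u = b")
    case False
    have "\<exists>p. lpath \<Delta> b p u" using con b that by (auto simp: lconnected_def)
    then show ?thesis using False unfolding t_def by (auto intro: someI_ex)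
  qed (simp add: t_def b)
  define A where "A = (\<lambda>(u, x, w). plabel G (t u) \<otimes> x \<otimes> inv (plabel G (t w))) ` edges \<Delta>"
  have E: "u \<in> verts \<Delta>" "x \<in> carrier G" "w \<in> verts \<Delta>" if "(u, x, w) \<in> edges \<Delta>" for u x w
    using that \<Delta> L unfolding lsubgraph_def by blast+
  have tc: "plabel G (t u) \<in> carrier G" if "u \<in> verts \<Delta>" for u
    using plabel_closed[OF L t[OF that]] .
  have sub: "subgroup (Lab G \<Delta> b) G" by (rule Lab_subgroup[OF L \<Delta> b])
  have A1: "A \<subseteq> Lab G \<Delta> b"
  proof
    fix g assume "g \<in> A"
    then obtain u x w where e: "(u, x, w) \<in> edges \<Delta>" "g = plabel G (t u) \<otimes> x \<otimes> inv (plabel G (t w))"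
      unfolding A_def by auto
    obtain q where q: "lpath \<Delta> w q b" "plabel G q = inv (plabel G (t w))"
      using lpath_rev_label[OF L \<Delta> t[OF E(3)[OF e(1)]]] by blast
    have e1: "lpath \<Delta> u ((u, x, w) # q) b" using e q E by simp
    have "plabel G (t u @ (u, x, w) # q) = g"
      using plabel_append[OF L t[OF E(1)[OF e(1)]] e1] E[OF e(1)] e(2) q(2) tc by (simp add: m_assoc)
    then show "g \<in> Lab G \<Delta> b" using lpath_append[OF t[OF E(1)[OF e(1)]] e1] unfolding Lab_def by blast
  qed
  have Ac: "A \<subseteq> carrier G" using A1 subgroup.subset[OF sub] by blast
  have "plabel G (t u) \<otimes> plabel G p \<otimes> inv (plabel G (t w)) \<in> generate G A" if "lpath \<Delta> u p w" for u p w
    using that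
  proof (induction p arbitrary: u)
    case Nil
    then show ?case using tc generate.one by auto
  next
    case (Cons e p)
    obtain x c where e: "e = (u, x, c)" "(u, x, c) \<in> edges \<Delta>" "lpath \<Delta> c p w" using Cons.prems by (cases e) auto
    have w: "w \<in> verts \<Delta>" using lpath_verts[OF \<Delta> e(3)] by simp
    have "plabel G (t u) \<otimes> x \<otimes> inv (plabel G (t c)) \<in> generate G A"
      by (rule generate.incl) (use e in \<open>force simp: A_def\<close>)
    from generate.eng[OF this Cons.IH[OF e(3)]]
    show ?case using tc E[OF e(2)] w plabel_closed[OF L e(3)] by (simp add: e(1) m_assoc inv_mult_cancel)
  qed
  then have "Lab G \<Delta> b \<subseteq> generate G A"
  proof (intro subsetI)
    fix g assume P: "\<And>u p w. lpath \<Delta> u p w \<Longrightarrow> plabel G (t u) \<otimes> plabel G p \<otimes> inv (plabel G (t w)) \<in> generate G A"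
      and "g \<in> Lab G \<Delta> b"
    then obtain p where p: "lpath \<Delta> b p b" "g = plabel G p" unfolding Lab_def by blast
    have "plabel G (t b) = \<one>" by (simp add: t_def)
    then show "g \<in> generate G A" using P[OF p(1)] plabel_closed[OF L p(1)] p(2) by simp
  qed
  then have "Lab G \<Delta> b = generate G A" using generate_subgroup_incl[OF A1 sub] by blast
  moreover have "finite A" using fin by (simp add: A_def finite_lgraph_def)
  ultimately show ?thesis using Ac unfolding fin_gen_def by blast
qed

lemma lpath_mono: "verts \<Delta> \<subseteq> verts \<Gamma> \<Longrightarrow> edges \<Delta> \<subseteq> edges \<Gamma> \<Longrightarrow> lpath \<Delta> u p w \<Longrightarrow> lpath \<Gamma> u p w"
  by (induction p arbitrary: u) auto

lemma star_inv: "X \<subseteq> carrier G \<Longrightarrow> x \<in> star G X \<Longrightarrow> inv x \<in> star G X"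
  by (auto simp: star_def)

lemma star_carrier: "X \<subseteq> carrier G \<Longrightarrow> x \<in> star G X \<Longrightarrow> x \<in> carrier G"
  by (auto simp: star_def)

lemma rcosets_step: "subgroup T G \<Longrightarrow> u \<in> rcosets T \<Longrightarrow> g \<in> carrier G \<Longrightarrow> u #> g \<in> rcosets T"
  by (auto simp: RCOSETS_def coset_mult_assoc subgroup.subset)

lemma lsubgraph_cayley:
  assumes T: "subgroup T G" and X: "X \<subseteq> carrier G"
  shows "lsubgraph G (cayley G X T) (cayley G X T)"
proof -
  have "c #> x \<in> rcosets T \<and> c #> x #> inv x = c \<and> inv x \<in> star G X" if "c \<in> rcosets T" "x \<in> star G X" for c x
  proof -
    have "c \<subseteq> carrier G" using T that(1) subgroup.rcosets_carrier[OF T is_group] by blast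
    then show ?thesis using that X T star_carrier[OF X] star_inv[OF X]
      by (simp add: rcosets_step coset_mult_assoc)
  qed
  then show ?thesis unfolding lsubgraph_def cayley_def by fastforce
qed

lemma subgraph_extend_edge:
  assumes T: "subgroup T G" and X: "X \<subseteq> carrier G" and \<Gamma>: "fin_subgraph G \<Gamma> (cayley G X T)"
    and c: "c \<in> verts \<Gamma>" and x: "x \<in> star G X"
  shows "\<exists>\<Gamma>'. fin_subgraph G \<Gamma>' (cayley G X T) \<and> lsubgraph G \<Gamma> \<Gamma>' \<and> (c, x, c #> x) \<in> edges \<Gamma>'"
proof -
  define \<Gamma>' where "\<Gamma>' = \<lparr>verts = insert (c #> x) (verts \<Gamma>),
    edges = insert (c, x, c #> x) (insert (c #> x, inv x, c) (edges \<Gamma>))\<rparr>"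
  have sub: "lsubgraph G \<Gamma> (cayley G X T)" and fin: "finite_lgraph \<Gamma>" and con: "lconnected \<Gamma>"
    using \<Gamma> by (auto simp: fin_subgraph_def)
  have cT: "c \<in> rcosets T" using sub c by (auto simp: lsubgraph_def cayley_def)
  have e: "(c, x, c #> x) \<in> edges (cayley G X T)" using cT x by (auto simp: cayley_def)
  then have e': "(c #> x, inv x, c) \<in> edges (cayley G X T)" "c #> x \<in> verts (cayley G X T)"
    using lsubgraph_cayley[OF T X] unfolding lsubgraph_def by blast+
  have xc: "inv (inv x) = x" using star_carrier[OF X x] by simp
  have s1: "lsubgraph G \<Gamma>' (cayley G X T)"
    using sub e e' c unfolding \<Gamma>'_def lsubgraph_def by (auto simp: xc)
  have s2: "lsubgraph G \<Gamma> \<Gamma>'"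
    using sub unfolding \<Gamma>'_def lsubgraph_def by auto
  have m: "lpath \<Gamma> u p w \<Longrightarrow> lpath \<Gamma>' u p w" for u p w
    by (rule lpath_mono) (auto simp: \<Gamma>'_def)
  have to: "\<exists>p. lpath \<Gamma>' c p w" if "w \<in> verts \<Gamma>'" for w
  proof (cases "w \<in> verts \<Gamma>")
    case True
    then show ?thesis using con c m unfolding lconnected_def by blast
  next
    case False
    then have "w = c #> x" using that by (simp add: \<Gamma>'_def)
    then have "lpath \<Gamma>' c [(c, x, w)] w" by (simp add: \<Gamma>'_def)
    then show ?thesis by blast
  qed
  have "lconnected \<Gamma>'"
    unfolding lconnected_def using to lpath_rev[OF s1] lpath_append by metis
  moreover have "finite_lgraph \<Gamma>'" using fin by (simp add: \<Gamma>'_def finite_lgraph_def)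
  moreover have "(c, x, c #> x) \<in> edges \<Gamma>'" by (simp add: \<Gamma>'_def)
  ultimately show ?thesis using s1 s2 unfolding fin_subgraph_def by blast
qed

lemma lsubgraph_trans: "lsubgraph G \<Gamma> \<Gamma>' \<Longrightarrow> lsubgraph G \<Gamma>' \<Gamma>'' \<Longrightarrow> lsubgraph G \<Gamma> \<Gamma>''"
  unfolding lsubgraph_def by (meson subset_trans)

lemma lpath_lsubgraph: "lsubgraph G \<Delta> \<Gamma> \<Longrightarrow> lpath \<Delta> u p w \<Longrightarrow> lpath \<Gamma> u p w"
  unfolding lsubgraph_def by (rule lpath_mono) auto

text \<open>The starting graph and the starting vertex are arbitrary, so that the induction over \<open>generate\<close>
  can attach the path for the second factor of a product to the end of the path for the first.\<close>

lemma subgraph_extend_path: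
  assumes T: "subgroup T G" and X: "X \<subseteq> carrier G" and \<Gamma>: "fin_subgraph G \<Gamma> (cayley G X T)"
    and c: "c \<in> verts \<Gamma>" and g: "g \<in> generate G X"
  shows "\<exists>\<Gamma>'. fin_subgraph G \<Gamma>' (cayley G X T) \<and> lsubgraph G \<Gamma> \<Gamma>' \<and>
    (\<exists>p. lpath \<Gamma>' c p (c #> g) \<and> plabel G p = g)"
  using g \<Gamma> c
proof (induction arbitrary: \<Gamma> c rule: generate.induct)
  case one
  then have s: "lsubgraph G \<Gamma> (cayley G X T)" by (simp add: fin_subgraph_def)
  then have "c \<subseteq> carrier G"
    using one(2) subgroup.rcosets_carrier[OF T is_group] by (auto simp: lsubgraph_def cayley_def)
  moreover have "lsubgraph G \<Gamma> \<Gamma>" using s by (simp add: lsubgraph_def)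
  ultimately show ?case using one
    by (intro exI[of _ \<Gamma>] conjI exI[of _ "[]"]) (simp_all add: coset_mult_one)
next
  case (incl h)
  then have "h \<in> star G X" "h \<in> carrier G" using X by (auto simp: star_def)
  with subgraph_extend_edge[OF T X incl(2,3)] obtain \<Gamma>' where
    \<Gamma>': "fin_subgraph G \<Gamma>' (cayley G X T)" "lsubgraph G \<Gamma> \<Gamma>'" "(c, h, c #> h) \<in> edges \<Gamma>'"
    by blast
  then have "lpath \<Gamma>' c [(c, h, c #> h)] (c #> h)" by (auto simp: fin_subgraph_def lsubgraph_def)
  moreover have "plabel G [(c, h, c #> h)] = h" using \<open>h \<in> carrier G\<close> by simp
  ultimately show ?case using \<Gamma>' by blast
next
  case (inv h)
  then have "inv h \<in> star G X" "inv h \<in> carrier G" using X by (auto simp: star_def)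
  with subgraph_extend_edge[OF T X inv(2,3)] obtain \<Gamma>' where
    \<Gamma>': "fin_subgraph G \<Gamma>' (cayley G X T)" "lsubgraph G \<Gamma> \<Gamma>'" "(c, inv h, c #> inv h) \<in> edges \<Gamma>'"
    by blast
  then have "lpath \<Gamma>' c [(c, inv h, c #> inv h)] (c #> inv h)" by (auto simp: fin_subgraph_def lsubgraph_def)
  moreover have "plabel G [(c, inv h, c #> inv h)] = inv h" using \<open>inv h \<in> carrier G\<close> by simp
  ultimately show ?case using \<Gamma>' by blast
next
  case (eng h1 h2)
  have hc: "h1 \<in> carrier G" "h2 \<in> carrier G" using eng(1,2) generate_in_carrier[OF X] by auto
  obtain \<Gamma>1 p where 1: "fin_subgraph G \<Gamma>1 (cayley G X T)" "lsubgraph G \<Gamma> \<Gamma>1"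
    "lpath \<Gamma>1 c p (c #> h1)" "plabel G p = h1" using eng(3)[OF eng(5,6)] by blast
  then have s1: "lsubgraph G \<Gamma>1 (cayley G X T)" by (simp add: fin_subgraph_def)
  have v: "c #> h1 \<in> verts \<Gamma>1" using lpath_verts[OF s1 1(3)] by simp
  obtain \<Gamma>2 q where 2: "fin_subgraph G \<Gamma>2 (cayley G X T)" "lsubgraph G \<Gamma>1 \<Gamma>2"
    "lpath \<Gamma>2 (c #> h1) q (c #> h1 #> h2)" "plabel G q = h2" using eng(4)[OF 1(1) v] by blast
  have s2: "lsubgraph G \<Gamma>2 (cayley G X T)" using 2 by (simp add: fin_subgraph_def)
  have L: "\<forall>(a, x, b)\<in>edges \<Gamma>2. x \<in> carrier G" using cayley_labels[OF X s2] by blast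
  have p2: "lpath \<Gamma>2 c p (c #> h1)" using lpath_lsubgraph[OF 2(2) 1(3)] .
  have "c \<in> rcosets T" using eng(5,6) by (auto simp: fin_subgraph_def lsubgraph_def cayley_def)
  then have "c \<subseteq> carrier G" using subgroup.rcosets_carrier[OF T is_group] by blast
  then have "c #> h1 #> h2 = c #> (h1 \<otimes> h2)" using hc by (simp add: coset_mult_assoc)
  then have "lpath \<Gamma>2 c (p @ q) (c #> (h1 \<otimes> h2))" using lpath_append[OF p2 2(3)] by simp
  moreover have "plabel G (p @ q) = h1 \<otimes> h2" using plabel_append[OF L p2 2(3)] 1(4) 2(4) by simp
  ultimately show ?case using 2(1) lsubgraph_trans[OF 1(2) 2(2)] by blast
qed

text \<open>A path from the vertex \<open>S\<close> whose label is in \<open>S\<close> is a loop, so a subgraph with paths for a generating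
  set of \<open>S\<close> has all of \<open>S\<close> as its group of labels.\<close>

lemma ex_finite_subgraph:
  assumes S: "fin_gen G S" and X: "X \<subseteq> carrier G" "generate G X = carrier G"
    and Y: "finite Y" "Y \<subseteq> carrier G"
  shows "\<exists>\<Gamma>. fin_subgraph G \<Gamma> (cayley G X S) \<and> S \<in> verts \<Gamma> \<and> Lab G \<Gamma> S = S \<and>
    (\<forall>y\<in>Y. \<exists>p. lpath \<Gamma> S p (S #> y) \<and> plabel G p = y)"
proof -
  obtain A where A: "finite A" "A \<subseteq> carrier G" "S = generate G A" using S by (auto simp: fin_gen_def)
  have T: "subgroup S G" using fin_gen_subgroup[OF is_group S] .
  have SS: "S \<in> rcosets S" using T by (metis coset_join2 one_closed rcosetsI subgroup.one_closed subgroup.subset)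
  have "\<exists>\<Gamma>. fin_subgraph G \<Gamma> (cayley G X S) \<and> S \<in> verts \<Gamma> \<and>
      (\<forall>y\<in>W. \<exists>p. lpath \<Gamma> S p (S #> y) \<and> plabel G p = y)" if "finite W" "W \<subseteq> carrier G" for W
    using that
  proof (induction W)
    case empty
    have "fin_subgraph G \<lparr>verts = {S}, edges = {}\<rparr> (cayley G X S)"
      using SS by (auto simp: fin_subgraph_def lsubgraph_def cayley_def finite_lgraph_def lconnected_def intro!: exI[of _ "[]"])
    then show ?case by (intro exI[of _ "\<lparr>verts = {S}, edges = {}\<rparr>"]) simp
  next
    case (insert w W)
    then obtain \<Gamma> where \<Gamma>: "fin_subgraph G \<Gamma> (cayley G X S)" "S \<in> verts \<Gamma>"
      "\<forall>y\<in>W. \<exists>p. lpath \<Gamma> S p (S #> y) \<and> plabel G p = y" by auto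
    have "w \<in> generate G X" using insert X by simp
    from subgraph_extend_path[OF T X(1) \<Gamma>(1,2) this]
    obtain \<Gamma>' where \<Gamma>': "fin_subgraph G \<Gamma>' (cayley G X S)" "lsubgraph G \<Gamma> \<Gamma>'"
      "\<exists>p. lpath \<Gamma>' S p (S #> w) \<and> plabel G p = w" by blast
    have "S \<in> verts \<Gamma>'" using \<Gamma>(2) \<Gamma>'(2) by (auto simp: lsubgraph_def)
    moreover have "\<forall>y\<in>W. \<exists>p. lpath \<Gamma>' S p (S #> y) \<and> plabel G p = y"
      using \<Gamma>(3) lpath_lsubgraph[OF \<Gamma>'(2)] by blast
    ultimately show ?case using \<Gamma>' by blast
  qed
  from this[of "A \<union> Y"] A Y obtain \<Gamma> where \<Gamma>: "fin_subgraph G \<Gamma> (cayley G X S)" "S \<in> verts \<Gamma>"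
      "\<forall>y\<in>A \<union> Y. \<exists>p. lpath \<Gamma> S p (S #> y) \<and> plabel G p = y" by auto
  have s: "lsubgraph G \<Gamma> (cayley G X S)" using \<Gamma>(1) by (simp add: fin_subgraph_def)
  have L: "\<forall>(a, x, b)\<in>edges \<Gamma>. x \<in> carrier G" using cayley_labels[OF X(1) s] by blast
  have "Lab G \<Gamma> S \<subseteq> S"
  proof
    fix g assume "g \<in> Lab G \<Gamma> S"
    then obtain p where p: "lpath \<Gamma> S p S" "g = plabel G p" by (auto simp: Lab_def)
    then have "g \<in> carrier G" "S = S #> g" using lpath_cayley[OF T X(1) s] by blast+
    then show "g \<in> S" using coset_join1[of S g] T by simp
  qed
  moreover have "A \<subseteq> Lab G \<Gamma> S"
  proof
    fix a assume a: "a \<in> A"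
    then have "a \<in> S" using A by (simp add: generate.incl)
    then have "S #> a = S" using T a A by (intro coset_join2) auto
    moreover obtain p where "lpath \<Gamma> S p (S #> a)" "plabel G p = a" using \<Gamma>(3) a by blast
    ultimately show "a \<in> Lab G \<Gamma> S" unfolding Lab_def by auto
  qed
  then have "S \<subseteq> Lab G \<Gamma> S"
    unfolding A(3) using generate_subgroup_incl Lab_subgroup[OF L s \<Gamma>(2)] by (simp add: A(3))
  ultimately show ?thesis using \<Gamma> by blast
qed

end

section \<open>Strong separability in terms of subgroups\<close>

text \<open>What strong separability says about one of the two subgroups, in terms of the map
  \<open>T \ G \<rightarrow> L \ G\<close> and of a finite set of cosets, given by the set \<open>Y\<close> of their representatives.  The
  map is injective on these cosets, it does not merge \<open>G\<^sub>0\<close>-orbits that meet them, and it keeps the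
  \<open>G\<^sub>0\<close>-stabilizers of those that are outside the \<open>G\<^sub>0\<close>-orbit of the coset of \<open>u\<close>; the latter
  orbit becomes finite.\<close>

definition separating_overgroup ::
  "('a, 'm) monoid_scheme \<Rightarrow> 'a set \<Rightarrow> 'a set \<Rightarrow> 'a \<Rightarrow> 'a set \<Rightarrow> 'a set \<Rightarrow> bool" where
  "separating_overgroup G G\<^sub>0 T u Y L \<longleftrightarrow> fin_gen G L \<and> T \<subseteq> L \<and>
     (\<forall>a\<in>Y. \<forall>b\<in>Y. coset_step G L a \<one>\<^bsub>G\<^esub> b \<longrightarrow> coset_step G T a \<one>\<^bsub>G\<^esub> b) \<and>
     (\<forall>a\<in>Y. \<forall>b\<in>Y. \<forall>g\<in>G\<^sub>0. coset_step G L a g b \<longrightarrow> (\<exists>k\<in>G\<^sub>0. coset_step G T a k b)) \<and>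
     (\<forall>a\<in>Y. \<forall>g\<in>G\<^sub>0. coset_step G L a g a \<longrightarrow> coset_step G T a g a \<or> (\<exists>k\<in>G\<^sub>0. coset_step G T a k u)) \<and>
     finite_index (G\<lparr>carrier := G\<^sub>0\<rparr>) {g \<in> G\<^sub>0. coset_step G L u g u}"

locale group_with_generated_subgroup = group G for G (structure) +
  fixes X G\<^sub>0 X\<^sub>1
  assumes X: "X \<subseteq> carrier G" and generate_X: "generate G X = carrier G"
    and X\<^sub>1: "X\<^sub>1 \<subseteq> X" and generate_X\<^sub>1: "generate G X\<^sub>1 = G\<^sub>0"
begin

lemma subgroup_G\<^sub>0: "subgroup G\<^sub>0 G"
  using X X\<^sub>1 generate_X\<^sub>1 generate_is_subgroup by blast

lemma G\<^sub>0_carrier: "g \<in> G\<^sub>0 \<Longrightarrow> g \<in> carrier G"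
  using subgroup_G\<^sub>0 by (rule subgroup.mem_carrier)

lemma group_G\<^sub>0: "group (G\<lparr>carrier := G\<^sub>0\<rparr>)"
  by (rule subgroup_imp_group[OF subgroup_G\<^sub>0])

lemma X\<^sub>1_carrier: "X\<^sub>1 \<subseteq> carrier G"
  using X X\<^sub>1 by blast

lemma cayley_path:
  assumes T: "subgroup T G" and X': "X' \<subseteq> X" and g: "g \<in> generate G X'" and c: "c \<in> rcosets T"
  shows "\<exists>p. lpath (cayley G X T) c p (c #> g) \<and> plabel G p = g \<and> (\<forall>(a, x, b)\<in>set p. x \<in> star G X')"
  using g c
proof (induction arbitrary: c rule: generate.induct)
  case one
  have "c \<subseteq> carrier G" using T one subgroup.rcosets_carrier[OF T is_group] by blast
  then show ?case using one by (intro exI[of _ "[]"]) (simp add: cayley_def coset_mult_one)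
next
  case (incl h)
  have h: "h \<in> star G X" "h \<in> star G X'" "h \<in> carrier G" using incl X X' by (auto simp: star_def)
  then show ?case using incl T
    by (intro exI[of _ "[(c, h, c #> h)]"]) (auto simp: cayley_def rcosets_step)
next
  case (inv h)
  have h: "inv h \<in> star G X" "inv h \<in> star G X'" "inv h \<in> carrier G" using inv X X' by (auto simp: star_def)
  then show ?case using inv T
    by (intro exI[of _ "[(c, inv h, c #> inv h)]"]) (auto simp: cayley_def rcosets_step)
next
  case (eng h1 h2)
  have X'c: "X' \<subseteq> carrier G" using X X' by blast
  have hc: "h1 \<in> carrier G" "h2 \<in> carrier G" using eng(1,2) generate_in_carrier[OF X'c] by auto
  obtain p where p: "lpath (cayley G X T) c p (c #> h1)" "plabel G p = h1" "\<forall>(a, x, b)\<in>set p. x \<in> star G X'"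
    using eng(3)[OF eng(5)] by blast
  obtain q where q: "lpath (cayley G X T) (c #> h1) q (c #> h1 #> h2)" "plabel G q = h2" "\<forall>(a, x, b)\<in>set q. x \<in> star G X'"
    using eng(4)[OF rcosets_step[OF T eng(5) hc(1)]] by blast
  have L: "\<forall>(a, x, b)\<in>edges (cayley G X T). x \<in> carrier G"
    using cayley_labels[OF X lsubgraph_cayley[OF T X]] by blast
  have "c \<subseteq> carrier G" using T eng(5) subgroup.rcosets_carrier[OF T is_group] by blast
  then have "c #> h1 #> h2 = c #> (h1 \<otimes> h2)" using hc by (simp add: coset_mult_assoc)
  then have "lpath (cayley G X T) c (p @ q) (c #> (h1 \<otimes> h2))" using lpath_append[OF p(1) q(1)] by simp
  moreover have "plabel G (p @ q) = h1 \<otimes> h2" using plabel_append[OF L p(1) q(1)] p(2) q(2) by simp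
  moreover have "\<forall>(a, x, b)\<in>set (p @ q). x \<in> star G X'" using p(3) q(3) by auto
  ultimately show ?case by blast
qed

lemma plabel_in_generate:
  assumes "\<forall>(a, x, b)\<in>set p. x \<in> star G X'"
  shows "plabel G p \<in> generate G X'"
  using assms
proof (induction p)
  case Nil
  then show ?case by (simp add: generate.one)
next
  case (Cons e p)
  obtain a x b where e: "e = (a, x, b)" by (cases e)
  have "x \<in> generate G X'"
    using Cons.prems by (auto simp: e star_def intro: generate.incl generate.inv)
  moreover have "plabel G p \<in> generate G X'" using Cons by simp
  ultimately show ?case by (simp add: e generate.eng)
qed

lemma component_cayley:
  assumes T: "subgroup T G" and c: "c \<in> rcosets T"
  shows "w \<in> verts (component (star G X\<^sub>1) (cayley G X T) c) \<longleftrightarrow> (\<exists>g\<in>G\<^sub>0. w = c #> g)"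
proof
  assume "w \<in> verts (component (star G X\<^sub>1) (cayley G X T) c)"
  then obtain p where p: "lpath (cayley G X T) c p w" "\<forall>(a, x, b)\<in>set p. x \<in> star G X\<^sub>1"
    by (auto simp: component_def)
  then show "\<exists>g\<in>G\<^sub>0. w = c #> g"
    using plabel_in_generate[OF p(2)] lpath_cayley[OF T X lsubgraph_cayley[OF T X] p(1)] generate_X\<^sub>1 by blast
next
  assume "\<exists>g\<in>G\<^sub>0. w = c #> g"
  then obtain g where "g \<in> generate G X\<^sub>1" "w = c #> g" using generate_X\<^sub>1 by blast
  then show "w \<in> verts (component (star G X\<^sub>1) (cayley G X T) c)"
    using cayley_path[OF T X\<^sub>1 _ c] unfolding component_def by fastforce
qed

lemma Lab_cayley:
  assumes T: "subgroup T G" and y: "y \<in> carrier G"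
  shows "Lab G (cayley G X T) (T #> y) = {g \<in> carrier G. coset_step G T y g y}"
proof -
  have c: "T #> y \<in> rcosets T" using y T by (simp add: rcosetsI subgroup.subset)
  have "g \<in> Lab G (cayley G X T) (T #> y) \<longleftrightarrow> g \<in> carrier G \<and> T #> y = T #> y #> g" for g
    using lpath_cayley[OF T X lsubgraph_cayley[OF T X], of "T #> y" _ "T #> y"]
      cayley_path[OF T subset_refl _ c, of g] generate_X unfolding Lab_def by fastforce
  moreover have "T #> y = T #> y #> g \<longleftrightarrow> coset_step G T y g y" if "g \<in> carrier G" for g
    using coset_step_iff[OF T y y that] coset_mult_assoc[OF subgroup.subset[OF T] y that] by auto
  ultimately show ?thesis by blast
qed

lemma lpath_graph_image:
  assumes "lembedding G f \<Gamma> \<Delta>" "lpath \<Gamma> u p w"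
  shows "\<exists>q. lpath \<Delta> (f u) q (f w) \<and> plabel G q = plabel G p"
  using assms(2)
proof (induction p arbitrary: u)
  case Nil
  then show ?case using assms(1)
    by (intro exI[of _ "[]"]) (auto simp: lembedding_def lsubgraph_def graph_image_def)
next
  case (Cons e p)
  obtain x c where e: "e = (u, x, c)" "(u, x, c) \<in> edges \<Gamma>" "lpath \<Gamma> c p w" using Cons.prems by (cases e) auto
  obtain q where "lpath \<Delta> (f c) q (f w)" "plabel G q = plabel G p" using Cons.IH[OF e(3)] by blast
  moreover have "(f u, x, f c) \<in> edges \<Delta>"
    using assms(1) e(2) unfolding lembedding_def lsubgraph_def graph_image_def by force
  ultimately show ?case by (intro exI[of _ "(f u, x, f c) # q"]) (simp add: e(1))
qed

text \<open>In a cover of \<open>G\<^sub>0\<close> an edge with any given label from \<open>X\<^sub>1\<close> or its inverses starts at every vertex.  So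
  every element of \<open>G\<^sub>0\<close> labels a path from \<open>b\<close> in the finite graph \<open>\<Delta>\<close>, and two elements whose paths end
  at the same vertex differ by the label of a loop at \<open>b\<close>.\<close>

lemma finite_cover_component:
  assumes \<Delta>: "lsubgraph G \<Delta> \<Delta>" and L: "\<forall>(a, x, b)\<in>edges \<Delta>. x \<in> carrier G"
    and fin: "finite_lgraph \<Delta>" and b: "b \<in> verts \<Delta>"
    and cov: "is_cover (G\<lparr>carrier := G\<^sub>0\<rparr>) X\<^sub>1 (component (star G X\<^sub>1) \<Delta> b)"
  shows "finite_index (G\<lparr>carrier := G\<^sub>0\<rparr>) (Lab G \<Delta> b \<inter> G\<^sub>0)"
proof -
  let ?G0 = "G\<lparr>carrier := G\<^sub>0\<rparr>" and ?C = "component (star G X\<^sub>1) \<Delta> b"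
  note C = component_maximal[OF \<Delta> b, of "star G X\<^sub>1"]
  have star_closed: "\<And>x. x \<in> star G X\<^sub>1 \<Longrightarrow> inv x \<in> star G X\<^sub>1" by (rule star_inv[OF X\<^sub>1_carrier])
  have C1: "lsubgraph G ?C \<Delta>" and bC: "b \<in> verts ?C" using C(1,3) star_closed by blast+
  obtain S' h where h: "inj_on h (verts ?C)" "graph_image h ?C = cayley ?G0 X\<^sub>1 S'"
    using cov unfolding is_cover_def lisomorphic_def by blast
  have X1: "X\<^sub>1 \<subseteq> G\<^sub>0" using generate_X\<^sub>1 generate.incl by fastforce
  have st: "star ?G0 X\<^sub>1 = star G X\<^sub>1"
    unfolding star_def using m_inv_consistent[OF subgroup_G\<^sub>0] X1 by (auto simp: image_def subset_iff)
  have sat: "\<exists>w. (u, s, w) \<in> edges ?C \<and> w \<in> verts ?C" if u: "u \<in> verts ?C" and s: "s \<in> star G X\<^sub>1" for u s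
  proof -
    have "h u \<in> verts (graph_image h ?C)" using u by (simp add: graph_image_def)
    then have "(h u, s, h u #>\<^bsub>?G0\<^esub> s) \<in> edges (graph_image h ?C)"
      using s st unfolding h(2) by (auto simp: cayley_def)
    then obtain a w where e: "(a, s, w) \<in> edges ?C" "h a = h u" by (auto simp: graph_image_def)
    have "a \<in> verts ?C" "w \<in> verts ?C" using e(1) C1 unfolding lsubgraph_def by blast+
    moreover have "a = u" using inj_onD[OF h(1) e(2)] calculation(1) u by blast
    ultimately show ?thesis using e(1) by blast
  qed
  have edge: "(u, s, w) \<in> edges \<Delta>" "w \<in> verts \<Delta>" if "(u, s, w) \<in> edges ?C" for u s w
    using that C1 unfolding lsubgraph_def by blast+
  have CD: "verts ?C \<subseteq> verts \<Delta>" using C1 by (simp add: lsubgraph_def)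
  have path: "\<exists>p w. lpath \<Delta> u p w \<and> plabel G p = g \<and> w \<in> verts ?C" if "g \<in> generate G X\<^sub>1" "u \<in> verts ?C" for g u
    using that
  proof (induction arbitrary: u rule: generate.induct)
    case one
    then show ?case using CD by (intro exI[of _ "[]"]) auto
  next
    case (incl s)
    then have s: "s \<in> star G X\<^sub>1" "s \<in> carrier G" using X\<^sub>1_carrier by (auto simp: star_def)
    obtain w where "(u, s, w) \<in> edges ?C" "w \<in> verts ?C" using sat[OF incl(2) s(1)] by blast
    then show ?case using edge s by (intro exI[of _ "[(u, s, w)]"]) auto
  next
    case (inv s)
    then have s: "inv s \<in> star G X\<^sub>1" "inv s \<in> carrier G" using X\<^sub>1_carrier by (auto simp: star_def)
    obtain w where "(u, inv s, w) \<in> edges ?C" "w \<in> verts ?C" using sat[OF inv(2) s(1)] by blast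
    then show ?case using edge s by (intro exI[of _ "[(u, inv s, w)]"]) auto
  next
    case (eng h1 h2)
    obtain p w where p: "lpath \<Delta> u p w" "plabel G p = h1" "w \<in> verts ?C" using eng(3)[OF eng(5)] by blast
    obtain q z where q: "lpath \<Delta> w q z" "plabel G q = h2" "z \<in> verts ?C" using eng(4)[OF p(3)] by blast
    have "plabel G (p @ q) = h1 \<otimes> h2" using plabel_append[OF L p(1) q(1)] p(2) q(2) by simp
    then show ?case using lpath_append[OF p(1) q(1)] q(3) by blast
  qed
  define \<phi> where "\<phi> = (\<lambda>g. SOME w. \<exists>p. lpath \<Delta> b p w \<and> plabel G p = g \<and> w \<in> verts ?C)"
  have \<phi>: "\<exists>p. lpath \<Delta> b p (\<phi> g) \<and> plabel G p = g \<and> \<phi> g \<in> verts ?C" if "g \<in> G\<^sub>0" for g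
  proof -
    have "\<exists>w p. lpath \<Delta> b p w \<and> plabel G p = g \<and> w \<in> verts ?C"
      using path[OF _ bC, of g] that generate_X\<^sub>1 by blast
    then show ?thesis unfolding \<phi>_def by (rule someI_ex)
  qed
  have LG: "subgroup (Lab G \<Delta> b) G" by (rule Lab_subgroup[OF L \<Delta> b])
  have sub: "subgroup (Lab G \<Delta> b \<inter> G\<^sub>0) ?G0"
    by (rule subgroup_incl[OF subgroups_Inter_pair[OF LG subgroup_G\<^sub>0] subgroup_G\<^sub>0]) simp
  show ?thesis
  proof (rule group.finite_index_if_finite_map[OF group_G\<^sub>0 sub, of "verts \<Delta>" \<phi>])
    show "finite (verts \<Delta>)" using fin by (simp add: finite_lgraph_def)
    show "\<phi> x \<in> verts \<Delta>" if "x \<in> carrier ?G0" for x using \<phi>[of x] that CD by auto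
    fix x y assume xy: "x \<in> carrier ?G0" "y \<in> carrier ?G0" "\<phi> x = \<phi> y"
    obtain p where p: "lpath \<Delta> b p (\<phi> x)" "plabel G p = x" using \<phi>[of x] xy by auto
    obtain q where q: "lpath \<Delta> b q (\<phi> x)" "plabel G q = y" using \<phi>[of y] xy by auto
    obtain r where r: "lpath \<Delta> (\<phi> x) r b" "plabel G r = inv y" using lpath_rev_label[OF L \<Delta> q(1)] q(2) by blast
    have "plabel G (p @ r) = x \<otimes> inv y" using plabel_append[OF L p(1) r(1)] p(2) r(2) by simp
    then have "x \<otimes> inv y \<in> Lab G \<Delta> b" using lpath_append[OF p(1) r(1)] unfolding Lab_def by (auto intro: HOL.sym)
    moreover have "x \<otimes> inv y \<in> G\<^sub>0"
      using xy subgroup_G\<^sub>0 by (simp add: subgroup.m_closed subgroup.m_inv_closed)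
    ultimately show "x \<otimes>\<^bsub>?G0\<^esub> inv\<^bsub>?G0\<^esub> y \<in> Lab G \<Delta> b \<inter> G\<^sub>0"
      using xy m_inv_consistent[OF subgroup_G\<^sub>0] by simp
  qed
qed

text \<open>Take \<open>L\<close> to be the group of labels of \<open>(\<Delta>, b)\<close>.  A path in \<open>\<Gamma>\<close> from the base vertex to \<open>S y\<close> with
  label \<open>y\<close> is carried to a path in \<open>\<Delta>\<close> with the same label, so the vertex \<open>S y\<close> goes to the coset \<open>L y\<close>.
  Thus the embedding of \<open>\<Gamma>'\<close> in the cover of \<open>\<Delta>\<close> agrees with the natural map \<open>S \ G \<rightarrow> L \ G\<close> on the
  cosets of \<open>Y\<close>, and the conditions on vertices, components and label groups become the required
  conditions on cosets, \<open>G\<^sub>0\<close>-orbits and \<open>G\<^sub>0\<close>-stabilizers.\<close>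

lemma separating_overgroup_if_data:
  assumes S: "fin_gen G S" and \<Gamma>: "fin_subgraph G \<Gamma> (cayley G X S)" "S \<in> verts \<Gamma>" "Lab G \<Gamma> S = S"
    and Y: "Y \<subseteq> carrier G" "\<forall>y\<in>Y. \<exists>p. lpath \<Gamma> S p (S #> y) \<and> plabel G p = y"
    and data: "strong_separability_data G X G\<^sub>0 X\<^sub>1 \<Gamma> S \<Gamma>' \<Delta> b f"
  shows "separating_overgroup G G\<^sub>0 S \<one> Y (Lab G \<Delta> b)"
proof -
  let ?L = "Lab G \<Delta> b" and ?K = "cayley G X S"
  let ?j = "\<lambda>u. tilde_map G \<Delta> b (f u)"
  have T: "subgroup S G" using fin_gen_subgroup[OF is_group S] .
  have s\<Gamma>: "lsubgraph G \<Gamma> ?K" and con\<Gamma>: "lconnected \<Gamma>" using \<Gamma>(1) by (auto simp: fin_subgraph_def)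
  have L\<Gamma>: "\<forall>(a, x, b)\<in>edges \<Gamma>. x \<in> carrier G" using cayley_labels[OF X s\<Gamma>] by blast
  \<comment> \<open>The label group of \<open>(\<Gamma>, S)\<close> is \<open>S\<close>, so \<open>\<Gamma>\<close> is its own image in its cover.\<close>
  have id: "tilde_map G \<Gamma> S w = w" if w: "w \<in> verts \<Gamma>" for w
  proof -
    obtain p where p: "lpath \<Gamma> S p w" using con\<Gamma> w \<Gamma>(2) unfolding lconnected_def by blast
    show ?thesis using tilde_map_coset[OF L\<Gamma> s\<Gamma> p] lpath_cayley[OF T X s\<Gamma> p] \<Gamma>(3) by simp
  qed
  have K: "tilde G X \<Gamma> S = ?K" using \<Gamma>(3) by (simp add: tilde_def)
  note data' = data[unfolded strong_separability_data_def Let_def K id[OF \<Gamma>(2)]]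
  have \<Gamma>\<Gamma>': "lsubgraph G (graph_image (tilde_map G \<Gamma> S) \<Gamma>) \<Gamma>'"
    and emb: "lembedding G f \<Gamma>' \<Delta>" and fS: "f S = b" and cov\<Delta>: "fin_subgraph_of_cover G X \<Delta> b"
    and cov: "is_cover (G\<lparr>carrier := G\<^sub>0\<rparr>) X\<^sub>1 (component (star G X\<^sub>1) \<Delta> b)"
    and stab: "\<And>u. u \<in> verts \<Gamma>' \<Longrightarrow> u \<notin> verts (component (star G X\<^sub>1) ?K S) \<Longrightarrow>
           Lab G ?K u \<inter> G\<^sub>0 = Lab G (tilde G X \<Delta> b) (?j u) \<inter> G\<^sub>0"
    and comp: "\<And>u w. u \<in> verts \<Gamma>' \<Longrightarrow> w \<in> verts \<Gamma>' \<Longrightarrow>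
           ?j w \<in> verts (component (star G X\<^sub>1) (tilde G X \<Delta> b) (?j u)) \<longleftrightarrow> w \<in> verts (component (star G X\<^sub>1) ?K u)"
    using data' by blast+
  have incl: "verts \<Gamma> \<subseteq> verts \<Gamma>'" "edges \<Gamma> \<subseteq> edges \<Gamma>'"
  proof -
    have "w \<in> tilde_map G \<Gamma> S ` verts \<Gamma>" if "w \<in> verts \<Gamma>" for w
      using that id by force
    then show "verts \<Gamma> \<subseteq> verts \<Gamma>'" using \<Gamma>\<Gamma>' by (auto simp: lsubgraph_def graph_image_def)
    have "e \<in> (\<lambda>(u, x, w). (tilde_map G \<Gamma> S u, x, tilde_map G \<Gamma> S w)) ` edges \<Gamma>" if e: "e \<in> edges \<Gamma>" for e
    proof -
      obtain u x w where "e = (u, x, w)" by (cases e)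
      moreover from this have "u \<in> verts \<Gamma>" "w \<in> verts \<Gamma>" using e s\<Gamma> unfolding lsubgraph_def by blast+
      ultimately show ?thesis using e id by (force intro: image_eqI[of _ _ e])
    qed
    then show "edges \<Gamma> \<subseteq> edges \<Gamma>'" using \<Gamma>\<Gamma>' by (auto simp: lsubgraph_def graph_image_def)
  qed
  have to\<Delta>: "\<exists>q. lpath \<Delta> (f u) q (f w) \<and> plabel G q = plabel G p" if "lpath \<Gamma> u p w" for u p w
    by (rule lpath_graph_image[OF emb lpath_mono[OF incl that]])
  obtain R where R: "subgroup R G" "lsubgraph G \<Delta> (cayley G X R)" "finite_lgraph \<Delta>" "lconnected \<Delta>" "b \<in> verts \<Delta>"
    using cov\<Delta> by (auto simp: fin_subgraph_of_cover_def fin_subgraph_def)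
  have L\<Delta>: "\<forall>(a, x, b)\<in>edges \<Delta>. x \<in> carrier G" using cayley_labels[OF X R(2)] by blast
  have L: "fin_gen G ?L" "subgroup ?L G"
    using fin_gen_Lab[OF L\<Delta> R(2-5)] Lab_subgroup[OF L\<Delta> R(2,5)] by auto
  have SL: "S \<subseteq> ?L"
  proof
    fix g assume "g \<in> S"
    then obtain p where p: "lpath \<Gamma> S p S" "g = plabel G p" using \<Gamma>(3) by (auto simp: Lab_def)
    obtain q where "lpath \<Delta> b q b" "plabel G q = g" using to\<Delta>[OF p(1)] p(2) fS by auto
    then show "g \<in> ?L" unfolding Lab_def by blast
  qed
  have Yv: "S #> y \<in> verts \<Gamma>'" "?j (S #> y) = ?L #> y" "y \<in> carrier G" if y: "y \<in> Y" for y
  proof -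
    obtain p where p: "lpath \<Gamma> S p (S #> y)" "plabel G p = y" using Y y by blast
    show "S #> y \<in> verts \<Gamma>'" using lpath_verts[OF s\<Gamma> p(1)] incl(1) by blast
    obtain q where "lpath \<Delta> b q (f (S #> y))" "plabel G q = y" using to\<Delta>[OF p(1)] p(2) fS by auto
    then show "?j (S #> y) = ?L #> y" using tilde_map_coset[OF L\<Delta> R(2)] by blast
    show "y \<in> carrier G" using y Y by blast
  qed
  have rc: "V #> y \<in> rcosets V" if "subgroup V G" "y \<in> carrier G" for V y
    using that by (simp add: rcosetsI subgroup.subset)
  have assoc: "V #> y #> g = V #> (y \<otimes> g)" if "subgroup V G" "y \<in> carrier G" "g \<in> carrier G" for V y g
    using that by (simp add: coset_mult_assoc subgroup.subset)
  have inj: "coset_step G S a \<one> c" if a: "a \<in> Y" and c: "c \<in> Y" and st: "coset_step G ?L a \<one> c" for a c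
  proof -
    have "?j (S #> a) = ?j (S #> c)"
      using st coset_step_iff[OF L(2), of a c \<one>] Yv[OF a] Yv[OF c] by simp
    moreover have "f (S #> a) \<in> verts \<Delta>" "f (S #> c) \<in> verts \<Delta>"
      using emb Yv(1)[OF a] Yv(1)[OF c] by (auto simp: lembedding_def lsubgraph_def graph_image_def)
    ultimately have "f (S #> a) = f (S #> c)"
      using tilde_map_embedding(1)[OF X cov\<Delta>] unfolding lembedding_def by (meson inj_onD)
    then have "S #> a = S #> c"
      using emb Yv(1)[OF a] Yv(1)[OF c] unfolding lembedding_def by (meson inj_onD)
    then show ?thesis using coset_step_iff[OF T, of a c \<one>] Yv[OF a] Yv[OF c] by simp
  qed
  have orb: "\<exists>k\<in>G\<^sub>0. coset_step G S a k c"
    if a: "a \<in> Y" and c: "c \<in> Y" and g: "g \<in> G\<^sub>0" and st: "coset_step G ?L a g c" for a c g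
  proof -
    have "?L #> c = ?L #> a #> g"
      using st coset_step_iff[OF L(2)] Yv[OF a] Yv[OF c] G\<^sub>0_carrier[OF g] assoc[OF L(2)] by simp
    then have "?j (S #> c) \<in> verts (component (star G X\<^sub>1) (tilde G X \<Delta> b) (?j (S #> a)))"
      unfolding tilde_def Yv(2)[OF a] Yv(2)[OF c] component_cayley[OF L(2) rc[OF L(2) Yv(3)[OF a]]]
      using g by blast
    then have "S #> c \<in> verts (component (star G X\<^sub>1) ?K (S #> a))"
      using comp[OF Yv(1)[OF a] Yv(1)[OF c]] by simp
    then obtain k where k: "k \<in> G\<^sub>0" "S #> c = S #> a #> k"
      unfolding component_cayley[OF T rc[OF T Yv(3)[OF a]]] by blast
    then have "coset_step G S a k c"
      using coset_step_iff[OF T] Yv[OF a] Yv[OF c] G\<^sub>0_carrier[OF k(1)] assoc[OF T] by simp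
    then show ?thesis using k(1) by blast
  qed
  have stb: "coset_step G S a g a \<or> (\<exists>k\<in>G\<^sub>0. coset_step G S a k \<one>)"
    if a: "a \<in> Y" and g: "g \<in> G\<^sub>0" and st: "coset_step G ?L a g a" for a g
  proof (cases "S #> a \<in> verts (component (star G X\<^sub>1) ?K S)")
    case True
    have S1: "S #> \<one> = S" using T by (simp add: coset_join2 subgroup.one_closed)
    obtain k where k: "k \<in> G\<^sub>0" "S #> a = S #> k"
      using True component_cayley[OF T, of S] rc[OF T one_closed] unfolding S1 by auto
    then have "coset_step G S \<one> k a"
      using coset_step_iff[OF T one_closed Yv(3)[OF a]] G\<^sub>0_carrier by simp
    then have "coset_step G S a (inv k) \<one>"
      using coset_step_inv[OF T] Yv(3)[OF a] G\<^sub>0_carrier[OF k(1)] by simp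
    then show ?thesis using k(1) subgroup_G\<^sub>0 by (auto simp: subgroup.m_inv_closed)
  next
    case False
    have "g \<in> Lab G (tilde G X \<Delta> b) (?j (S #> a)) \<inter> G\<^sub>0"
      using st g G\<^sub>0_carrier unfolding tilde_def Yv(2)[OF a] Lab_cayley[OF L(2) Yv(3)[OF a]] by simp
    then have "g \<in> Lab G ?K (S #> a)" using stab[OF Yv(1)[OF a] False] by blast
    then show ?thesis unfolding Lab_cayley[OF T Yv(3)[OF a]] by simp
  qed
  have "{g \<in> G\<^sub>0. coset_step G ?L \<one> g \<one>} = ?L \<inter> G\<^sub>0"
    using G\<^sub>0_carrier by (auto simp: coset_step_def)
  moreover have "lsubgraph G \<Delta> \<Delta>" using R(2) by (simp add: lsubgraph_def)
  ultimately have "finite_index (G\<lparr>carrier := G\<^sub>0\<rparr>) {g \<in> G\<^sub>0. coset_step G ?L \<one> g \<one>}"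
    using finite_cover_component[OF _ L\<Delta> R(3,5) cov] by simp
  then show ?thesis
    unfolding separating_overgroup_def using L(1) SL inj orb stb by blast
qed

text \<open>Carries \<open>separating_overgroup\<close> from the base coset of \<open>u\<^sup>-\<^sup>1 T u\<close>, the only position of which strong
  separability speaks, to the coset of \<open>u\<close> in \<open>T \ G\<close>.\<close>

lemma separating_overgroup_conjugate:
  assumes u: "u \<in> carrier G" and Y: "Y \<subseteq> carrier G" and T: "subgroup T G"
    and L: "separating_overgroup G G\<^sub>0 (conjugate_subgroup G u T) \<one> ((\<lambda>y. inv u \<otimes> y) ` Y) L"
  shows "separating_overgroup G G\<^sub>0 T u Y (conjugate_subgroup G (inv u) L)"
proof -
  let ?S = "conjugate_subgroup G u T" and ?M = "conjugate_subgroup G (inv u) L"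
  have M: "coset_step G ?M a g c \<longleftrightarrow> coset_step G L (inv u \<otimes> a) g (inv u \<otimes> c)"
    if "a \<in> carrier G" "c \<in> carrier G" "g \<in> carrier G" for a g c
    using coset_step_conjugate[of "inv u" "inv u \<otimes> a" "inv u \<otimes> c" g L] that u
    by (simp add: mult_inv_cancel)
  note S = coset_step_conjugate[OF u, of _ _ _ T]
  note L' = L[unfolded separating_overgroup_def]
  have 1: "fin_gen G ?M" using fin_gen_conjugate_subgroup L' u by simp
  have 2: "T \<subseteq> ?M"
  proof
    fix t assume t: "t \<in> T"
    then have tc: "t \<in> carrier G" using T by (simp add: subgroup.mem_carrier)
    have "inv u \<otimes> t \<otimes> u \<in> ?S"
      using t tc u by (simp add: conjugate_subgroup_def m_assoc mult_inv_cancel)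
    then show "t \<in> ?M" using L' tc u by (auto simp: conjugate_subgroup_def)
  qed
  have c: "a \<in> carrier G" if "a \<in> Y" for a using that Y by blast
  have uu: "inv u \<otimes> u = \<one>" using u by simp
  have G0: "coset_step G ?M u g u \<longleftrightarrow> coset_step G L \<one> g \<one>" if "g \<in> G\<^sub>0" for g
    using M[OF u u G\<^sub>0_carrier[OF that]] uu by simp
  have 3: "coset_step G T a \<one> d" if "a \<in> Y" "d \<in> Y" "coset_step G ?M a \<one> d" for a d
  proof -
    have "coset_step G L (inv u \<otimes> a) \<one> (inv u \<otimes> d)" using M that c by simp
    then have "coset_step G ?S (inv u \<otimes> a) \<one> (inv u \<otimes> d)" using L' that by blast
    then show ?thesis using S that c by simp
  qed
  have 4: "\<exists>k\<in>G\<^sub>0. coset_step G T a k d" if ad: "a \<in> Y" "d \<in> Y" "g \<in> G\<^sub>0" "coset_step G ?M a g d" for a d g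
  proof -
    have "coset_step G L (inv u \<otimes> a) g (inv u \<otimes> d)" using M ad c G\<^sub>0_carrier by simp
    moreover have "\<forall>a\<in>(\<lambda>y. inv u \<otimes> y) ` Y. \<forall>b\<in>(\<lambda>y. inv u \<otimes> y) ` Y. \<forall>g\<in>G\<^sub>0.
        coset_step G L a g b \<longrightarrow> (\<exists>k\<in>G\<^sub>0. coset_step G ?S a k b)"
      using L' by blast
    ultimately obtain k where "k \<in> G\<^sub>0" "coset_step G ?S (inv u \<otimes> a) k (inv u \<otimes> d)"
      using ad(1-3) by blast
    then show ?thesis using S ad c G\<^sub>0_carrier by auto
  qed
  have 5: "coset_step G T a g a \<or> (\<exists>k\<in>G\<^sub>0. coset_step G T a k u)"
    if "a \<in> Y" "g \<in> G\<^sub>0" "coset_step G ?M a g a" for a g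
  proof -
    have "coset_step G L (inv u \<otimes> a) g (inv u \<otimes> a)" using M that c G\<^sub>0_carrier by simp
    then have "coset_step G ?S (inv u \<otimes> a) g (inv u \<otimes> a) \<or>
        (\<exists>k\<in>G\<^sub>0. coset_step G ?S (inv u \<otimes> a) k (inv u \<otimes> u))"
      using L' that unfolding uu by blast
    moreover have "coset_step G ?S (inv u \<otimes> a) k (inv u \<otimes> u) \<longleftrightarrow> coset_step G T a k u" if "k \<in> G\<^sub>0" for k
      using S u \<open>a \<in> Y\<close> c G\<^sub>0_carrier that by blast
    moreover have "coset_step G ?S (inv u \<otimes> a) g (inv u \<otimes> a) \<longleftrightarrow> coset_step G T a g a"
      using S that c G\<^sub>0_carrier by blast
    ultimately show ?thesis by blast
  qed
  have "{g \<in> G\<^sub>0. coset_step G ?M u g u} = {g \<in> G\<^sub>0. coset_step G L \<one> g \<one>}" using G0 by blast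
  then have 6: "finite_index (G\<lparr>carrier := G\<^sub>0\<rparr>) {g \<in> G\<^sub>0. coset_step G ?M u g u}" using L' by simp
  show ?thesis unfolding separating_overgroup_def using 1 2 3 4 5 6 by blast
qed

lemma conjugate_inter_G\<^sub>0:
  assumes "u \<in> carrier G"
  shows "conjugate_subgroup G u T \<inter> G\<^sub>0 = {g \<in> G\<^sub>0. coset_step G T u g u}"
  using G\<^sub>0_carrier by (auto simp: conjugate_subgroup_def coset_step_def)

text \<open>Conjugation moves the cosets of \<open>u\<^sub>1\<close> and \<open>u\<^sub>2\<close> to the base vertices of two covers.  Their common
  \<open>G\<^sub>0\<close>-stabilizer becomes the intersection with \<open>G\<^sub>0\<close>, as strong separability requires.\<close>

lemma simultaneous_separating_overgroups:
  assumes sep: "strongly_separable G X G\<^sub>0 X\<^sub>1"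
    and T: "fin_gen G T\<^sub>1" "fin_gen G T\<^sub>2" and u: "u\<^sub>1 \<in> carrier G" "u\<^sub>2 \<in> carrier G"
    and eq: "\<And>g. g \<in> G\<^sub>0 \<Longrightarrow> coset_step G T\<^sub>1 u\<^sub>1 g u\<^sub>1 \<longleftrightarrow> coset_step G T\<^sub>2 u\<^sub>2 g u\<^sub>2"
    and inf: "\<not> finite_index (G\<lparr>carrier := G\<^sub>0\<rparr>) {g \<in> G\<^sub>0. coset_step G T\<^sub>1 u\<^sub>1 g u\<^sub>1}"
    and Y: "finite Y\<^sub>1" "Y\<^sub>1 \<subseteq> carrier G" "finite Y\<^sub>2" "Y\<^sub>2 \<subseteq> carrier G"
  shows "\<exists>L\<^sub>1 L\<^sub>2. separating_overgroup G G\<^sub>0 T\<^sub>1 u\<^sub>1 Y\<^sub>1 L\<^sub>1 \<and> separating_overgroup G G\<^sub>0 T\<^sub>2 u\<^sub>2 Y\<^sub>2 L\<^sub>2 \<and>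
    (\<forall>g\<in>G\<^sub>0. coset_step G L\<^sub>1 u\<^sub>1 g u\<^sub>1 \<longleftrightarrow> coset_step G L\<^sub>2 u\<^sub>2 g u\<^sub>2)"
proof -
  define S\<^sub>1 S\<^sub>2 where S_def: "S\<^sub>1 = conjugate_subgroup G u\<^sub>1 T\<^sub>1" "S\<^sub>2 = conjugate_subgroup G u\<^sub>2 T\<^sub>2"
  have S: "fin_gen G S\<^sub>1" "fin_gen G S\<^sub>2" using fin_gen_conjugate_subgroup T u by (auto simp: S_def)
  have SG: "S\<^sub>1 \<inter> G\<^sub>0 = {g \<in> G\<^sub>0. coset_step G T\<^sub>1 u\<^sub>1 g u\<^sub>1}" "S\<^sub>2 \<inter> G\<^sub>0 = {g \<in> G\<^sub>0. coset_step G T\<^sub>2 u\<^sub>2 g u\<^sub>2}"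
    using conjugate_inter_G\<^sub>0 u by (auto simp: S_def)
  let ?Y1 = "(\<lambda>y. inv u\<^sub>1 \<otimes> y) ` Y\<^sub>1" and ?Y2 = "(\<lambda>y. inv u\<^sub>2 \<otimes> y) ` Y\<^sub>2"
  have Yc: "?Y1 \<subseteq> carrier G" "?Y2 \<subseteq> carrier G" using Y u by auto
  obtain \<Gamma>\<^sub>1 where 1: "fin_subgraph G \<Gamma>\<^sub>1 (cayley G X S\<^sub>1)" "S\<^sub>1 \<in> verts \<Gamma>\<^sub>1" "Lab G \<Gamma>\<^sub>1 S\<^sub>1 = S\<^sub>1"
    "\<forall>y\<in>?Y1. \<exists>p. lpath \<Gamma>\<^sub>1 S\<^sub>1 p (S\<^sub>1 #> y) \<and> plabel G p = y"
    using ex_finite_subgraph[OF S(1) X generate_X _ Yc(1)] Y by blast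
  obtain \<Gamma>\<^sub>2 where 2: "fin_subgraph G \<Gamma>\<^sub>2 (cayley G X S\<^sub>2)" "S\<^sub>2 \<in> verts \<Gamma>\<^sub>2" "Lab G \<Gamma>\<^sub>2 S\<^sub>2 = S\<^sub>2"
    "\<forall>y\<in>?Y2. \<exists>p. lpath \<Gamma>\<^sub>2 S\<^sub>2 p (S\<^sub>2 #> y) \<and> plabel G p = y"
    using ex_finite_subgraph[OF S(2) X generate_X _ Yc(2)] Y by blast
  have cov: "fin_subgraph_of_cover G X \<Gamma>\<^sub>1 S\<^sub>1" "fin_subgraph_of_cover G X \<Gamma>\<^sub>2 S\<^sub>2"
    unfolding fin_subgraph_of_cover_def
    using 1(1,2) 2(1,2) fin_gen_subgroup[OF is_group S(1)] fin_gen_subgroup[OF is_group S(2)] by blast+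
  have "S\<^sub>1 \<inter> G\<^sub>0 = S\<^sub>2 \<inter> G\<^sub>0" "\<not> finite_index (G\<lparr>carrier := G\<^sub>0\<rparr>) (S\<^sub>1 \<inter> G\<^sub>0)"
    using SG eq inf by auto
  then obtain \<Gamma>\<^sub>1' \<Gamma>\<^sub>2' \<Delta>\<^sub>1 \<Delta>\<^sub>2 b\<^sub>1 b\<^sub>2 f\<^sub>1 f\<^sub>2 where d:
    "strong_separability_data G X G\<^sub>0 X\<^sub>1 \<Gamma>\<^sub>1 S\<^sub>1 \<Gamma>\<^sub>1' \<Delta>\<^sub>1 b\<^sub>1 f\<^sub>1"
    "strong_separability_data G X G\<^sub>0 X\<^sub>1 \<Gamma>\<^sub>2 S\<^sub>2 \<Gamma>\<^sub>2' \<Delta>\<^sub>2 b\<^sub>2 f\<^sub>2"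
    "Lab G \<Delta>\<^sub>1 b\<^sub>1 \<inter> G\<^sub>0 = Lab G \<Delta>\<^sub>2 b\<^sub>2 \<inter> G\<^sub>0"
    using sep[unfolded strongly_separable_def, rule_format, of S\<^sub>1 S\<^sub>2 \<Gamma>\<^sub>1 S\<^sub>1 \<Gamma>\<^sub>2 S\<^sub>2] S cov 1(3) 2(3) by blast
  let ?L1 = "conjugate_subgroup G (inv u\<^sub>1) (Lab G \<Delta>\<^sub>1 b\<^sub>1)" and ?L2 = "conjugate_subgroup G (inv u\<^sub>2) (Lab G \<Delta>\<^sub>2 b\<^sub>2)"
  have "separating_overgroup G G\<^sub>0 T\<^sub>1 u\<^sub>1 Y\<^sub>1 ?L1"
    by (rule separating_overgroup_conjugate[OF u(1) Y(2) fin_gen_subgroup[OF is_group T(1)]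
          separating_overgroup_if_data[OF S(1) 1(1-3) Yc(1) 1(4) d(1), unfolded S_def]])
  moreover have "separating_overgroup G G\<^sub>0 T\<^sub>2 u\<^sub>2 Y\<^sub>2 ?L2"
    by (rule separating_overgroup_conjugate[OF u(2) Y(4) fin_gen_subgroup[OF is_group T(2)]
          separating_overgroup_if_data[OF S(2) 2(1-3) Yc(2) 2(4) d(2), unfolded S_def]])
  moreover have L: "coset_step G (conjugate_subgroup G (inv u) R) u g u \<longleftrightarrow> g \<in> R \<inter> G\<^sub>0"
    if "u \<in> carrier G" "g \<in> G\<^sub>0" for u g R
    using coset_step_conjugate[of "inv u" \<one> \<one> g R] that G\<^sub>0_carrier by (simp add: coset_step_def)
  have "\<forall>g\<in>G\<^sub>0. coset_step G ?L1 u\<^sub>1 g u\<^sub>1 \<longleftrightarrow> coset_step G ?L2 u\<^sub>2 g u\<^sub>2"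
    using L[OF u(1)] L[OF u(2)] d(3) by auto
  ultimately show ?thesis by blast
qed

end

section \<open>Gluing patterns and their completion\<close>

lemma (in group) finite_index_representatives:
  assumes K: "subgroup K G" "finite_index G K"
  shows "\<exists>R. finite R \<and> R \<subseteq> carrier G \<and> (\<forall>g\<in>carrier G. \<exists>r\<in>R. g \<otimes> inv r \<in> K)"
proof (intro exI conjI ballI)
  let ?r = "\<lambda>C. SOME x. x \<in> C"
  let ?R = "?r ` (rcosets K)"
  show "finite ?R" using K by (simp add: finite_index_def)
  have r: "?r (K #> g) \<in> K #> g" if "g \<in> carrier G" for g
    using rcos_self[OF that K(1)] by (rule someI)
  show "?R \<subseteq> carrier G"
  proof
    fix x assume "x \<in> ?R"
    then obtain g where g: "g \<in> carrier G" "x = ?r (K #> g)" by (auto simp: RCOSETS_def)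
    then have "x \<in> K #> g" using r by blast
    then show "x \<in> carrier G" using r_coset_subset_G[OF subgroup.subset[OF K(1)] g(1)] by blast
  qed
  fix g assume g: "g \<in> carrier G"
  obtain k where k: "k \<in> K" "?r (K #> g) = k \<otimes> g" using r[OF g] by (auto simp: r_coset_def)
  have "k \<in> carrier G" using K(1) k(1) by (simp add: subgroup.mem_carrier)
  then have "g \<otimes> inv (?r (K #> g)) = inv k" using g k(2) by (simp add: inv_mult_group flip: m_assoc)
  then have "g \<otimes> inv (?r (K #> g)) \<in> K" using K(1) k(1) by (simp add: subgroup.m_inv_closed)
  moreover have "K #> g \<in> rcosets K" using g K(1) by (simp add: rcosetsI subgroup.subset)
  ultimately show "\<exists>r\<in>?R. g \<otimes> inv r \<in> K" by blast
qed

text \<open>Finitely many points of a disjoint union of coset spaces \<open>T i \ G\<close>: the name \<open>x \<in> F\<close> stands for the coset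
  of \<open>el x\<close> in the space number \<open>idx x\<close>, and \<open>M\<close> pairs each point with the partners to which an
  involution is to send it.  The family \<open>T\<close> is left open because it will be enlarged while the names stay
  the same.  Partners lie in different spaces, so that the groups of the two spaces can be enlarged
  independently of each other.\<close>

locale gluing_pattern = group_with_generated_subgroup G X G\<^sub>0 X\<^sub>1 for G (structure) and X G\<^sub>0 X\<^sub>1 +
  fixes F :: "'p set" and idx :: "'p \<Rightarrow> 'i" and el :: "'p \<Rightarrow> 'a" and M :: "('p \<times> 'p) set"
  assumes finite_F: "finite F" and el: "x \<in> F \<Longrightarrow> el x \<in> carrier G"
    and M: "(x, y) \<in> M \<Longrightarrow> x \<in> F \<and> y \<in> F \<and> (y, x) \<in> M \<and> idx x \<noteq> idx y"
begin

definition moves :: "('i \<Rightarrow> 'a set) \<Rightarrow> 'p \<Rightarrow> 'a \<Rightarrow> 'p \<Rightarrow> bool" where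
  "moves T x g y \<longleftrightarrow> idx x = idx y \<and> coset_step G (T (idx x)) (el x) g (el y)"

text \<open>Different names denote different points, and passing to the partner commutes with \<open>G\<^sub>0\<close>.  For
  \<open>x = x'\<close> and \<open>y = y'\<close> the second condition says, together with the symmetry of \<open>M\<close>, that partners have the
  same \<open>G\<^sub>0\<close>-stabilizer.\<close>

definition compatible :: "('i \<Rightarrow> 'a set) \<Rightarrow> bool" where
  "compatible T \<longleftrightarrow> (\<forall>x\<in>F. \<forall>y\<in>F. moves T x \<one> y \<longrightarrow> x = y) \<and>
     (\<forall>x y x' y' g. (x, y) \<in> M \<and> (x', y') \<in> M \<and> g \<in> G\<^sub>0 \<and> moves T x g x' \<longrightarrow> moves T y g y')"

text \<open>The \<open>G\<^sub>0\<close>-stabilizer of the point \<open>x\<close>: an edge group in the graph of groups whose vertex groups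
  are the \<open>T i\<close>.\<close>

definition edge_group :: "('i \<Rightarrow> 'a set) \<Rightarrow> 'p \<Rightarrow> 'a set" where
  "edge_group T x = {g \<in> G\<^sub>0. moves T x g x}"

lemma moves_trans:
  assumes "\<And>i. subgroup (T i) G" "moves T x g y" "moves T y h z"
    "x \<in> F" "y \<in> F" "z \<in> F" "g \<in> carrier G" "h \<in> carrier G"
  shows "moves T x (g \<otimes> h) z"
  using assms coset_step_trans[of "T (idx x)" "el x" g "el y" h "el z"] el unfolding moves_def by auto

lemma moves_inv:
  assumes "\<And>i. subgroup (T i) G" "moves T x g y" "x \<in> F" "y \<in> F" "g \<in> carrier G"
  shows "moves T y (inv g) x"
  using assms coset_step_inv[of "T (idx x)" "el x" g "el y"] el unfolding moves_def by auto

lemma moves_mono: "moves T x g y \<Longrightarrow> (\<And>i. T i \<subseteq> T' i) \<Longrightarrow> moves T' x g y"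
  unfolding moves_def using coset_step_mono by blast

lemma moves_refl: "subgroup (T (idx x)) G \<Longrightarrow> x \<in> F \<Longrightarrow> moves T x \<one> x"
  unfolding moves_def using coset_step_refl el by blast

lemma subgroup_edge_group:
  assumes T: "\<And>i. subgroup (T i) G" and x: "x \<in> F"
  shows "subgroup (edge_group T x) G"
proof (rule subgroupI)
  show "edge_group T x \<subseteq> carrier G" using G\<^sub>0_carrier by (auto simp: edge_group_def)
  show "edge_group T x \<noteq> {}"
    using moves_refl[of T x, OF T x] subgroup.one_closed[OF subgroup_G\<^sub>0] unfolding edge_group_def by blast
  show "inv a \<in> edge_group T x" if "a \<in> edge_group T x" for a
    using that moves_inv[OF T _ x x] subgroup_G\<^sub>0 G\<^sub>0_carrier
    by (auto simp: edge_group_def subgroup.m_inv_closed)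
  show "a \<otimes> b \<in> edge_group T x" if "a \<in> edge_group T x" "b \<in> edge_group T x" for a b
    using that moves_trans[OF T _ _ x x x] subgroup_G\<^sub>0 G\<^sub>0_carrier
    by (auto simp: edge_group_def subgroup.m_closed)
qed

lemma subgroup_edge_group_G\<^sub>0:
  assumes T: "\<And>i. subgroup (T i) G" and x: "x \<in> F"
  shows "subgroup (edge_group T x) (G\<lparr>carrier := G\<^sub>0\<rparr>)"
  by (rule subgroup_incl[OF subgroup_edge_group[OF T x] subgroup_G\<^sub>0]) (auto simp: edge_group_def)

lemma edge_group_mono: "(\<And>i. T i \<subseteq> T' i) \<Longrightarrow> edge_group T x \<subseteq> edge_group T' x"
  unfolding edge_group_def using moves_mono by blast

text \<open>Compatibility at the points of the space that contains \<open>v\<close>, when its group is enlarged along \<open>v\<close>.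
  A new step \<open>g \<in> G\<^sub>0\<close> from \<open>x\<close> to \<open>x'\<close> is \<open>h k\<close>, where \<open>k \<in> G\<^sub>0\<close> is an old step, as no orbits are merged,
  and \<open>h\<close> fixes \<open>x\<close>.  If \<open>x\<close> is outside the \<open>G\<^sub>0\<close>-orbit of \<open>v\<close>, then \<open>h\<close> fixed \<open>x\<close> before.  Otherwise
  a conjugate of \<open>h\<close> fixes \<open>v\<close>, hence its partner \<open>w\<close>, and this is carried back to the partner of \<open>x\<close>.\<close>

lemma compatible_side:
  assumes T: "\<And>i. subgroup (T i) G" and T': "\<And>i. subgroup (T' i) G" and TT': "\<And>i. T i \<subseteq> T' i"
    and comp: "compatible T"
    and vw: "(v, w) \<in> M" "edge_group T' v \<subseteq> edge_group T' w"
    and sep: "separating_overgroup G G\<^sub>0 (T (idx v)) (el v) (el ` {x \<in> F. idx x = idx v}) (T' (idx v))"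
    and xy: "(x, y) \<in> M" "(x', y') \<in> M" "g \<in> G\<^sub>0" "moves T' x g x'" and i: "idx x = idx v"
  shows "moves T' y g y'"
proof -
  have F: "x \<in> F" "y \<in> F" "x' \<in> F" "y' \<in> F" "v \<in> F" "w \<in> F" and i': "idx x' = idx v"
    using M xy vw i by (auto simp: moves_def)
  note s0 = subgroup.m_closed[OF subgroup_G\<^sub>0] subgroup.m_inv_closed[OF subgroup_G\<^sub>0]
  have glue: "moves T b h b'" if "(a, b) \<in> M" "(a', b') \<in> M" "h \<in> G\<^sub>0" "moves T a h a'" for a b a' b' h
    using comp that unfolding compatible_def by blast
  obtain k where k: "k \<in> G\<^sub>0" "moves T x k x'"
  proof -
    have "coset_step G (T' (idx v)) (el x) g (el x')" using xy(4) unfolding moves_def i by blast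
    then have "\<exists>k\<in>G\<^sub>0. coset_step G (T (idx v)) (el x) k (el x')"
      using sep F i i' xy(3) unfolding separating_overgroup_def by blast
    then show ?thesis using that i i' by (auto simp: moves_def)
  qed
  define h where "h = g \<otimes> inv k"
  have h: "h \<in> G\<^sub>0" using xy(3) k(1) s0 by (simp add: h_def)
  have c: "g \<in> carrier G" "k \<in> carrier G" "h \<in> carrier G" using xy(3) k(1) h G\<^sub>0_carrier by auto
  have ghk: "g = h \<otimes> k" using c by (simp add: h_def m_assoc)
  have yk: "moves T' y k y'" by (rule moves_mono[OF glue[OF xy(1,2) k] TT'])
  have xh: "moves T' x h x"
  proof -
    have "moves T' x' (inv k) x" using moves_inv[OF T' moves_mono[OF k(2) TT'] F(1,3) c(2)] .
    from moves_trans[OF T' xy(4) this F(1,3,1)] show ?thesis using c by (simp add: h_def)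
  qed
  \<comment> \<open>If \<open>l \<in> G\<^sub>0\<close> leads from \<open>x\<close> to \<open>v\<close>, it leads from \<open>y\<close> to \<open>w\<close>, and \<open>l\<^sup>-\<^sup>1 h l\<close> fixes \<open>v\<close> and hence \<open>w\<close>.\<close>
  have yh: "moves T' y h y"
  proof (cases "\<exists>l\<in>G\<^sub>0. moves T x l v")
    case True
    then obtain l where l: "l \<in> G\<^sub>0" "moves T x l v" by blast
    have lc: "l \<in> carrier G" using l(1) G\<^sub>0_carrier by simp
    have xl: "moves T' x l v" using moves_mono[OF l(2) TT'] .
    have yl: "moves T' y l w" using moves_mono[OF glue[OF xy(1) vw(1) l] TT'] .
    have "moves T' v (inv l \<otimes> h) x" using moves_trans[OF T' moves_inv[OF T' xl F(1,5) lc] xh F(5,1,1)] c lc by simp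
    then have "moves T' v (inv l \<otimes> h \<otimes> l) v" using moves_trans[OF T' _ xl F(5,1,5)] c lc by simp
    moreover have "inv l \<otimes> h \<otimes> l \<in> G\<^sub>0" using h l(1) by (intro s0)
    ultimately have wl: "moves T' w (inv l \<otimes> h \<otimes> l) w" using vw(2) by (auto simp: edge_group_def)
    have "moves T' y (l \<otimes> (inv l \<otimes> h \<otimes> l)) w" using moves_trans[OF T' yl wl F(2,6,6)] c lc by simp
    from moves_trans[OF T' this moves_inv[OF T' yl F(2,6) lc] F(2,6,2)]
    show ?thesis using c lc by (simp add: m_assoc mult_inv_cancel)
  next
    case False
    have "coset_step G (T (idx v)) (el x) h (el x)"
    proof -
      have "coset_step G (T' (idx v)) (el x) h (el x)" using xh i by (simp add: moves_def)
      then have "coset_step G (T (idx v)) (el x) h (el x) \<or> (\<exists>l\<in>G\<^sub>0. coset_step G (T (idx v)) (el x) l (el v))"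
        using sep F i h unfolding separating_overgroup_def by blast
      moreover have "coset_step G (T (idx v)) (el x) l (el v) \<Longrightarrow> moves T x l v" for l
        using i by (simp add: moves_def)
      ultimately show ?thesis using False by blast
    qed
    then have "moves T x h x" using i by (simp add: moves_def)
    from glue[OF xy(1) xy(1) h this] show ?thesis by (rule moves_mono[OF _ TT'])
  qed
  show ?thesis unfolding ghk by (rule moves_trans[OF T' yh yk F(2,2,4) c(3,2)])
qed

text \<open>Compatibility makes the edge groups of \<open>v\<close> and \<open>w\<close> equal, as strong separability requires.  Only the
  groups of the two spaces containing \<open>v\<close> and \<open>w\<close> change, and \<open>compatible_side\<close> applies to either of them.\<close>

lemma complete_one_edge:
  assumes sep: "strongly_separable G X G\<^sub>0 X\<^sub>1" and T: "\<And>i. fin_gen G (T i)" and comp: "compatible T"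
    and vw: "(v, w) \<in> M" and inf: "\<not> finite_index (G\<lparr>carrier := G\<^sub>0\<rparr>) (edge_group T v)"
  shows "\<exists>T'. (\<forall>i. fin_gen G (T' i) \<and> T i \<subseteq> T' i) \<and> compatible T' \<and>
    finite_index (G\<lparr>carrier := G\<^sub>0\<rparr>) (edge_group T' v)"
proof -
  let ?Y = "\<lambda>v. el ` {x \<in> F. idx x = idx v}"
  have F: "v \<in> F" "w \<in> F" and vw': "(w, v) \<in> M" and ne: "idx v \<noteq> idx w" using M[OF vw] by auto
  have eg: "edge_group T x = {g \<in> G\<^sub>0. coset_step G (T (idx x)) (el x) g (el x)}" for T x
    by (auto simp: edge_group_def moves_def)
  have "coset_step G (T (idx v)) (el v) g (el v) \<longleftrightarrow> coset_step G (T (idx w)) (el w) g (el w)" if "g \<in> G\<^sub>0" for g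
    using comp vw vw' that unfolding compatible_def moves_def by blast
  moreover have "finite (?Y x)" "?Y x \<subseteq> carrier G" for x using finite_F el by auto
  ultimately obtain L\<^sub>1 L\<^sub>2 where L: "separating_overgroup G G\<^sub>0 (T (idx v)) (el v) (?Y v) L\<^sub>1"
      "separating_overgroup G G\<^sub>0 (T (idx w)) (el w) (?Y w) L\<^sub>2"
      "\<forall>g\<in>G\<^sub>0. coset_step G L\<^sub>1 (el v) g (el v) \<longleftrightarrow> coset_step G L\<^sub>2 (el w) g (el w)"
    using simultaneous_separating_overgroups[OF sep T T el[OF F(1)] el[OF F(2)],
        of "idx v" "idx w" "?Y v" "?Y w"] inf unfolding eg by blast
  define T' where "T' = T(idx v := L\<^sub>1, idx w := L\<^sub>2)"
  have T'i: "T' (idx v) = L\<^sub>1" "T' (idx w) = L\<^sub>2" using ne by (auto simp: T'_def)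
  have fg: "fin_gen G (T' i)" and TT': "T i \<subseteq> T' i" for i
    using T L(1,2) by (auto simp: T'_def separating_overgroup_def)
  have sT: "subgroup (T i) G" and sT': "subgroup (T' i) G" for i
    using fin_gen_subgroup[OF is_group] T fg by auto
  have sepv: "separating_overgroup G G\<^sub>0 (T (idx v)) (el v) (?Y v) (T' (idx v))"
    and sepw: "separating_overgroup G G\<^sub>0 (T (idx w)) (el w) (?Y w) (T' (idx w))"
    using L T'i by auto
  have eq: "edge_group T' v = edge_group T' w" unfolding eg T'i using L(3) by blast
  have inj: "x = y" if xy: "x \<in> F" "y \<in> F" "moves T' x \<one> y" for x y
  proof -
    have "moves T x \<one> y"
    proof (cases "idx x = idx v \<or> idx x = idx w")
      case True
      then show ?thesis
      proof
        assume i: "idx x = idx v"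
        then show ?thesis using xy sepv unfolding separating_overgroup_def moves_def by auto
      next
        assume i: "idx x = idx w"
        then show ?thesis using xy sepw unfolding separating_overgroup_def moves_def by auto
      qed
    next
      case False
      then have "T' (idx x) = T (idx x)" by (simp add: T'_def)
      then show ?thesis using xy(3) unfolding moves_def by metis
    qed
    then show ?thesis using comp xy unfolding compatible_def by blast
  qed
  have glue: "moves T' y g y'" if xy: "(x, y) \<in> M" "(x', y') \<in> M" "g \<in> G\<^sub>0" "moves T' x g x'" for x y x' y' g
  proof (cases "idx x = idx v \<or> idx x = idx w")
    case True
    then show ?thesis
    proof
      assume i: "idx x = idx v"
      show ?thesis by (rule compatible_side[OF sT sT' TT' comp vw _ sepv xy i]) (simp add: eq)
    next
      assume i: "idx x = idx w"
      show ?thesis by (rule compatible_side[OF sT sT' TT' comp vw' _ sepw xy i]) (simp add: eq)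
    qed
  next
    case False
    then have "T' (idx x) = T (idx x)" by (simp add: T'_def)
    then have "moves T x g x'" using xy(4) unfolding moves_def by metis
    then have "moves T y g y'" using comp xy unfolding compatible_def by blast
    then show ?thesis by (rule moves_mono) (rule TT')
  qed
  have "compatible T'" unfolding compatible_def using inj glue by blast
  moreover have "finite_index (G\<lparr>carrier := G\<^sub>0\<rparr>) (edge_group T' v)"
    unfolding eg using sepv by (simp add: separating_overgroup_def)
  ultimately show ?thesis using fg TT' by blast
qed

text \<open>As \<open>T\<close> grows, edge groups of finite index keep finite index; so each application of
  \<open>complete_one_edge\<close> lowers the number of points whose edge group has infinite index.\<close>

lemma complete_all_edges:
  assumes sep: "strongly_separable G X G\<^sub>0 X\<^sub>1" and T: "\<And>i. fin_gen G (T i)" and comp: "compatible T"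
  shows "\<exists>T'. (\<forall>i. fin_gen G (T' i) \<and> T i \<subseteq> T' i) \<and> compatible T' \<and>
    (\<forall>x\<in>Domain M. finite_index (G\<lparr>carrier := G\<^sub>0\<rparr>) (edge_group T' x))"
  using T comp
proof (induction "card {x \<in> Domain M. \<not> finite_index (G\<lparr>carrier := G\<^sub>0\<rparr>) (edge_group T x)}"
    arbitrary: T rule: less_induct)
  case less
  let ?inf = "\<lambda>T. {x \<in> Domain M. \<not> finite_index (G\<lparr>carrier := G\<^sub>0\<rparr>) (edge_group T x)}"
  show ?case
  proof (cases "?inf T = {}")
    case True
    then show ?thesis using less.prems by (intro exI[of _ T]) auto
  next
    case False
    then obtain v w where vw: "(v, w) \<in> M" and inf: "\<not> finite_index (G\<lparr>carrier := G\<^sub>0\<rparr>) (edge_group T v)" by blast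
    from complete_one_edge[OF sep less.prems vw inf] obtain T' where
      T': "\<And>i. fin_gen G (T' i)" "\<And>i. T i \<subseteq> T' i" "compatible T'"
        "finite_index (G\<lparr>carrier := G\<^sub>0\<rparr>) (edge_group T' v)" by blast
    have sT: "subgroup (T i) G" and sT': "subgroup (T' i) G" for i
      using fin_gen_subgroup[OF is_group] less.prems(1) T'(1) by auto
    have fin: "finite (Domain M)" by (rule finite_subset[OF _ finite_F]) (use M in blast)
    have "finite_index (G\<lparr>carrier := G\<^sub>0\<rparr>) (edge_group T' x)"
      if "x \<in> Domain M" "finite_index (G\<lparr>carrier := G\<^sub>0\<rparr>) (edge_group T x)" for x
    proof (rule group.finite_index_mono[OF group_G\<^sub>0 _ _ that(2)])
      have x: "x \<in> F" using M that(1) by blast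
      show "subgroup (edge_group T' x) (G\<lparr>carrier := G\<^sub>0\<rparr>)" "subgroup (edge_group T x) (G\<lparr>carrier := G\<^sub>0\<rparr>)"
        using subgroup_edge_group_G\<^sub>0 sT sT' x by auto
      show "edge_group T x \<subseteq> edge_group T' x" by (rule edge_group_mono) (rule T'(2))
    qed
    then have "?inf T' \<subseteq> ?inf T - {v}" using T'(4) by blast
    moreover have "v \<in> ?inf T" using vw inf by blast
    ultimately have "card (?inf T') < card (?inf T)"
      using fin by (intro psubset_card_mono) auto
    from less.hyps[OF this T'(1,3)] obtain T'' where
      "(\<forall>i. fin_gen G (T'' i) \<and> T' i \<subseteq> T'' i) \<and> compatible T'' \<and>
      (\<forall>x\<in>Domain M. finite_index (G\<lparr>carrier := G\<^sub>0\<rparr>) (edge_group T'' x))" by blast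
    then show ?thesis using T'(2) by (intro exI[of _ T'']) blast
  qed
qed

text \<open>If the edge group of \<open>x\<close> has finite index, then a step \<open>g \<in> G\<^sub>0\<close> from \<open>x\<close> is, up to an element that
  fixes \<open>x\<close>, one of finitely many representatives \<open>r\<close>.  So only finitely many elements decide which steps
  exist, and LERF provides overgroups of finite index that contain none of those that were missing
  before.\<close>

lemma finite_index_completion:
  assumes LERF: "LERF G" and sep: "strongly_separable G X G\<^sub>0 X\<^sub>1"
    and T: "\<And>i. fin_gen G (T i)" and comp: "compatible T"
  shows "\<exists>T'. (\<forall>i. subgroup (T' i) G \<and> finite_index G (T' i) \<and> T i \<subseteq> T' i) \<and> compatible T'"
proof -
  obtain U where U: "\<And>i. fin_gen G (U i)" "\<And>i. T i \<subseteq> U i" "compatible U"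
    "\<And>x. x \<in> Domain M \<Longrightarrow> finite_index (G\<lparr>carrier := G\<^sub>0\<rparr>) (edge_group U x)"
    using complete_all_edges[OF sep T comp] by blast
  have sU: "subgroup (U i) G" for i using fin_gen_subgroup[OF is_group] U(1) by auto
  have MF: "x \<in> F" if "x \<in> Domain M" for x using M that by blast
  have "\<exists>R. finite R \<and> R \<subseteq> G\<^sub>0 \<and> (\<forall>g\<in>G\<^sub>0. \<exists>r\<in>R. g \<otimes> inv r \<in> edge_group U x)" if x: "x \<in> Domain M" for x
  proof -
    obtain R where R: "finite R" "R \<subseteq> G\<^sub>0"
      "\<forall>g\<in>G\<^sub>0. \<exists>r\<in>R. g \<otimes> inv\<^bsub>G\<lparr>carrier := G\<^sub>0\<rparr>\<^esub> r \<in> edge_group U x"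
      using group.finite_index_representatives[OF group_G\<^sub>0 subgroup_edge_group_G\<^sub>0[OF sU MF[OF x]] U(4)[OF x]] by auto
    have "inv\<^bsub>G\<lparr>carrier := G\<^sub>0\<rparr>\<^esub> r = inv r" if "r \<in> R" for r
      using m_inv_consistent[OF subgroup_G\<^sub>0] R(2) that by blast
    then show ?thesis using R by (intro exI[of _ R]) fastforce
  qed
  then obtain R where R: "\<And>x. x \<in> Domain M \<Longrightarrow> finite (R x) \<and> R x \<subseteq> G\<^sub>0"
    "\<And>x g. x \<in> Domain M \<Longrightarrow> g \<in> G\<^sub>0 \<Longrightarrow> \<exists>r\<in>R x. g \<otimes> inv r \<in> edge_group U x"
    by metis
  define P where "P = (\<Union>x\<in>F. \<Union>y\<in>F. {el x \<otimes> \<one> \<otimes> inv (el y)}) \<union>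
    (\<Union>x\<in>Domain M. \<Union>y\<in>Domain M. (\<lambda>r. el x \<otimes> r \<otimes> inv (el y)) ` R x)"
  have finM: "finite (Domain M)" by (rule finite_subset[OF _ finite_F]) (use MF in blast)
  have P: "finite P" "P \<subseteq> carrier G"
  proof -
    show "finite P" using finite_F finM R(1) by (auto simp: P_def)
    have "el x \<otimes> r \<otimes> inv (el y) \<in> carrier G" if "x \<in> Domain M" "y \<in> Domain M" "r \<in> R x" for x y r
      using that R(1) G\<^sub>0_carrier el MF by (metis inv_closed m_closed subsetD)
    moreover have "el x \<otimes> \<one> \<otimes> inv (el y) \<in> carrier G" if "x \<in> F" "y \<in> F" for x y
      using that el by simp
    ultimately show "P \<subseteq> carrier G" unfolding P_def by blast
  qed
  have "\<exists>L. subgroup L G \<and> finite_index G L \<and> U i \<subseteq> L \<and> (P - U i) \<inter> L = {}" for i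
    by (rule LERF_separates[OF LERF U(1)]) (use P in auto)
  then obtain T' where T': "\<And>i. subgroup (T' i) G" "\<And>i. finite_index G (T' i)" "\<And>i. U i \<subseteq> T' i"
    "\<And>i. (P - U i) \<inter> T' i = {}"
    by metis
  have inj: "x = y" if xy: "x \<in> F" "y \<in> F" "moves T' x \<one> y" for x y
  proof -
    have "el x \<otimes> \<one> \<otimes> inv (el y) \<in> P" using xy by (auto simp: P_def)
    then have "moves U x \<one> y" using xy T'(4)[of "idx x"] unfolding moves_def coset_step_def by blast
    then show ?thesis using U(3) xy unfolding compatible_def by blast
  qed
  \<comment> \<open>Replace \<open>g\<close> by its representative \<open>r\<close>, for which the step of \<open>T'\<close> is tested by an element of \<open>P\<close>.\<close>
  have descend: "moves U x g x'" if x: "x \<in> Domain M" "x' \<in> Domain M" and g: "g \<in> G\<^sub>0" and m: "moves T' x g x'" for x x' g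
  proof -
    obtain r where r: "r \<in> R x" "g \<otimes> inv r \<in> edge_group U x" using R(2)[OF x(1) g] by blast
    have xF: "x \<in> F" "x' \<in> F" using MF x by auto
    have rc: "r \<in> carrier G" "g \<in> carrier G" using R(1)[OF x(1)] r(1) g G\<^sub>0_carrier by auto
    have e: "moves U x (g \<otimes> inv r) x" using r(2) by (simp add: edge_group_def)
    have "moves T' x (inv (g \<otimes> inv r)) x"
      by (rule moves_mono[OF moves_inv[OF sU e] T'(3)]) (use xF rc in auto)
    from moves_trans[OF T'(1) this m] have "moves T' x r x'"
      using xF rc by (simp add: inv_mult_group m_assoc)
    moreover have "el x \<otimes> r \<otimes> inv (el x') \<in> P" using x r(1) unfolding P_def by blast
    ultimately have "moves U x r x'" using T'(4)[of "idx x"] unfolding moves_def coset_step_def by blast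
    from moves_trans[OF sU e this] show ?thesis using xF rc by (simp add: m_assoc)
  qed
  have glue: "moves T' y g y'" if xy: "(x, y) \<in> M" "(x', y') \<in> M" "g \<in> G\<^sub>0" "moves T' x g x'" for x y x' y' g
  proof -
    have "moves U x g x'" using descend xy by blast
    then have "moves U y g y'" using U(3) xy unfolding compatible_def by blast
    then show ?thesis by (rule moves_mono) (rule T'(3))
  qed
  have "compatible T'" unfolding compatible_def using inj glue by blast
  moreover have "T i \<subseteq> T' i" for i using U(2) T'(3) by blast
  ultimately show ?thesis using T'(1,2) by blast
qed

end

section \<open>Actions with an involution\<close>

text \<open>For a subgroup \<open>G\<^sub>0\<close> this is the same as an action of the amalgam of \<open>G\<close> and \<open>G\<^sub>0 \<times> \<langle>\<tau>\<rangle>\<close> over \<open>G\<^sub>0\<close>,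
  where \<open>\<tau>\<close> has order two.  The double of \<open>G\<close> along \<open>G\<^sub>0\<close> is the subgroup of index two generated by \<open>G\<close> and \<open>\<tau> G \<tau>\<close>.\<close>

locale involutive_action = group G for G (structure) +
  fixes G\<^sub>0 and \<Omega> :: "'w set" and act :: "'w \<Rightarrow> 'a \<Rightarrow> 'w" and \<tau> :: "'w \<Rightarrow> 'w"
  assumes G\<^sub>0_subset: "G\<^sub>0 \<subseteq> carrier G"
    and act_closed: "\<lbrakk>x \<in> \<Omega>; g \<in> carrier G\<rbrakk> \<Longrightarrow> act x g \<in> \<Omega>"
    and act_one: "x \<in> \<Omega> \<Longrightarrow> act x \<one> = x"
    and act_mult: "\<lbrakk>x \<in> \<Omega>; g \<in> carrier G; h \<in> carrier G\<rbrakk> \<Longrightarrow> act (act x g) h = act x (g \<otimes> h)"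
    and \<tau>_closed: "x \<in> \<Omega> \<Longrightarrow> \<tau> x \<in> \<Omega>"
    and \<tau>_\<tau>: "x \<in> \<Omega> \<Longrightarrow> \<tau> (\<tau> x) = x"
    and \<tau>_act: "\<lbrakk>x \<in> \<Omega>; g \<in> G\<^sub>0\<rbrakk> \<Longrightarrow> \<tau> (act x g) = act (\<tau> x) g"
begin

lemma act_inv: "\<lbrakk>x \<in> \<Omega>; g \<in> carrier G; act x g = y\<rbrakk> \<Longrightarrow> act y (inv g) = x"
  using act_mult[of x g "inv g"] act_one[of x] by auto

text \<open>Each orbit has a base point, from which \<open>el x\<close> leads to \<open>x\<close>.  If \<open>g\<close> takes \<open>x\<close> to \<open>y\<close>, then
  \<open>el x g (el y)\<^sup>-\<^sup>1\<close> fixes the base point; let \<open>T i\<close> be generated by such elements, for the triples of the finite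
  set \<open>C2\<close>.  All steps in \<open>T i \ G\<close> are therefore true in \<open>\<Omega>\<close>.  For the converse, \<open>C2\<close> contains the
  triples of \<open>C\<close>, generators of the \<open>G\<^sub>0\<close>-stabilizers of the points of \<open>F\<close>, and one element of \<open>G\<^sub>0\<close> for each
  pair of points of \<open>F\<close> in one \<open>G\<^sub>0\<close>-orbit; the last two kinds account for all steps in \<open>G\<^sub>0\<close> between
  points of \<open>F\<close>.\<close>

lemma finite_presentation_of_points:
  assumes F: "finite F" "F \<subseteq> \<Omega>" and C: "finite C"
    and C': "\<And>x g y. (x, g, y) \<in> C \<Longrightarrow> x \<in> F \<and> y \<in> F \<and> g \<in> carrier G \<and> act x g = y"
    and stab: "\<And>x. x \<in> F \<Longrightarrow> fin_gen G {g \<in> G\<^sub>0. act x g = x}"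
    and sub0: "subgroup G\<^sub>0 G"
  obtains idx :: "'w \<Rightarrow> 'w set" and el and T where
    "\<And>i. fin_gen G (T i)" "\<And>x. x \<in> F \<Longrightarrow> el x \<in> carrier G"
    "\<And>x y. \<lbrakk>x \<in> F; y \<in> F; idx x = idx y\<rbrakk> \<Longrightarrow> \<exists>g\<in>carrier G. act x g = y"
    "\<And>x y g. \<lbrakk>x \<in> F; y \<in> F; g \<in> carrier G; act x g = y\<rbrakk> \<Longrightarrow> idx x = idx y"
    "\<And>x g y. (x, g, y) \<in> C \<Longrightarrow> coset_step G (T (idx x)) (el x) g (el y)"
    "\<And>x y g. \<lbrakk>x \<in> F; y \<in> F; g \<in> carrier G; idx x = idx y; coset_step G (T (idx x)) (el x) g (el y)\<rbrakk> \<Longrightarrow> act x g = y"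
    "\<And>x y g. \<lbrakk>x \<in> F; y \<in> F; g \<in> G\<^sub>0; act x g = y\<rbrakk> \<Longrightarrow> coset_step G (T (idx x)) (el x) g (el y)"
proof -
  define idx where "idx = (\<lambda>x. act x ` carrier G)"
  define base where "base = (\<lambda>i :: 'w set. SOME z. z \<in> i)"
  define el where "el = (\<lambda>x. SOME g. g \<in> carrier G \<and> act (base (idx x)) g = x)"
  have c0: "g \<in> carrier G" if "g \<in> G\<^sub>0" for g using that G\<^sub>0_subset by blast
  have idx_act: "idx (act x g) = idx x" if x: "x \<in> \<Omega>" and g: "g \<in> carrier G" for x g
  proof
    show "idx (act x g) \<subseteq> idx x" using x g by (auto simp: idx_def act_mult)
    show "idx x \<subseteq> idx (act x g)"
    proof
      fix y assume "y \<in> idx x"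
      then obtain h where h: "h \<in> carrier G" "y = act x h" by (auto simp: idx_def)
      then have "y = act (act x g) (inv g \<otimes> h)" using x g by (simp add: act_mult mult_inv_cancel)
      then show "y \<in> idx (act x g)" using g h by (auto simp: idx_def)
    qed
  qed
  have base: "\<exists>h\<in>carrier G. base (idx x) = act x h" if "x \<in> \<Omega>" for x
  proof -
    have "act x \<one> \<in> idx x" by (auto simp: idx_def)
    then have "base (idx x) \<in> idx x" unfolding base_def by (rule someI)
    then show ?thesis by (auto simp: idx_def)
  qed
  have el: "el x \<in> carrier G" "act (base (idx x)) (el x) = x" "base (idx x) \<in> \<Omega>" if x: "x \<in> \<Omega>" for x
  proof -
    obtain h where h: "h \<in> carrier G" "base (idx x) = act x h" using base[OF x] by blast
    have "inv h \<in> carrier G \<and> act (base (idx x)) (inv h) = x" using act_inv[OF x h(1)] h by simp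
    then have "el x \<in> carrier G \<and> act (base (idx x)) (el x) = x"
      unfolding el_def by (rule someI)
    then show "el x \<in> carrier G" "act (base (idx x)) (el x) = x" by auto
    show "base (idx x) \<in> \<Omega>" using h act_closed[OF x] by simp
  qed
  obtain K where K: "\<And>x. x \<in> F \<Longrightarrow> finite (K x) \<and> K x \<subseteq> carrier G \<and> {g \<in> G\<^sub>0. act x g = x} = generate G (K x)"
    using stab unfolding fin_gen_def by metis
  have K': "k \<in> G\<^sub>0" "act x k = x" if "x \<in> F" "k \<in> K x" for x k
    using K[OF that(1)] that(2) generate.incl[of k "K x" G] by blast+
  define h where "h = (\<lambda>x y. SOME g. g \<in> G\<^sub>0 \<and> act x g = y)"
  have h: "h x y \<in> G\<^sub>0 \<and> act x (h x y) = y" if "g \<in> G\<^sub>0" "act x g = y" for x y g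
    unfolding h_def by (rule someI[of _ g]) (use that in blast)
  define C2 where "C2 = C \<union> (\<Union>x\<in>F. (\<lambda>k. (x, k, x)) ` K x) \<union>
    (\<lambda>(x, y). (x, h x y, y)) ` {(x, y) \<in> F \<times> F. \<exists>g\<in>G\<^sub>0. act x g = y}"
  have "finite {(x, y) \<in> F \<times> F. \<exists>g\<in>G\<^sub>0. act x g = y}"
    by (rule finite_subset[of _ "F \<times> F"]) (use F in auto)
  then have C2f: "finite C2" using C F K by (simp add: C2_def)
  have C2': "x \<in> F \<and> y \<in> F \<and> g \<in> carrier G \<and> act x g = y" if c: "(x, g, y) \<in> C2" for x g y
  proof -
    consider "(x, g, y) \<in> C" | "x \<in> F" "g \<in> K x" "y = x"
      | g' where "x \<in> F" "y \<in> F" "g = h x y" "g' \<in> G\<^sub>0" "act x g' = y"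
      using c unfolding C2_def by auto
    then show ?thesis
    proof cases
      case 1
      then show ?thesis using C' by blast
    next
      case 2
      then show ?thesis using K'[OF 2(1,2)] c0 by blast
    next
      case 3
      then show ?thesis using h[OF 3(4,5)] c0 by blast
    qed
  qed
  then have C2: "x \<in> F" "y \<in> F" "g \<in> carrier G" "act x g = y" if "(x, g, y) \<in> C2" for x g y
    using that by blast+
  define A where "A = (\<lambda>i. (\<lambda>(x, g, y). el x \<otimes> g \<otimes> inv (el y)) ` {(x, g, y) \<in> C2. idx x = i})"
  define T where "T = (\<lambda>i. generate G (A i))"
  have A: "finite (A i)" "A i \<subseteq> carrier G" for i
  proof -
    have e: "el x \<otimes> g \<otimes> inv (el y) \<in> carrier G" if "(x, g, y) \<in> C2" for x g y
      using C2[OF that] el(1) F(2) by (metis inv_closed m_closed subsetD)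
    have "finite {(x, g, y) \<in> C2. idx x = i}" by (rule finite_subset[OF _ C2f]) blast
    then show "finite (A i)" by (simp add: A_def)
    show "A i \<subseteq> carrier G" using e unfolding A_def by auto
  qed
  have fg: "fin_gen G (T i)" for i using A unfolding T_def fin_gen_def by blast
  have sT: "subgroup (T i) G" for i using fin_gen_subgroup[OF is_group fg] .
  have stepC2: "coset_step G (T (idx x)) (el x) g (el y)" if "(x, g, y) \<in> C2" for x g y
  proof -
    have "el x \<otimes> g \<otimes> inv (el y) \<in> A (idx x)"
      unfolding A_def by (rule image_eqI[of _ _ "(x, g, y)"]) (use that in simp_all)
    then show ?thesis unfolding coset_step_def T_def by (rule generate.incl)
  qed
  have fixes_base: "act (base (idx x)) t = base (idx x)" if x: "x \<in> F" and t: "t \<in> T (idx x)" for x t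
  proof -
    let ?b = "base (idx x)"
    have b: "?b \<in> \<Omega>" using el F x by blast
    have "subgroup {t \<in> carrier G. act ?b t = ?b} G"
    proof (rule subgroupI)
      show "{t \<in> carrier G. act ?b t = ?b} \<noteq> {}" using act_one[OF b] by blast
      show "inv a \<in> {t \<in> carrier G. act ?b t = ?b}" if "a \<in> {t \<in> carrier G. act ?b t = ?b}" for a
        using that act_inv[OF b] by auto
      show "a \<otimes> a' \<in> {t \<in> carrier G. act ?b t = ?b}"
        if "a \<in> {t \<in> carrier G. act ?b t = ?b}" "a' \<in> {t \<in> carrier G. act ?b t = ?b}" for a a'
        using that act_mult[OF b, of a a'] by auto
    qed auto
    moreover have "A (idx x) \<subseteq> {t \<in> carrier G. act ?b t = ?b}"
    proof
      fix a assume a: "a \<in> A (idx x)"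
      then obtain y g z where e: "(y, g, z) \<in> C2" "idx y = idx x" "a = el y \<otimes> g \<otimes> inv (el z)"
        unfolding A_def by auto
      have yz: "y \<in> \<Omega>" "z \<in> \<Omega>" "g \<in> carrier G" "act y g = z" using C2[OF e(1)] F by auto
      have iz: "idx z = idx x" using idx_act[OF yz(1,3)] yz(4) e(2) by simp
      have "act ?b (el y) = y" using el(2)[OF yz(1)] e(2) by simp
      moreover have "act z (inv (el z)) = ?b" using act_inv[OF b el(1)[OF yz(2)]] el(2)[OF yz(2)] iz by simp
      ultimately have "act ?b a = ?b"
        unfolding e(3) using b el(1) yz by (simp add: act_mult[symmetric] act_closed)
      then show "a \<in> {t \<in> carrier G. act ?b t = ?b}" using a A(2) by blast
    qed
    ultimately show ?thesis using t generate_subgroup_incl unfolding T_def by blast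
  qed
  show thesis
  proof
    show "fin_gen G (T i)" for i by (rule fg)
    show "el x \<in> carrier G" if "x \<in> F" for x using el F that by blast
    show "\<exists>g\<in>carrier G. act x g = y" if xy: "x \<in> F" "y \<in> F" "idx x = idx y" for x y
    proof -
      have "act y \<one> \<in> idx x" using xy(3) by (auto simp: idx_def)
      then show ?thesis using act_one[of y] F(2) xy(2) unfolding idx_def by (metis imageE subsetD)
    qed
    show "idx x = idx y" if "x \<in> F" "y \<in> F" "g \<in> carrier G" "act x g = y" for x y g
      using idx_act[of x g] that F by auto
    show "coset_step G (T (idx x)) (el x) g (el y)" if "(x, g, y) \<in> C" for x g y
      by (rule stepC2) (use that in \<open>simp add: C2_def\<close>)
    show "act x g = y" if xy: "x \<in> F" "y \<in> F" "g \<in> carrier G" "idx x = idx y"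
      and st: "coset_step G (T (idx x)) (el x) g (el y)" for x y g
    proof -
      let ?b = "base (idx x)"
      have xy': "x \<in> \<Omega>" "y \<in> \<Omega>" using xy F by auto
      have ec: "el x \<in> carrier G" "el y \<in> carrier G" using el xy' by auto
      have b: "?b \<in> \<Omega>" using el(3)[OF xy'(1)] .
      have t: "act ?b (el x \<otimes> g \<otimes> inv (el y)) = ?b" using fixes_base[OF xy(1)] st by (simp add: coset_step_def)
      have "act x g = act ?b (el x \<otimes> g)" using el(2)[OF xy'(1)] act_mult[OF b ec(1) xy(3)] by simp
      also have "el x \<otimes> g = (el x \<otimes> g \<otimes> inv (el y)) \<otimes> el y" using ec xy(3) by (simp add: m_assoc)
      also have "act ?b \<dots> = act ?b (el y)" using act_mult[OF b, of "el x \<otimes> g \<otimes> inv (el y)" "el y"] ec xy(3) t by simp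
      finally show ?thesis using el(2)[OF xy'(2)] xy(4) by simp
    qed
    show "coset_step G (T (idx x)) (el x) g (el y)" if xy: "x \<in> F" "y \<in> F" "g \<in> G\<^sub>0" "act x g = y" for x y g
    proof -
      have xy': "x \<in> \<Omega>" "y \<in> \<Omega>" using xy F by auto
      have ec: "el x \<in> carrier G" "el y \<in> carrier G" using el xy' by auto
      have hh: "h x y \<in> G\<^sub>0" "act x (h x y) = y" using h[OF xy(3,4)] by auto
      have hc: "h x y \<in> carrier G" "g \<in> carrier G" using c0 hh(1) xy(3) by blast+
      have "(x, y) \<in> {(x, y) \<in> F \<times> F. \<exists>g\<in>G\<^sub>0. act x g = y}" using xy by blast
      then have "(x, h x y, y) \<in> C2" unfolding C2_def by (intro UnI2) (rule image_eqI[of _ _ "(x, y)"], simp_all)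
      note s1 = stepC2[OF this]
      have "act x (g \<otimes> inv (h x y)) = x"
        using act_mult[OF xy'(1) hc(2)] act_inv[OF xy'(1) hc(1) hh(2)] xy(4) hc by simp
      moreover have "g \<otimes> inv (h x y) \<in> G\<^sub>0" using sub0 xy(3) hh(1) by (simp add: subgroup.m_closed subgroup.m_inv_closed)
      ultimately have "g \<otimes> inv (h x y) \<in> generate G (K x)" using K[OF xy(1)] by blast
      moreover have "K x \<subseteq> conjugate_subgroup G (el x) (T (idx x))"
      proof
        fix k assume k: "k \<in> K x"
        then have "(x, k, x) \<in> C2" using xy(1) unfolding C2_def by blast
        from stepC2[OF this] show "k \<in> conjugate_subgroup G (el x) (T (idx x))"
          using K[OF xy(1)] k by (auto simp: conjugate_subgroup_def coset_step_def)
      qed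
      moreover have "subgroup (conjugate_subgroup G (el x) (T (idx x))) G"
        using fin_gen_subgroup[OF is_group fin_gen_conjugate_subgroup[OF fg ec(1)]] .
      ultimately have "g \<otimes> inv (h x y) \<in> conjugate_subgroup G (el x) (T (idx x))"
        using generate_subgroup_incl by blast
      then have "coset_step G (T (idx x)) (el x) (g \<otimes> inv (h x y)) (el x)"
        by (simp add: conjugate_subgroup_def coset_step_def)
      from coset_step_trans[OF sT this s1 ec(1,1,2)] show ?thesis using hc by (simp add: m_assoc)
    qed
  qed
qed

end

context gluing_pattern
begin

text \<open>The pairs in \<open>M\<close> and their translates by \<open>G\<^sub>0\<close> form a symmetric \<open>G\<^sub>0\<close>-invariant relation \<open>N\<close>, which is
  single-valued by compatibility.  The involution follows \<open>N\<close> where it can and is the identity elsewhere.\<close>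

lemma glued_coset_space:
  assumes T: "\<And>i. subgroup (T i) G" "\<And>i. finite_index G (T i)" and comp: "compatible T"
  obtains Z :: "('i \<times> 'a set) set" and act \<tau> f where
    "finite Z" "involutive_action G G\<^sub>0 Z act \<tau>" "f ` F \<subseteq> Z" "inj_on f F"
    "\<And>x g y. \<lbrakk>x \<in> F; y \<in> F; g \<in> carrier G; moves T x g y\<rbrakk> \<Longrightarrow> act (f x) g = f y"
    "\<And>x y. (x, y) \<in> M \<Longrightarrow> \<tau> (f x) = f y"
proof -
  define Z where "Z = (SIGMA i:idx ` F. rcosets (T i))"
  define act where "act = (\<lambda>(i :: 'i, c) g. (i, c #> g))"
  define f where "f = (\<lambda>x. (idx x, T (idx x) #> el x))"
  define N where "N = {(act (f x) g, act (f y) g) | x y g. (x, y) \<in> M \<and> g \<in> G\<^sub>0}"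
  define \<tau> where "\<tau> = (\<lambda>z. if z \<in> Domain N then THE w. (z, w) \<in> N else z)"
  have Tc: "T i \<subseteq> carrier G" for i using T(1) by (rule subgroup.subset)
  have cc: "c \<subseteq> carrier G" if "c \<in> rcosets (T i)" for c i
    using subgroup.rcosets_carrier[OF T(1) is_group that] .
  have act1: "act z g \<in> Z" if "z \<in> Z" "g \<in> carrier G" for z g
    using that rcosets_step[OF T(1)] by (auto simp: Z_def act_def)
  have act2: "act z \<one> = z" if "z \<in> Z" for z
    using that cc by (fastforce simp: Z_def act_def coset_mult_one)
  have act3: "act (act z g) h = act z (g \<otimes> h)" if "z \<in> Z" "g \<in> carrier G" "h \<in> carrier G" for z g h
    using that cc by (auto simp: Z_def act_def coset_mult_assoc)
  have fZ: "f x \<in> Z" if "x \<in> F" for x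
    using that el Tc by (auto simp: Z_def f_def rcosetsI)
  have fstep: "act (f x) g = f y \<longleftrightarrow> moves T x g y" if "x \<in> F" "y \<in> F" "g \<in> carrier G" for x y g
    using that el coset_step_iff[OF T(1), of "el x" "el y" g "idx x"] Tc
    by (auto simp: act_def f_def moves_def coset_mult_assoc)
  have fstep2: "act (f x) g = act (f y) h \<longleftrightarrow> moves T x (g \<otimes> inv h) y"
    if "x \<in> F" "y \<in> F" "g \<in> carrier G" "h \<in> carrier G" for x y g h
  proof -
    have "act (f x) g = act (f y) h \<longleftrightarrow> act (act (f x) g) (inv h) = f y"
    proof
      assume "act (f x) g = act (f y) h"
      then show "act (act (f x) g) (inv h) = f y" using that fZ act2 act3 by simp
    next
      assume a: "act (act (f x) g) (inv h) = f y"
      have "act (act (act (f x) g) (inv h)) h = act (f x) g"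
        using that fZ act1 act3[of "f x" "g \<otimes> inv h" h] act3[of "f x" g "inv h"] by (simp add: m_assoc)
      then show "act (f x) g = act (f y) h" using a by simp
    qed
    then show ?thesis using that fZ act3 fstep by simp
  qed
  have G0: "g \<otimes> inv h \<in> G\<^sub>0" if "g \<in> G\<^sub>0" "h \<in> G\<^sub>0" for g h
    using that subgroup_G\<^sub>0 by (simp add: subgroup.m_closed subgroup.m_inv_closed)
  have N_unique: "w = w'" if zw: "(z, w) \<in> N" and zw': "(z, w') \<in> N" for z w w'
  proof -
    obtain x y g where 1: "z = act (f x) g" "w = act (f y) g" "(x, y) \<in> M" "g \<in> G\<^sub>0" using zw unfolding N_def by blast
    obtain x' y' h where 2: "z = act (f x') h" "w' = act (f y') h" "(x', y') \<in> M" "h \<in> G\<^sub>0" using zw' unfolding N_def by blast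
    have F': "x \<in> F" "y \<in> F" "x' \<in> F" "y' \<in> F" using M 1 2 by auto
    have "moves T x (g \<otimes> inv h) x'" using fstep2 1 2 F' G\<^sub>0_carrier by metis
    then have "moves T y (g \<otimes> inv h) y'"
      using comp 1(3) 2(3) G0[OF 1(4) 2(4)] unfolding compatible_def by blast
    then show ?thesis using fstep2[OF F'(2,4)] 1 2 G\<^sub>0_carrier by simp
  qed
  have \<tau>N: "\<tau> z = w" if "(z, w) \<in> N" for z w
  proof -
    have "(THE w. (z, w) \<in> N) = w" by (rule the_equality) (use that N_unique in auto)
    then show ?thesis using that by (auto simp: \<tau>_def)
  qed
  have \<tau>0: "\<tau> z = z" if "z \<notin> Domain N" for z using that by (simp add: \<tau>_def)
  have N_sym: "(w, z) \<in> N" if "(z, w) \<in> N" for z w using that M unfolding N_def by blast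
  have N_Z: "z \<in> Z" if "(z, w) \<in> N" for z w
    using that M fZ act1 G\<^sub>0_carrier unfolding N_def by blast
  have N_act: "(act z h, act w h) \<in> N" if zw: "(z, w) \<in> N" and h: "h \<in> G\<^sub>0" for z w h
  proof -
    obtain x y g where 1: "z = act (f x) g" "w = act (f y) g" "(x, y) \<in> M" "g \<in> G\<^sub>0" using zw unfolding N_def by blast
    have "x \<in> F" "y \<in> F" using M 1 by auto
    then have "act z h = act (f x) (g \<otimes> h)" "act w h = act (f y) (g \<otimes> h)"
      using 1 h fZ act3 G\<^sub>0_carrier by auto
    moreover have "g \<otimes> h \<in> G\<^sub>0" using 1(4) h subgroup_G\<^sub>0 by (simp add: subgroup.m_closed)
    ultimately show ?thesis using 1(3) unfolding N_def by blast
  qed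
  have "involutive_action G G\<^sub>0 Z act \<tau>"
  proof
    show "G\<^sub>0 \<subseteq> carrier G" using G\<^sub>0_carrier by blast
    fix z assume z: "z \<in> Z"
    show "act z \<one> = z" by (rule act2[OF z])
    show "act z g \<in> Z" if "g \<in> carrier G" for g by (rule act1[OF z that])
    show "act (act z g) h = act z (g \<otimes> h)" if "g \<in> carrier G" "h \<in> carrier G" for g h
      by (rule act3[OF z that])
    show "\<tau> z \<in> Z"
    proof (cases "z \<in> Domain N")
      case True
      then obtain w where "(z, w) \<in> N" by blast
      then show ?thesis using \<tau>N N_Z[OF N_sym] by simp
    qed (simp add: \<tau>0 z)
    show "\<tau> (\<tau> z) = z"
    proof (cases "z \<in> Domain N")
      case True
      then obtain w where w: "(z, w) \<in> N" by blast
      show ?thesis unfolding \<tau>N[OF w] by (rule \<tau>N[OF N_sym[OF w]])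
    qed (simp add: \<tau>0)
    show "\<tau> (act z g) = act (\<tau> z) g" if g: "g \<in> G\<^sub>0" for g
    proof (cases "z \<in> Domain N")
      case True
      then obtain w where w: "(z, w) \<in> N" by blast
      then show ?thesis using \<tau>N[OF w] \<tau>N[OF N_act[OF w g]] by simp
    next
      case False
      have gc: "g \<in> carrier G" "inv g \<in> G\<^sub>0" using g G\<^sub>0_carrier subgroup_G\<^sub>0 by (auto simp: subgroup.m_inv_closed)
      have "act z g \<notin> Domain N"
      proof
        assume "act z g \<in> Domain N"
        then obtain w where "(act z g, w) \<in> N" by blast
        from N_act[OF this gc(2)] have "(z, act w (inv g)) \<in> N"
          using act3[OF z] act2[OF z] gc by simp
        then show False using False by blast
      qed
      then show ?thesis using \<tau>0 False by simp
    qed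
  qed
  moreover have "finite Z"
    unfolding Z_def using finite_F T(2) by (auto simp: finite_index_def)
  moreover have "f ` F \<subseteq> Z" using fZ by blast
  moreover have "inj_on f F"
  proof (rule inj_onI)
    fix x y assume xy: "x \<in> F" "y \<in> F" "f x = f y"
    then have "moves T x \<one> y" using fstep[OF xy(1,2) one_closed] act2[OF fZ[OF xy(2)]] by simp
    then show "x = y" using comp xy unfolding compatible_def by blast
  qed
  moreover have "\<tau> (f x) = f y" if xy: "(x, y) \<in> M" for x y
  proof -
    have "x \<in> F" "y \<in> F" using M[OF xy] by auto
    then have "(f x, f y) \<in> N"
      unfolding N_def using xy act2 fZ subgroup.one_closed[OF subgroup_G\<^sub>0]
      by (intro CollectI exI[of _ x] exI[of _ y] exI[of _ \<one>]) simp
    then show ?thesis by (rule \<tau>N)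
  qed
  ultimately show thesis using fstep by (intro that[of Z act \<tau> f]) simp_all
qed

end

locale involutive_action_generated =
  group_with_generated_subgroup G X G\<^sub>0 X\<^sub>1 + involutive_action G G\<^sub>0 \<Omega> act \<tau>
  for G (structure) and X G\<^sub>0 X\<^sub>1 \<Omega> act \<tau>
begin

text \<open>Pairing the points of \<open>F\<close> by \<open>\<tau>\<close> gives a gluing pattern; it is compatible because \<open>\<tau>\<close>
  commutes with \<open>G\<^sub>0\<close> and because the presentation of the points is faithful for steps in \<open>G\<^sub>0\<close>.\<close>

lemma finite_approximation:
  assumes LERF: "LERF G" and sep: "strongly_separable G X G\<^sub>0 X\<^sub>1"
    and stab: "\<And>x. x \<in> \<Omega> \<Longrightarrow> fin_gen G {g \<in> G\<^sub>0. act x g = x}"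
    and flip: "\<And>x g. \<lbrakk>x \<in> \<Omega>; g \<in> carrier G\<rbrakk> \<Longrightarrow> act x g \<noteq> \<tau> x"
    and F: "finite F" "F \<subseteq> \<Omega>" "\<tau> ` F \<subseteq> F" and C: "finite C"
    and C': "\<And>x g y. (x, g, y) \<in> C \<Longrightarrow> x \<in> F \<and> y \<in> F \<and> g \<in> carrier G \<and> act x g = y"
  obtains Z :: "('c set \<times> 'a set) set" and act' \<tau>' f where
    "finite Z" "involutive_action G G\<^sub>0 Z act' \<tau>'" "f ` F \<subseteq> Z" "inj_on f F"
    "\<And>x g y. (x, g, y) \<in> C \<Longrightarrow> act' (f x) g = f y" "\<And>x. x \<in> F \<Longrightarrow> \<tau>' (f x) = f (\<tau> x)"
proof -
  have stabF: "fin_gen G {g \<in> G\<^sub>0. act x g = x}" if "x \<in> F" for x using stab F(2) that by blast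
  obtain idx :: "'c \<Rightarrow> 'c set" and el T where
    T: "\<And>i. fin_gen G (T i)" and el: "\<And>x. x \<in> F \<Longrightarrow> el x \<in> carrier G"
    and orb: "\<And>x y. \<lbrakk>x \<in> F; y \<in> F; idx x = idx y\<rbrakk> \<Longrightarrow> \<exists>g\<in>carrier G. act x g = y"
    and orb': "\<And>x y g. \<lbrakk>x \<in> F; y \<in> F; g \<in> carrier G; act x g = y\<rbrakk> \<Longrightarrow> idx x = idx y"
    and TC: "\<And>x g y. (x, g, y) \<in> C \<Longrightarrow> coset_step G (T (idx x)) (el x) g (el y)"
    and st: "\<And>x y g. \<lbrakk>x \<in> F; y \<in> F; g \<in> carrier G; idx x = idx y; coset_step G (T (idx x)) (el x) g (el y)\<rbrakk> \<Longrightarrow> act x g = y"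
    and st0: "\<And>x y g. \<lbrakk>x \<in> F; y \<in> F; g \<in> G\<^sub>0; act x g = y\<rbrakk> \<Longrightarrow> coset_step G (T (idx x)) (el x) g (el y)"
  proof (rule finite_presentation_of_points[OF F(1,2) C], goal_cases)
    case (1 x g y)
    show ?case by (rule C'[OF 1(2)])
  next
    case (2 x)
    show ?case by (rule stabF[OF 2(2)])
  next
    case 3
    show ?case by (rule subgroup_G\<^sub>0)
  next
    case (4 idx el T)
    show ?case by (rule 4(1)[of T el idx, OF 4(2-)])
  qed
  define M where "M = (\<lambda>x. (x, \<tau> x)) ` F"
  interpret gluing_pattern G X G\<^sub>0 X\<^sub>1 F idx el M
  proof
    show "finite F" by (rule F)
    show "el x \<in> carrier G" if "x \<in> F" for x by (rule el[OF that])
    fix x y assume "(x, y) \<in> M"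
    then have xy: "x \<in> F" "y = \<tau> x" by (auto simp: M_def)
    then have y: "y \<in> F" "\<tau> y = x" using F \<tau>_\<tau> by auto
    moreover have "idx x \<noteq> idx y" using orb[OF xy(1) y(1)] flip xy F(2) by blast
    ultimately show "x \<in> F \<and> y \<in> F \<and> (y, x) \<in> M \<and> idx x \<noteq> idx y"
      using xy(1) unfolding M_def by force
  qed
  have mv: "moves T x g y \<longleftrightarrow> act x g = y" if "x \<in> F" "y \<in> F" "g \<in> G\<^sub>0" for x y g
    using st[OF that(1,2) G\<^sub>0_carrier[OF that(3)]] st0[OF that] orb'[OF that(1,2) G\<^sub>0_carrier[OF that(3)]]
    unfolding moves_def by blast
  have "compatible T"
    unfolding compatible_def
  proof (intro conjI ballI allI impI)
    fix x y assume "x \<in> F" "y \<in> F" "moves T x \<one> y"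
    then show "x = y" using mv[OF _ _ subgroup.one_closed[OF subgroup_G\<^sub>0]] act_one F by auto
  next
    fix x y x' y' g assume a: "(x, y) \<in> M \<and> (x', y') \<in> M \<and> g \<in> G\<^sub>0 \<and> moves T x g x'"
    then have xy: "x \<in> F" "y = \<tau> x" "x' \<in> F" "y' = \<tau> x'" by (auto simp: M_def)
    then have "act x g = x'" using mv a by blast
    then have "act y g = y'" using \<tau>_act[of x g] xy a F by auto
    moreover have "y \<in> F" "y' \<in> F" using xy F(3) by auto
    ultimately show "moves T y g y'" using mv a by blast
  qed
  then obtain T' where T': "\<And>i. subgroup (T' i) G" "\<And>i. finite_index G (T' i)" "\<And>i. T i \<subseteq> T' i" "compatible T'"
    using finite_index_completion[of T, OF LERF sep T] by blast
  obtain Z :: "('c set \<times> 'a set) set" and act' \<tau>' f where Z: "finite Z" "involutive_action G G\<^sub>0 Z act' \<tau>'" "f ` F \<subseteq> Z" "inj_on f F"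
    "\<And>x g y. \<lbrakk>x \<in> F; y \<in> F; g \<in> carrier G; moves T' x g y\<rbrakk> \<Longrightarrow> act' (f x) g = f y"
    "\<And>x y. (x, y) \<in> M \<Longrightarrow> \<tau>' (f x) = f y"
  proof (rule glued_coset_space[OF T'(1,2,4)], goal_cases)
    case (1 Z act \<tau> f)
    show ?case by (rule 1(1)[of Z act \<tau> f, OF 1(2-)])
  qed
  show thesis
  proof (rule that[OF Z(1-4)])
    show "act' (f x) g = f y" if c: "(x, g, y) \<in> C" for x g y
    proof (rule Z(5))
      show "x \<in> F" "y \<in> F" "g \<in> carrier G" using C'[OF c] by auto
      have "moves T x g y" using TC[OF c] orb' C'[OF c] unfolding moves_def by blast
      then show "moves T' x g y" by (rule moves_mono) (rule T'(3))
    qed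
    show "\<tau>' (f x) = f (\<tau> x)" if "x \<in> F" for x
      by (rule Z(6)) (use that in \<open>auto simp: M_def\<close>)
  qed
qed

end

section \<open>Actions of the double\<close>

text \<open>With \<open>\<beta> = \<alpha>\<^sup>-\<^sup>1\<close> this is the action of the double in which \<open>\<alpha> g\<close> acts as \<open>\<tau> g \<tau>\<close>; it respects
  the relations of the amalgam by \<open>word_act_cong\<close> below.\<close>

fun word_act :: "('z \<Rightarrow> 'a \<Rightarrow> 'z) \<Rightarrow> ('z \<Rightarrow> 'z) \<Rightarrow> ('b \<Rightarrow> 'a) \<Rightarrow> 'z \<Rightarrow> ('a + 'b) list \<Rightarrow> 'z" where
  "word_act act \<tau> \<beta> z [] = z"
| "word_act act \<tau> \<beta> z (Inl g # w) = word_act act \<tau> \<beta> (act z g) w"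
| "word_act act \<tau> \<beta> z (Inr h # w) = word_act act \<tau> \<beta> (\<tau> (act (\<tau> z) (\<beta> h))) w"

lemma word_act_append: "word_act act \<tau> \<beta> z (u @ v) = word_act act \<tau> \<beta> (word_act act \<tau> \<beta> z u) v"
  by (induction act \<tau> \<beta> z u rule: word_act.induct) simp_all

fun word_value :: "('a, 'm) monoid_scheme \<Rightarrow> ('b \<Rightarrow> 'a) \<Rightarrow> ('a + 'b) list \<Rightarrow> 'a" where
  "word_value G \<beta> [] = \<one>\<^bsub>G\<^esub>"
| "word_value G \<beta> (Inl g # w) = g \<otimes>\<^bsub>G\<^esub> word_value G \<beta> w"
| "word_value G \<beta> (Inr h # w) = \<beta> h \<otimes>\<^bsub>G\<^esub> word_value G \<beta> w"

lemma amalg_class_eq_iff: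
  assumes "v \<in> amalg_words A B"
  shows "amalg_class A B C \<phi> u = amalg_class A B C \<phi> v \<longleftrightarrow> amalg_eq A B C \<phi> u v"
proof
  assume "amalg_class A B C \<phi> u = amalg_class A B C \<phi> v"
  moreover have "v \<in> amalg_class A B C \<phi> v" using assms by (simp add: amalg_class_def amalg_eq.refl)
  ultimately have "v \<in> amalg_class A B C \<phi> u" by simp
  then show "amalg_eq A B C \<phi> u v" by (simp add: amalg_class_def)
qed (rule amalg_class_eqI)

locale double_group = group_with_generated_subgroup G X G\<^sub>0 X\<^sub>1 + H: group H
  for G (structure) and X G\<^sub>0 X\<^sub>1 and H :: "('b, 'n) monoid_scheme" +
  fixes \<alpha> :: "'a \<Rightarrow> 'b"
  assumes \<alpha>_iso: "\<alpha> \<in> iso G H"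
begin

abbreviation "cls \<equiv> amalg_class G H G\<^sub>0 \<alpha>"
abbreviation "words \<equiv> amalg_words G H"
abbreviation "D \<equiv> double G G\<^sub>0 H \<alpha>"
abbreviation "\<iota> \<equiv> double_incl G G\<^sub>0 H \<alpha>"

definition \<beta> :: "'b \<Rightarrow> 'a" where "\<beta> = inv_into (carrier G) \<alpha>"

lemma \<alpha>_closed: "g \<in> carrier G \<Longrightarrow> \<alpha> g \<in> carrier H"
  using \<alpha>_iso by (auto simp: iso_def bij_betw_def)

lemma \<alpha>_mult: "g \<in> carrier G \<Longrightarrow> g' \<in> carrier G \<Longrightarrow> \<alpha> (g \<otimes> g') = \<alpha> g \<otimes>\<^bsub>H\<^esub> \<alpha> g'"
  using \<alpha>_iso by (auto simp: iso_def hom_def)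

lemma \<beta>_\<alpha>: "g \<in> carrier G \<Longrightarrow> \<beta> (\<alpha> g) = g"
  using \<alpha>_iso by (simp add: \<beta>_def iso_def bij_betw_def)

lemma \<alpha>_\<beta>: "h \<in> carrier H \<Longrightarrow> \<alpha> (\<beta> h) = h"
  using \<alpha>_iso by (simp add: \<beta>_def iso_def bij_betw_def f_inv_into_f)

lemma \<beta>_hom: "\<beta> \<in> hom H G"
  using iso_set_sym[OF \<alpha>_iso] by (simp add: \<beta>_def iso_def)

lemma \<beta>_closed: "h \<in> carrier H \<Longrightarrow> \<beta> h \<in> carrier G"
  using \<beta>_hom by (auto simp: hom_def)

lemma \<beta>_mult: "h \<in> carrier H \<Longrightarrow> h' \<in> carrier H \<Longrightarrow> \<beta> (h \<otimes>\<^bsub>H\<^esub> h') = \<beta> h \<otimes> \<beta> h'"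
  using \<beta>_hom by (auto simp: hom_def)

lemma \<beta>_one: "\<beta> \<one>\<^bsub>H\<^esub> = \<one>"
  using hom_one[OF \<beta>_hom H.is_group is_group] .

lemma \<alpha>_one: "\<alpha> \<one> = \<one>\<^bsub>H\<^esub>"
  using \<alpha>_\<beta>[OF H.one_closed] \<beta>_one by simp

lemma group_D: "group D"
  unfolding double_def by (rule group_amalgam[OF is_group H.is_group])

sublocale D: group D
  by (rule group_D)

lemma carrier_D: "carrier D = cls ` words"
  by (simp add: double_def amalgam_def)

lemma one_D: "\<one>\<^bsub>D\<^esub> = cls []"
  by (simp add: double_def amalgam_def)

lemma mult_D: "u \<in> words \<Longrightarrow> v \<in> words \<Longrightarrow> cls u \<otimes>\<^bsub>D\<^esub> cls v = cls (u @ v)"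
  unfolding double_def by (rule amalg_mult_class)

lemma words_simps [simp]: "[] \<in> words" "Inl g # w \<in> words \<longleftrightarrow> g \<in> carrier G \<and> w \<in> words"
    "Inr h # w \<in> words \<longleftrightarrow> h \<in> carrier H \<and> w \<in> words"
    "u @ v \<in> words \<longleftrightarrow> u \<in> words \<and> v \<in> words"
  by (auto simp: amalg_words_def)

lemma amalg_eq_words: "amalg_eq G H G\<^sub>0 \<alpha> u v \<Longrightarrow> u \<in> words \<and> v \<in> words"
  by (induction rule: amalg_eq.induct) (auto simp: G\<^sub>0_carrier \<alpha>_closed)

lemma word_value_closed: "w \<in> words \<Longrightarrow> word_value G \<beta> w \<in> carrier G"
proof (induction w)
  case (Cons x w)
  then show ?case by (cases x) (auto simp: \<beta>_closed)
qed simp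

lemma word_value_append: "u \<in> words \<Longrightarrow> v \<in> words \<Longrightarrow>
    word_value G \<beta> (u @ v) = word_value G \<beta> u \<otimes> word_value G \<beta> v"
proof (induction u)
  case (Cons x u)
  then show ?case by (cases x) (auto simp: \<beta>_closed word_value_closed m_assoc)
qed (simp add: word_value_closed)

lemma word_value_cong: "amalg_eq G H G\<^sub>0 \<alpha> u v \<Longrightarrow> word_value G \<beta> u = word_value G \<beta> v"
proof (induction rule: amalg_eq.induct)
  case (append u u' v v')
  then show ?case using amalg_eq_words word_value_append by metis
qed (auto simp: \<beta>_one \<beta>_mult \<beta>_closed \<beta>_\<alpha> G\<^sub>0_carrier)

text \<open>The folding map of the double onto \<open>G\<close>, given by the identity on \<open>G\<close> and by \<open>\<alpha>\<^sup>-\<^sup>1\<close> on \<open>H\<close>.\<close>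

definition retraction :: "('a + 'b) list set \<Rightarrow> 'a" where
  "retraction P = word_value G \<beta> (SOME u. u \<in> P)"

lemma SOME_class: "u \<in> words \<Longrightarrow> amalg_eq G H G\<^sub>0 \<alpha> u (SOME v. v \<in> cls u)"
  using someI[of "\<lambda>v. v \<in> cls u" u] by (simp add: amalg_class_def amalg_eq.refl)

lemma retraction_class: "u \<in> words \<Longrightarrow> retraction (cls u) = word_value G \<beta> u"
  using word_value_cong[OF SOME_class] by (simp add: retraction_def)

lemma retraction_hom: "retraction \<in> hom D G"
proof (rule homI)
  fix x assume "x \<in> carrier D"
  then show "retraction x \<in> carrier G" by (auto simp: carrier_D retraction_class word_value_closed)
next
  fix x y assume "x \<in> carrier D" "y \<in> carrier D"
  then show "retraction (x \<otimes>\<^bsub>D\<^esub> y) = retraction x \<otimes> retraction y"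
    by (auto simp: carrier_D mult_D retraction_class word_value_append)
qed

lemma retraction_incl: "g \<in> carrier G \<Longrightarrow> retraction (\<iota> g) = g"
  by (simp add: double_incl_def retraction_class)

lemma incl_closed: "g \<in> carrier G \<Longrightarrow> \<iota> g \<in> carrier D"
  by (simp add: double_incl_def carrier_D)

end

locale double_action = double_group G X G\<^sub>0 X\<^sub>1 H \<alpha> + involutive_action G G\<^sub>0 \<Omega> act \<tau>
  for G (structure) and X G\<^sub>0 X\<^sub>1 and H :: "('b, 'n) monoid_scheme" and \<alpha>
    and \<Omega> :: "'w set" and act \<tau>
begin

sublocale involutive_action_generated G X G\<^sub>0 X\<^sub>1 \<Omega> act \<tau> ..

abbreviation "wact \<equiv> word_act act \<tau> \<beta>"

lemma word_act_closed: "w \<in> words \<Longrightarrow> z \<in> \<Omega> \<Longrightarrow> wact z w \<in> \<Omega>"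
proof (induction w arbitrary: z)
  case (Cons x w)
  then show ?case by (cases x) (auto simp: \<beta>_closed act_closed \<tau>_closed)
qed simp

lemma word_act_cong: "amalg_eq G H G\<^sub>0 \<alpha> u v \<Longrightarrow> z \<in> \<Omega> \<Longrightarrow> wact z u = wact z v"
proof (induction arbitrary: z rule: amalg_eq.induct)
  case (append u u' v v')
  then show ?case using amalg_eq_words word_act_closed word_act_append by metis
qed (auto simp: act_one act_mult act_closed \<tau>_closed \<tau>_\<tau> \<tau>_act \<beta>_one \<beta>_mult \<beta>_closed \<beta>_\<alpha> G\<^sub>0_carrier)

definition stabilizer :: "'w \<Rightarrow> ('a + 'b) list set set" where
  "stabilizer z = cls ` {w \<in> words. wact z w = z}"

lemma stabilizer_iff: "w \<in> words \<Longrightarrow> z \<in> \<Omega> \<Longrightarrow> cls w \<in> stabilizer z \<longleftrightarrow> wact z w = z"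
  using word_act_cong unfolding stabilizer_def by (auto simp: amalg_class_eq_iff)

lemma inv_class: "u \<in> words \<Longrightarrow> \<exists>v\<in>words. inv\<^bsub>D\<^esub> (cls u) = cls v"
  using D.inv_closed[of "cls u"] by (auto simp: carrier_D)

lemma word_act_inv:
  assumes u: "u \<in> words" "v \<in> words" "inv\<^bsub>D\<^esub> (cls u) = cls v" and z: "z \<in> \<Omega>"
  shows "wact (wact z u) v = z"
proof -
  have "cls (u @ v) = cls []" using u D.r_inv[of "cls u"] by (simp add: carrier_D mult_D one_D)
  then have "amalg_eq G H G\<^sub>0 \<alpha> (u @ v) []" by (simp add: amalg_class_eq_iff)
  from word_act_cong[OF this z] show ?thesis by (simp add: word_act_append)
qed

lemma subgroup_stabilizer: "z \<in> \<Omega> \<Longrightarrow> subgroup (stabilizer z) D"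
proof (rule D.subgroupI)
  assume z: "z \<in> \<Omega>"
  show "stabilizer z \<subseteq> carrier D" by (auto simp: stabilizer_def carrier_D)
  show "stabilizer z \<noteq> {}" using z stabilizer_iff[of "[]"] by auto
  show "inv\<^bsub>D\<^esub> a \<in> stabilizer z" if "a \<in> stabilizer z" for a
  proof -
    obtain u where u: "u \<in> words" "a = cls u" "wact z u = z" using \<open>a \<in> stabilizer z\<close> by (auto simp: stabilizer_def)
    obtain v where v: "v \<in> words" "inv\<^bsub>D\<^esub> (cls u) = cls v" using inv_class[OF u(1)] by blast
    then show ?thesis using word_act_inv[OF u(1) v z] u(2,3) stabilizer_iff[OF v(1) z] by simp
  qed
  show "a \<otimes>\<^bsub>D\<^esub> b \<in> stabilizer z" if ab: "a \<in> stabilizer z" "b \<in> stabilizer z" for a b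
  proof -
    obtain u v where uv: "u \<in> words" "a = cls u" "wact z u = z" "v \<in> words" "b = cls v" "wact z v = z"
      using ab by (auto simp: stabilizer_def)
    then show ?thesis using stabilizer_iff[of "u @ v", OF _ z] by (simp add: mult_D word_act_append)
  qed
qed

lemma finite_index_stabilizer:
  assumes z: "z \<in> \<Omega>" and fin: "finite \<Omega>"
  shows "finite_index D (stabilizer z)"
proof (rule D.finite_index_if_finite_map[OF subgroup_stabilizer[OF z] fin, of "\<lambda>P. wact z (SOME u. u \<in> P)"])
  have S: "wact z (SOME v. v \<in> cls u) = wact z u" if "u \<in> words" for u
    using word_act_cong[OF SOME_class[OF that] z] by simp
  show "wact z (SOME u. u \<in> P) \<in> \<Omega>" if "P \<in> carrier D" for P
    using that S word_act_closed z by (auto simp: carrier_D)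
  fix x y assume xy: "x \<in> carrier D" "y \<in> carrier D" "wact z (SOME u. u \<in> x) = wact z (SOME u. u \<in> y)"
  then obtain u v where uv: "u \<in> words" "v \<in> words" "x = cls u" "y = cls v" by (auto simp: carrier_D)
  obtain v' where v': "v' \<in> words" "inv\<^bsub>D\<^esub> (cls v) = cls v'" using inv_class[OF uv(2)] by blast
  have "wact z u = wact z v" using xy(3) S uv by simp
  then have "wact z (u @ v') = z" using word_act_inv[OF uv(2) v' z] by (simp add: word_act_append)
  then show "x \<otimes>\<^bsub>D\<^esub> inv\<^bsub>D\<^esub> y \<in> stabilizer z"
    using stabilizer_iff[of "u @ v'", OF _ z] uv v' by (simp add: mult_D)
qed

text \<open>Apply \<open>finite_approximation\<close> to the points \<open>V\<close> that prefixes of the words in \<open>W\<close> reach from \<open>p\<close> and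
  to their images under \<open>\<tau>\<close>, with one triple in \<open>C\<close> for each letter that is read.  By induction on the
  prefixes, words in \<open>W\<close> then trace the image of the same path; as the approximation is injective on the
  points, it also detects which words return to \<open>p\<close>.\<close>

lemma finite_word_action:
  assumes LERF: "LERF G" and sep: "strongly_separable G X G\<^sub>0 X\<^sub>1"
    and stab: "\<And>x. x \<in> \<Omega> \<Longrightarrow> fin_gen G {g \<in> G\<^sub>0. act x g = x}"
    and flip: "\<And>x g. \<lbrakk>x \<in> \<Omega>; g \<in> carrier G\<rbrakk> \<Longrightarrow> act x g \<noteq> \<tau> x"
    and p: "p \<in> \<Omega>" and W: "finite W" "W \<subseteq> words"
  obtains Z :: "('w set \<times> 'a set) set" and act' \<tau>' q where
    "finite Z" "involutive_action G G\<^sub>0 Z act' \<tau>'" "q \<in> Z"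
    "\<And>w. w \<in> W \<Longrightarrow> word_act act' \<tau>' \<beta> q w = q \<longleftrightarrow> wact p w = p"
proof -
  define V where "V = insert p (\<Union>w\<in>W. (\<lambda>n. wact p (take n w)) ` {..length w})"
  define F where "F = V \<union> \<tau> ` V"
  define constraint where "constraint = (\<lambda>z (l :: 'a + 'b). case l of
      Inl g \<Rightarrow> (z, g, act z g) | Inr h \<Rightarrow> (\<tau> z, \<beta> h, act (\<tau> z) (\<beta> h)))"
  define C where "C = (\<Union>w\<in>W. (\<lambda>n. constraint (wact p (take n w)) (w ! n)) ` {..<length w})"
  have take_words: "take n w \<in> words" if "w \<in> W" for n w
    using that W(2) words_simps(4)[of "take n w" "drop n w"] by auto
  have V: "V \<subseteq> \<Omega>" using p take_words word_act_closed by (auto simp: V_def)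
  have letter: "w ! n \<in> carrier G <+> carrier H" if "w \<in> W" "n < length w" for w n
    using that W(2) by (auto simp: amalg_words_def)
  have next_point: "wact p (take (Suc n) w) = wact (wact p (take n w)) [w ! n]" if "n < length w" for n w
    using that by (simp add: take_Suc_conv_app_nth word_act_append)
  have VI: "wact p (take n w) \<in> V" if "w \<in> W" "n \<le> length w" for w n
    using that by (auto simp: V_def)
  have F: "finite F" "F \<subseteq> \<Omega>" "\<tau> ` F \<subseteq> F"
  proof -
    show "finite F" using W(1) by (simp add: F_def V_def)
    show "F \<subseteq> \<Omega>" using V \<tau>_closed by (auto simp: F_def)
    have "\<tau> (\<tau> z) \<in> F" if "z \<in> V" for z using that V \<tau>_\<tau>[of z] by (auto simp: F_def)
    then show "\<tau> ` F \<subseteq> F" by (auto simp: F_def)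
  qed
  have C: "x \<in> F \<and> y \<in> F \<and> g \<in> carrier G \<and> act x g = y" if c: "(x, g, y) \<in> C" for x g y
  proof -
    obtain w n where w: "w \<in> W" "n < length w" "(x, g, y) = constraint (wact p (take n w)) (w ! n)"
      using c unfolding C_def by blast
    let ?z = "wact p (take n w)" and ?z' = "wact p (take (Suc n) w)"
    have z: "?z \<in> V" "?z' \<in> V" using VI w by auto
    show ?thesis
    proof (cases "w ! n")
      case (Inl l)
      then have "x = ?z" "g = l" "y = ?z'" "act x g = y" "l \<in> carrier G"
        using w(3) letter[OF w(1,2)] next_point[OF w(2)] by (auto simp: constraint_def)
      then show ?thesis using z by (auto simp: F_def)
    next
      case (Inr l)
      then have e: "x = \<tau> ?z" "g = \<beta> l" "act x g = y" "l \<in> carrier H" "?z' = \<tau> y"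
        using w(3) letter[OF w(1,2)] next_point[OF w(2)] by (auto simp: constraint_def)
      then have "y = \<tau> ?z'" using \<tau>_\<tau> act_closed \<tau>_closed \<beta>_closed z V by auto
      then show ?thesis using e z \<beta>_closed by (auto simp: F_def)
    qed
  qed
  have "finite C" using W(1) by (simp add: C_def)
  obtain Z :: "('w set \<times> 'a set) set" and act' \<tau>' f where
    Z: "finite Z" "involutive_action G G\<^sub>0 Z act' \<tau>'" "f ` F \<subseteq> Z" "inj_on f F"
    "\<And>x g y. (x, g, y) \<in> C \<Longrightarrow> act' (f x) g = f y" "\<And>x. x \<in> F \<Longrightarrow> \<tau>' (f x) = f (\<tau> x)"
  proof (rule finite_approximation[OF LERF sep stab flip F \<open>finite C\<close>], goal_cases)
    case (4 x g y)
    show ?case by (rule C[OF 4(2)])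
  next
    case (5 Z act' \<tau>' f)
    show ?case by (rule 5(1)[of Z act' \<tau>' f, OF 5(2-)])
  qed auto
  have trace: "word_act act' \<tau>' \<beta> (f p) (take n w) = f (wact p (take n w))" if w: "w \<in> W" and "n \<le> length w" for n w
    using that(2)
  proof (induction n)
    case (Suc n)
    then have n: "n < length w" by simp
    let ?z = "wact p (take n w)" and ?z' = "wact p (take (Suc n) w)"
    have IH: "word_act act' \<tau>' \<beta> (f p) (take n w) = f ?z" using Suc by simp
    have z: "?z \<in> F" "\<tau> ?z \<in> F" using VI[OF w] n by (auto simp: F_def)
    have c: "constraint ?z (w ! n) \<in> C" unfolding C_def using w n by blast
    have "word_act act' \<tau>' \<beta> (f p) (take (Suc n) w) = word_act act' \<tau>' \<beta> (f ?z) [w ! n]"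
      using n IH by (simp add: take_Suc_conv_app_nth word_act_append)
    also have "\<dots> = f ?z'"
    proof (cases "w ! n")
      case (Inl l)
      then have "(?z, l, act ?z l) \<in> C" using c by (simp add: constraint_def)
      from Z(5)[OF this] show ?thesis unfolding next_point[OF n] Inl by simp
    next
      case (Inr l)
      then have cC: "(\<tau> ?z, \<beta> l, act (\<tau> ?z) (\<beta> l)) \<in> C" using c by (simp add: constraint_def)
      have "act (\<tau> ?z) (\<beta> l) \<in> F" using C[OF cC] by blast
      then show ?thesis unfolding next_point[OF n] Inr using Z(5)[OF cC] Z(6) z by simp
    qed
    finally show ?case .
  qed simp
  have pF: "p \<in> F" by (simp add: F_def V_def)
  show thesis
  proof (rule that[OF Z(1,2)])
    show "f p \<in> Z" using pF Z(3) by blast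
    show "word_act act' \<tau>' \<beta> (f p) w = f p \<longleftrightarrow> wact p w = p" if w: "w \<in> W" for w
    proof -
      have "wact p w \<in> F" using VI[OF w, of "length w"] by (simp add: F_def)
      then have "f (wact p w) = f p \<longleftrightarrow> wact p w = p" using inj_on_eq_iff[OF Z(4) _ pF] by blast
      then show ?thesis using trace[OF w, of "length w"] by simp
    qed
  qed
qed

end

section \<open>Closed subgroups of the double\<close>

context double_group
begin

lemma conj_coset_iff:
  assumes "d \<in> carrier D" "K \<subseteq> carrier D" "x \<in> carrier D"
  shows "x \<in> (d <#\<^bsub>D\<^esub> K) #>\<^bsub>D\<^esub> inv\<^bsub>D\<^esub> d \<longleftrightarrow> inv\<^bsub>D\<^esub> d \<otimes>\<^bsub>D\<^esub> x \<otimes>\<^bsub>D\<^esub> d \<in> K"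
proof
  assume "x \<in> (d <#\<^bsub>D\<^esub> K) #>\<^bsub>D\<^esub> inv\<^bsub>D\<^esub> d"
  then obtain k where k: "k \<in> K" "x = d \<otimes>\<^bsub>D\<^esub> k \<otimes>\<^bsub>D\<^esub> inv\<^bsub>D\<^esub> d" by (auto simp: l_coset_def r_coset_def)
  moreover have "k \<in> carrier D" using k assms by blast
  ultimately show "inv\<^bsub>D\<^esub> d \<otimes>\<^bsub>D\<^esub> x \<otimes>\<^bsub>D\<^esub> d \<in> K"
    using assms by (simp add: D.m_assoc D.inv_mult_cancel)
next
  assume k: "inv\<^bsub>D\<^esub> d \<otimes>\<^bsub>D\<^esub> x \<otimes>\<^bsub>D\<^esub> d \<in> K"
  have "x = d \<otimes>\<^bsub>D\<^esub> (inv\<^bsub>D\<^esub> d \<otimes>\<^bsub>D\<^esub> x \<otimes>\<^bsub>D\<^esub> d) \<otimes>\<^bsub>D\<^esub> inv\<^bsub>D\<^esub> d"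
    using assms by (simp add: D.m_assoc D.mult_inv_cancel)
  then show "x \<in> (d <#\<^bsub>D\<^esub> K) #>\<^bsub>D\<^esub> inv\<^bsub>D\<^esub> d" using k unfolding l_coset_def r_coset_def by blast
qed

text \<open>On the two copies of \<open>S \ D\<close> that make up \<open>\<Omega>\<close>, \<open>G\<close> acts through its inclusion in \<open>D\<close> and through
  \<open>\<alpha>\<close>, so that a word \<open>w\<close> acts on the first copy as right multiplication by its class (fact \<open>word\<close>).
  The \<open>G\<^sub>0\<close>-stabilizer of a point \<open>S y\<close> is conjugate in \<open>D\<close> to \<open>S \<inter> y G\<^sub>0 y\<^sup>-\<^sup>1\<close>; as \<open>G\<^sub>0\<close> embeds in \<open>D\<close>, with
  the folding map as left inverse, it is finitely generated in \<open>G\<close>.  Partners lie in different copies and hence in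
  different \<open>G\<close>-orbits.\<close>

theorem closed_if_conjugate_intersections_fin_gen:
  assumes LERF: "LERF G" and sep: "strongly_separable G X G\<^sub>0 X\<^sub>1"
    and S: "fin_gen D S"
    and conj: "\<And>d. d \<in> carrier D \<Longrightarrow> fin_gen D (S \<inter> ((d <#\<^bsub>D\<^esub> (\<iota> ` G\<^sub>0)) #>\<^bsub>D\<^esub> inv\<^bsub>D\<^esub> d))"
  shows "closedin (profinite_topology D) S"
proof (rule D.closed_subgroup_if_separated)
  show sS: "subgroup S D" by (rule fin_gen_subgroup[OF group_D S])
  fix d assume d: "d \<in> carrier D" "d \<notin> S"
  define \<Omega> where "\<Omega> = (rcosets\<^bsub>D\<^esub> S) \<times> (UNIV :: bool set)"
  define act where "act = (\<lambda>(c, b) g. (c #>\<^bsub>D\<^esub> (if b then cls [Inl g] else cls [Inr (\<alpha> g)]), b))"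
  define \<tau> where "\<tau> = (\<lambda>(c :: ('a + 'b) list set set, b). (c, \<not> b))"
  let ?e = "\<lambda>b g. if b then cls [Inl g] else cls [Inr (\<alpha> g)]"
  have e: "?e b g \<in> carrier D" if "g \<in> carrier G" for b g
    using that \<alpha>_closed by (simp add: carrier_D)
  have e1: "?e b \<one> = \<one>\<^bsub>D\<^esub>" for b
    using amalg_class_eqI[OF amalg_eq.one_left, of G H G\<^sub>0 \<alpha>] amalg_class_eqI[OF amalg_eq.one_right, of G H G\<^sub>0 \<alpha>]
    by (simp add: one_D \<alpha>_one)
  have e2: "?e b g \<otimes>\<^bsub>D\<^esub> ?e b h = ?e b (g \<otimes> h)" if "g \<in> carrier G" "h \<in> carrier G" for b g h
    using that \<alpha>_closed \<alpha>_mult amalg_class_eqI[OF amalg_eq.mult_left[OF that, of H G\<^sub>0 \<alpha>]]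
      amalg_class_eqI[OF amalg_eq.mult_right[OF \<alpha>_closed[OF that(1)] \<alpha>_closed[OF that(2)], of G G\<^sub>0 \<alpha>]]
    by (simp add: mult_D)
  have e3: "?e b g = ?e b' g" if "g \<in> G\<^sub>0" for b b' g
    using amalg_class_eqI[OF amalg_eq.glue[OF that, of G H \<alpha>]] by simp
  have cc: "c \<subseteq> carrier D" if "c \<in> rcosets\<^bsub>D\<^esub> S" for c
    using subgroup.rcosets_carrier[OF sS group_D that] .
  have action: "involutive_action G G\<^sub>0 \<Omega> act \<tau>"
  proof
    show "G\<^sub>0 \<subseteq> carrier G" using G\<^sub>0_carrier by blast
    fix x assume x: "x \<in> \<Omega>"
    obtain c b where cb: "x = (c, b)" "c \<in> rcosets\<^bsub>D\<^esub> S" using x by (auto simp: \<Omega>_def)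
    have c: "c \<subseteq> carrier D" using cc cb by blast
    show "act x g \<in> \<Omega>" if "g \<in> carrier G" for g
      using D.rcosets_step[OF sS cb(2) e[OF that]] by (simp add: cb(1) act_def \<Omega>_def)
    show "act x \<one> = x" using e1[of b] D.coset_mult_one[OF c] by (simp add: cb(1) act_def)
    show "act (act x g) h = act x (g \<otimes> h)" if "g \<in> carrier G" "h \<in> carrier G" for g h
      using D.coset_mult_assoc[OF c e[OF that(1), of b] e[OF that(2), of b]] e2[OF that, of b]
      by (simp add: cb(1) act_def)
    show "\<tau> x \<in> \<Omega>" "\<tau> (\<tau> x) = x" using cb by (auto simp: \<tau>_def \<Omega>_def)
    show "\<tau> (act x g) = act (\<tau> x) g" if "g \<in> G\<^sub>0" for g
      using e3[OF that, of b "\<not> b"] by (simp add: cb(1) act_def \<tau>_def)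
  qed
  interpret double_action G X G\<^sub>0 X\<^sub>1 H \<alpha> \<Omega> act \<tau>
    by (rule double_action.intro[OF double_group_axioms action])
  have word: "wact (c, True) w = (c #>\<^bsub>D\<^esub> cls w, True)" if "w \<in> words" "c \<in> rcosets\<^bsub>D\<^esub> S" for c w
    using that
  proof (induction w arbitrary: c)
    case Nil
    then show ?case using D.coset_mult_one[OF cc] by (simp add: one_D)
  next
    case (Cons l w)
    have w: "w \<in> words" "cls w \<in> carrier D" using Cons.prems by (cases l; simp add: carrier_D)+
    have l: "[l] \<in> words" using Cons.prems by (cases l) auto
    then have lD: "cls [l] \<in> carrier D" by (simp add: carrier_D)
    have "wact (c, True) [l] = (c #>\<^bsub>D\<^esub> cls [l], True)"
      using l by (cases l) (auto simp: act_def \<tau>_def \<alpha>_\<beta>)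
    then have "wact (c, True) (l # w) = wact (c #>\<^bsub>D\<^esub> cls [l], True) w"
      using word_act_append[of act \<tau> \<beta> "(c, True)" "[l]" w] by simp
    also have "\<dots> = (c #>\<^bsub>D\<^esub> cls [l] #>\<^bsub>D\<^esub> cls w, True)"
      using Cons.IH[OF w(1) D.rcosets_step[OF sS Cons.prems(2) lD]] .
    also have "c #>\<^bsub>D\<^esub> cls [l] #>\<^bsub>D\<^esub> cls w = c #>\<^bsub>D\<^esub> cls (l # w)"
      using D.coset_mult_assoc[OF cc[OF Cons.prems(2)] lD w(2)] mult_D[OF l w(1)] by simp
    finally show ?case .
  qed
  have SS: "S \<in> rcosets\<^bsub>D\<^esub> S"
    using D.rcosetsI[OF subgroup.subset[OF sS] D.one_closed] D.coset_mult_one[OF subgroup.subset[OF sS]] by simp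
  then have p: "(S, True) \<in> \<Omega>" by (simp add: \<Omega>_def)
  have base: "wact (S, True) w = (S, True) \<longleftrightarrow> cls w \<in> S" if w: "w \<in> words" for w
  proof -
    have "cls w \<in> carrier D" using w by (simp add: carrier_D)
    then have "S #>\<^bsub>D\<^esub> cls w = S \<longleftrightarrow> cls w \<in> S" using D.coset_join1[OF _ _ sS] D.coset_join2[OF _ sS] by blast
    then show ?thesis using word[OF w SS] by simp
  qed
  have stab: "fin_gen G {g \<in> G\<^sub>0. act x g = x}" if x: "x \<in> \<Omega>" for x
  proof -
    obtain c b where cb: "x = (c, b)" "c \<in> rcosets\<^bsub>D\<^esub> S" using x by (auto simp: \<Omega>_def)
    obtain y where y: "y \<in> carrier D" "c = S #>\<^bsub>D\<^esub> y" using cb(2) by (auto simp: RCOSETS_def)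
    let ?I = "S \<inter> ((y <#\<^bsub>D\<^esub> (\<iota> ` G\<^sub>0)) #>\<^bsub>D\<^esub> inv\<^bsub>D\<^esub> y)"
    have \<iota>c: "\<iota> ` G\<^sub>0 \<subseteq> carrier D" using incl_closed G\<^sub>0_carrier by blast
    have fix_iff: "act x g = x \<longleftrightarrow> coset_step D S y (\<iota> g) y" if "g \<in> G\<^sub>0" for g
    proof -
      have "act x g = (c #>\<^bsub>D\<^esub> \<iota> g, b)"
        using e3[OF that, of b True] by (simp add: act_def cb(1) double_incl_def)
      then show ?thesis
        using D.coset_step_iff[OF sS y(1) y(1) incl_closed[OF G\<^sub>0_carrier[OF that]]] cb(1) y
          D.coset_mult_assoc[OF subgroup.subset[OF sS] y(1) incl_closed[OF G\<^sub>0_carrier[OF that]]] by simp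
    qed
    have "retraction ` conjugate_subgroup D y ?I = {g \<in> G\<^sub>0. act x g = x}"
    proof
      show "retraction ` conjugate_subgroup D y ?I \<subseteq> {g \<in> G\<^sub>0. act x g = x}"
      proof
        fix g assume "g \<in> retraction ` conjugate_subgroup D y ?I"
        then obtain z where z: "g = retraction z" "z \<in> carrier D" "y \<otimes>\<^bsub>D\<^esub> z \<otimes>\<^bsub>D\<^esub> inv\<^bsub>D\<^esub> y \<in> ?I"
          by (auto simp: conjugate_subgroup_def)
        then have "inv\<^bsub>D\<^esub> y \<otimes>\<^bsub>D\<^esub> (y \<otimes>\<^bsub>D\<^esub> z \<otimes>\<^bsub>D\<^esub> inv\<^bsub>D\<^esub> y) \<otimes>\<^bsub>D\<^esub> y \<in> \<iota> ` G\<^sub>0"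
          using conj_coset_iff[OF y(1) \<iota>c] y(1) by blast
        then have "z \<in> \<iota> ` G\<^sub>0" using y(1) z(2) by (simp add: D.m_assoc D.inv_mult_cancel)
        then obtain k where k: "k \<in> G\<^sub>0" "z = \<iota> k" by blast
        then have "g = k" using z(1) retraction_incl G\<^sub>0_carrier by simp
        then show "g \<in> {g \<in> G\<^sub>0. act x g = x}" using k z(3) fix_iff[OF k(1)] by (simp add: coset_step_def)
      qed
      show "{g \<in> G\<^sub>0. act x g = x} \<subseteq> retraction ` conjugate_subgroup D y ?I"
      proof
        fix g assume "g \<in> {g \<in> G\<^sub>0. act x g = x}"
        then have g: "g \<in> G\<^sub>0" "coset_step D S y (\<iota> g) y" using fix_iff by auto
        have gD: "\<iota> g \<in> carrier D" using g(1) \<iota>c by blast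
        have "y \<otimes>\<^bsub>D\<^esub> \<iota> g \<otimes>\<^bsub>D\<^esub> inv\<^bsub>D\<^esub> y \<in> (y <#\<^bsub>D\<^esub> (\<iota> ` G\<^sub>0)) #>\<^bsub>D\<^esub> inv\<^bsub>D\<^esub> y"
          using g(1) by (auto simp: l_coset_def r_coset_def)
        then have "\<iota> g \<in> conjugate_subgroup D y ?I"
          using g(2) gD by (simp add: conjugate_subgroup_def coset_step_def)
        moreover have "g = retraction (\<iota> g)" using retraction_incl G\<^sub>0_carrier g(1) by simp
        ultimately show "g \<in> retraction ` conjugate_subgroup D y ?I" by blast
      qed
    qed
    moreover have "fin_gen G (retraction ` conjugate_subgroup D y ?I)"
      by (rule fin_gen_hom_image[OF group_D is_group retraction_hom D.fin_gen_conjugate_subgroup[OF conj[OF y(1)] y(1)]])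
    ultimately show ?thesis by simp
  qed
  have flip: "act x g \<noteq> \<tau> x" for x g by (cases x) (simp add: act_def \<tau>_def)
  obtain A where A: "finite A" "A \<subseteq> carrier D" "S = generate D A" using S by (auto simp: fin_gen_def)
  have "\<forall>a\<in>insert d A. \<exists>w. w \<in> words \<and> a = cls w" using A(2) d(1) by (auto simp: carrier_D)
  then obtain r where r: "\<And>a. a \<in> insert d A \<Longrightarrow> r a \<in> words \<and> a = cls (r a)" by metis
  have W: "finite (r ` insert d A)" "r ` insert d A \<subseteq> words" using A(1) r by auto
  obtain Z :: "((('a + 'b) list set set \<times> bool) set \<times> 'a set) set" and act' \<tau>' q where
    Z: "finite Z" "involutive_action G G\<^sub>0 Z act' \<tau>'" "q \<in> Z"
      "\<And>w. w \<in> r ` insert d A \<Longrightarrow> word_act act' \<tau>' \<beta> q w = q \<longleftrightarrow> wact (S, True) w = (S, True)"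
    using finite_word_action[OF LERF sep stab flip p W] by blast
  interpret Z: double_action G X G\<^sub>0 X\<^sub>1 H \<alpha> Z act' \<tau>'
    by (rule double_action.intro[OF double_group_axioms Z(2)])
  have Zstab: "a \<in> Z.stabilizer q \<longleftrightarrow> a \<in> S" if a: "a \<in> insert d A" for a
    using Z.stabilizer_iff[of "r a" q] Z(3) Z(4)[of "r a"] base[of "r a"] r[OF a] a by auto
  show "\<exists>L. subgroup L D \<and> finite_index D L \<and> S \<subseteq> L \<and> d \<notin> L"
  proof (intro exI conjI)
    show L: "subgroup (Z.stabilizer q) D" by (rule Z.subgroup_stabilizer[OF Z(3)])
    show "finite_index D (Z.stabilizer q)" by (rule Z.finite_index_stabilizer[OF Z(3,1)])
    have "A \<subseteq> Z.stabilizer q" using Zstab A(3) generate.incl[of _ A D] by blast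
    then show "S \<subseteq> Z.stabilizer q" unfolding A(3) using D.generate_subgroup_incl L by blast
    show "d \<notin> Z.stabilizer q" using Zstab d(2) by blast
  qed
qed

text \<open>Conjugation by \<open>d\<close> reduces the claim to the intersection of \<open>K\<close> with \<open>d\<^sup>-\<^sup>1 S d\<close>.\<close>

lemma fgip_conjugate:
  assumes fgip: "fgip D K" and S: "fin_gen D S" and d: "d \<in> carrier D"
  shows "fin_gen D (S \<inter> ((d <#\<^bsub>D\<^esub> K) #>\<^bsub>D\<^esub> inv\<^bsub>D\<^esub> d))"
proof -
  have K: "K \<subseteq> carrier D" using fgip by (simp add: fgip_def subgroup.subset)
  have Sc: "S \<subseteq> carrier D" using fin_gen_subgroup[OF group_D S] by (rule subgroup.subset)
  have "fin_gen D (K \<inter> conjugate_subgroup D d S)"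
    using fgip D.fin_gen_conjugate_subgroup[OF S d] by (simp add: fgip_def)
  then have "fin_gen D (conjugate_subgroup D (inv\<^bsub>D\<^esub> d) (K \<inter> conjugate_subgroup D d S))"
    by (rule D.fin_gen_conjugate_subgroup) (simp add: d)
  moreover have "x \<in> conjugate_subgroup D (inv\<^bsub>D\<^esub> d) (K \<inter> conjugate_subgroup D d S) \<longleftrightarrow>
      x \<in> S \<inter> ((d <#\<^bsub>D\<^esub> K) #>\<^bsub>D\<^esub> inv\<^bsub>D\<^esub> d)" for x
  proof (cases "x \<in> carrier D")
    case True
    have "d \<otimes>\<^bsub>D\<^esub> (inv\<^bsub>D\<^esub> d \<otimes>\<^bsub>D\<^esub> x \<otimes>\<^bsub>D\<^esub> d) \<otimes>\<^bsub>D\<^esub> inv\<^bsub>D\<^esub> d = x"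
      using True d by (simp add: D.m_assoc D.mult_inv_cancel)
    then show ?thesis using True d conj_coset_iff[OF d K True] by (auto simp: conjugate_subgroup_def)
  next
    case False
    then show ?thesis using Sc by (auto simp: conjugate_subgroup_def)
  qed
  ultimately show ?thesis by (metis subsetI subset_antisym)
qed

end

theorem theorem4p4:
  fixes G :: "('a, 'm) monoid_scheme" and H :: "('b, 'n) monoid_scheme"
    and X X\<^sub>1 G\<^sub>0 :: "'a set" and \<alpha> :: "'a \<Rightarrow> 'b"
  assumes "group G" and "group H" and "\<alpha> \<in> iso G H"
    and "LERF G"
    and "X \<subseteq> carrier G" and "generate G X = carrier G"
    and "finite X\<^sub>1" and "X\<^sub>1 \<subseteq> X" and "generate G X\<^sub>1 = G\<^sub>0"
    and "strongly_separable G X G\<^sub>0 X\<^sub>1"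
  shows "(\<forall>S. fin_gen (double G G\<^sub>0 H \<alpha>) S \<and>
            (\<forall>d\<in>carrier (double G G\<^sub>0 H \<alpha>).
               fin_gen (double G G\<^sub>0 H \<alpha>)
                 (S \<inter> ((d <#\<^bsub>double G G\<^sub>0 H \<alpha>\<^esub> (double_incl G G\<^sub>0 H \<alpha> ` G\<^sub>0))
                        #>\<^bsub>double G G\<^sub>0 H \<alpha>\<^esub> inv\<^bsub>double G G\<^sub>0 H \<alpha>\<^esub> d)))
            \<longrightarrow> closedin (profinite_topology (double G G\<^sub>0 H \<alpha>)) S)
       \<and> (fgip (double G G\<^sub>0 H \<alpha>) (double_incl G G\<^sub>0 H \<alpha> ` G\<^sub>0) \<longrightarrow> LERF (double G G\<^sub>0 H \<alpha>))"
proof -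
  interpret double_group G X G\<^sub>0 X\<^sub>1 H \<alpha>
    by (intro double_group.intro group_with_generated_subgroup.intro double_group_axioms.intro
        group_with_generated_subgroup_axioms.intro assms)
  note closed = closed_if_conjugate_intersections_fin_gen[OF assms(4,10)]
  show ?thesis
    unfolding LERF_def using closed fgip_conjugate by blast
qed

end
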